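(* Let $\Bbbk$ be a field of characteristic zero, let $A$ be a smooth associative unital $\Bbbk$-algebra, and let $V$ be a finite-dimensional $\Bbbk$-vector space. Let $\omega\in \operatorname{DR}^2_{\mathrm{nc}}(A)$ be a bi-symplectic form on $A$. Then the induced $2$-form $(\omega)_V:=\operatorname{Tr}(\widehat{\omega})\in\Omega^2_{\mathrm{comm}}(A_V)$ on the representation scheme $\operatorname{Rep}(A,V)=\operatorname{Spec}A_V$ is symplectic; that is, $(\omega)_V$ is closed for the de Rham differential, and it is non-degenerate in the sense that the $A_V$-module map $$\operatorname{Der}(A_V)\longrightarrow \Omega^1_{\mathrm{comm}}(A_V),\qquad \theta\longmapsto i_\theta\big((\omega)_V\big),$$ given by contraction, is an isomorphism.
   Context: Conventions. $\otimes=\otimes_{\Bbbk}$; algebras are associative, unital and finitely generated over $\Bbbk$. $A^{\mathrm{op}}$ is the opposite algebra, $A^{\mathrm e}=A\otimes A^{\mathrm{op}}$, and $A$-bimodules are identified with left $A^{\mathrm e}$-modules. The bimodule $A\otimes A$ has an outer structure $a_1(a\otimes b)b_1=(a_1a)\otimes(bb_1)$ and an inner structure $a_1*(a\otimes b)*b_1=(ab_1)\otimes(a_1b)$. Noncommutative forms. $\Omega^1_{\mathrm{nc}}A$ is the kernel of the multiplication map $A\otimes A\to A$, an $A$-bimodule (sub-bimodule for the outer structure), with universal derivation $d\colon A\to\Omega^1_{\mathrm{nc}}A$, $da=1\otimes a-a\otimes 1$. $A$ is smooth if it is finitely generated over $\Bbbk$ and $\Omega^1_{\mathrm{nc}}A$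 is a projective $A^{\mathrm e}$-module. $\Omega^\bullet_{\mathrm{nc}}A=T_A(\Omega^1_{\mathrm{nc}}A)$ is the tensor algebra, a differential graded algebra with $d$ extended by the graded Leibniz rule and $d^2=0$. The Karoubi--de Rham complex is $\operatorname{DR}^\bullet_{\mathrm{nc}}(A)=\Omega^\bullet_{\mathrm{nc}}A/[\Omega^\bullet_{\mathrm{nc}}A,\Omega^\bullet_{\mathrm{nc}}A]$ (quotient by the linear span of graded commutators), with the induced differential $d$. Double derivations. $\mathbb{D}\mathrm{er}A$ is the space of $\Bbbk$-linear derivations $\Theta\colon A\to A\otimes A$, where $A\otimes A$ has the outer structure; it is an $A$-bimodule via the inner structure. For $\Theta\in\mathbb{D}\mathrm{er}A$, let $i_\Theta\colon\Omega^1_{\mathrm{nc}}A\to A\otimes A$ be the unique bimodule map (outer structure) with $i_\Theta(da)=\Theta(a)$, written in Sweedler notation $i_\Theta\alpha=i'_\Theta\alpha\otimes i''_\Theta\alpha$. The reduced contraction on $2$-forms is, for $\alpha_1,\alpha_2\in\Omega^1_{\mathrm{nc}}A$, $$\iota_\Theta(\alpha_1\alpha_2)=(i''_\Theta\alpha_1)\,\alpha_2\,(i'_\Theta\alpha_1)-(i''_\Theta\alpha_2)\,\alpha_1\,(i'_\Theta\alpha_2)\in\Omega^1_{\mathrm{nc}}A;$$ it vanishes on graded commutators and so is defined on $\operatorname{DR}^2_{\mathrm{nc}}(A)$. Bi-symplectic form. An element $\omega\in\operatorname{DR}^2_{\mathrm{nc}}(A)$ is bi-symplectic if $d\omega=0$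 in $\operatorname{DR}^3_{\mathrm{nc}}(A)$ and the map of $A$-bimodules $\iota(\omega)\colon\mathbb{D}\mathrm{er}A\to\Omega^1_{\mathrm{nc}}A$, $\Theta\mapsto\iota_\Theta\omega$, is an isomorphism. Representation scheme. $A_V$ is the commutative $\Bbbk$-algebra representing the functor $C\mapsto\operatorname{Hom}_{\mathrm{Alg}_\Bbbk}(A,\operatorname{End}V\otimes C)$ on commutative $\Bbbk$-algebras, and $\pi\colon A\to\operatorname{End}V\otimes A_V$ is the universal representation (corresponding to $\mathrm{Id}_{A_V}$); write $\widehat a=\pi(a)$. $\Omega^\bullet_{\mathrm{comm}}(A_V)=\bigwedge^\bullet_{A_V}\Omega^1_{\mathrm{comm}}(A_V)$ is the algebra of Kähler differential forms of $A_V$ over $\Bbbk$, and $\operatorname{Der}(A_V)$ is the module of $\Bbbk$-linear derivations $A_V\to A_V$. For $\beta\in\operatorname{DR}^2_{\mathrm{nc}}(A)$ represented by $\sum a_0\,da_1\,da_2$, set $\widehat\beta=\sum\widehat a_0\,d\widehat a_1\,d\widehat a_2\in\operatorname{End}V\otimes\Omega^2_{\mathrm{comm}}(A_V)$, where $d$ acts on the second factor, and $\operatorname{Tr}(\widehat\beta)=(\operatorname{Tr}\otimes\mathrm{Id})(\widehat\beta)\in\Omega^2_{\mathrm{comm}}(A_V)$; this depends only on the class $\beta$. Kontsevich--Rosenberg principle: a structure on an associative algebra $A$ has geometric meaning if it induces the corresponding standard geometric structure on the representation spaces $\operatorname{Rep}(A,V)$. *)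

theory Defs
  imports Complex_Main "HOL-Library.Poly_Mapping" "HOL-Algebra.Module"
begin

section \<open>Vector spaces given by generators and relations\<close>

text \<open>
  All derived objects are quotients of a free vector space \<open>'x \<Rightarrow>\<^sub>0 'k\<close> (formal finite linear
  combinations of elements of \<open>'x\<close>) by the span of a set of relations; their elements are cosets.
  A map out of such a quotient is given by its values on generators, extended linearly and
  evaluated on a representative; this is meaningful whenever the values respect the relations.
\<close>

definition fscale :: "'k::comm_ring_1 \<Rightarrow> ('x \<Rightarrow>\<^sub>0 'k) \<Rightarrow> ('x \<Rightarrow>\<^sub>0 'k)" where
  "fscale c = Poly_Mapping.map ((*) c)"

definition gen :: "'x \<Rightarrow> ('x \<Rightarrow>\<^sub>0 'k::comm_ring_1)" where
  "gen x = Poly_Mapping.single x 1"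

definition fspan :: "('x \<Rightarrow>\<^sub>0 'k::comm_ring_1) set \<Rightarrow> ('x \<Rightarrow>\<^sub>0 'k) set" where
  "fspan R = Modules.module.span fscale R"

definition lext :: "('x \<Rightarrow> ('y \<Rightarrow>\<^sub>0 'k)) \<Rightarrow> ('x \<Rightarrow>\<^sub>0 'k::comm_ring_1) \<Rightarrow> ('y \<Rightarrow>\<^sub>0 'k)" where
  "lext g f = (\<Sum>x\<in>Poly_Mapping.keys f. fscale (Poly_Mapping.lookup f x) (g x))"

definition cls :: "'f::ab_group_add set \<Rightarrow> 'f \<Rightarrow> 'f set" where
  "cls S f = {h. h - f \<in> S}"

definition rep :: "'f set \<Rightarrow> 'f" where
  "rep X = (SOME f. f \<in> X)"

definition qspace :: "('x \<Rightarrow>\<^sub>0 'k::comm_ring_1) set \<Rightarrow> 'x set \<Rightarrow> ('x \<Rightarrow>\<^sub>0 'k) set set" where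
  "qspace S G = {cls S f | f. Poly_Mapping.keys f \<subseteq> G}"


section \<open>Bimodules\<close>

text \<open>
  A \<open>\<k>\<close>-central bimodule over an algebra with underlying set \<open>R\<close>. Modules over a commutative algebra
  are regarded as bimodules whose two actions coincide.
\<close>

record ('k, 'r, 'm) bimod =
  mcar :: "'m set"
  madd :: "'m \<Rightarrow> 'm \<Rightarrow> 'm"
  mscale :: "'k \<Rightarrow> 'm \<Rightarrow> 'm"
  mleft :: "'r \<Rightarrow> 'm \<Rightarrow> 'm"
  mright :: "'m \<Rightarrow> 'r \<Rightarrow> 'm"

definition bimod_hom ::
  "'r set \<Rightarrow> ('k, 'r, 'm) bimod \<Rightarrow> ('k, 'r, 'n) bimod \<Rightarrow> ('m \<Rightarrow> 'n) \<Rightarrow> bool" where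
  "bimod_hom R M N f \<longleftrightarrow>
     f \<in> mcar M \<rightarrow> mcar N \<and>
     (\<forall>x\<in>mcar M. \<forall>y\<in>mcar M. f (madd M x y) = madd N (f x) (f y)) \<and>
     (\<forall>c. \<forall>x\<in>mcar M. f (mscale M c x) = mscale N c (f x)) \<and>
     (\<forall>r\<in>R. \<forall>x\<in>mcar M. f (mleft M r x) = mleft N r (f x)) \<and>
     (\<forall>r\<in>R. \<forall>x\<in>mcar M. f (mright M x r) = mright N (f x) r)"

definition bimod_iso ::
  "'r set \<Rightarrow> ('k, 'r, 'm) bimod \<Rightarrow> ('k, 'r, 'n) bimod \<Rightarrow> ('m \<Rightarrow> 'n) \<Rightarrow> bool" where
  "bimod_iso R M N f \<longleftrightarrow> bimod_hom R M N f \<and> bij_betw f (mcar M) (mcar N)"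

text \<open>
  For \<open>n \<ge> 1\<close>, the \<open>n\<close>-fold tensor power of \<open>M\<close> over the algebra \<open>R\<close> is generated by words of
  length \<open>n\<close> in elements of \<open>M\<close>, the word \<open>[x\<^sub>1, \<dots>, x\<^sub>n]\<close> standing for \<open>x\<^sub>1 \<otimes> \<dots> \<otimes> x\<^sub>n\<close>, subject to the relations
  that follow. The product of words in the tensor algebra is concatenation.
\<close>

definition mwords :: "('k, 'r, 'm) bimod \<Rightarrow> nat \<Rightarrow> 'm list set" where
  "mwords M n = {w. length w = n \<and> set w \<subseteq> mcar M}"

definition tensor_rels ::
  "'r set \<Rightarrow> ('k::field, 'r, 'm) bimod \<Rightarrow> nat \<Rightarrow> ('m list \<Rightarrow>\<^sub>0 'k) set" where
  "tensor_rels R M n =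
     {gen (u @ [madd M x y] @ v) - gen (u @ [x] @ v) - gen (u @ [y] @ v) | u v x y.
        u @ [x] @ v \<in> mwords M n \<and> y \<in> mcar M} \<union>
     {gen (u @ [mscale M c x] @ v) - fscale c (gen (u @ [x] @ v)) | u v c x.
        u @ [x] @ v \<in> mwords M n} \<union>
     {gen (u @ [mright M x r, y] @ v) - gen (u @ [x, mleft M r y] @ v) | u v x r y.
        u @ [x, y] @ v \<in> mwords M n \<and> r \<in> R}"

text \<open>
  One-forms, noncommutative as well as commutative, are classes of formal sums of pairs, with
  \<open>(x, y)\<close> standing for \<open>x dy\<close>. Since \<open>d(x dy) = dx dy\<close>, the graded Leibniz rule yields the
  following formula for \<open>d(\<alpha>\<^sub>1 \<dots> \<alpha>\<^sub>n)\<close>, where \<open>d0\<close> is the differential on functions.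
\<close>

definition d_word ::
  "('r \<Rightarrow> ('r \<times> 'r \<Rightarrow>\<^sub>0 'k) set) \<Rightarrow> ('r \<times> 'r \<Rightarrow>\<^sub>0 'k) set list
     \<Rightarrow> (('r \<times> 'r \<Rightarrow>\<^sub>0 'k) set list \<Rightarrow>\<^sub>0 'k::field)" where
  "d_word d0 w =
     (\<Sum>i<length w. fscale ((-1) ^ i)
        (lext (\<lambda>(x, y). gen (take i w @ [d0 x, d0 y] @ drop (Suc i) w)) (rep (w ! i))))"


section \<open>Noncommutative differential forms\<close>

text \<open>The sort \<open>{ring, monoid_mult}\<close> describes unital rings, including the zero ring.\<close>

definition k_algebra :: "('k::field \<Rightarrow> 'a::{ring, monoid_mult} \<Rightarrow> 'a) \<Rightarrow> bool" where
  "k_algebra s \<longleftrightarrow> vector_space s \<and>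
     (\<forall>c a b. s c (a * b) = s c a * b \<and> s c (a * b) = a * s c b)"

definition fin_gen :: "('k::field \<Rightarrow> 'a::{ring, monoid_mult} \<Rightarrow> 'a) \<Rightarrow> bool" where
  "fin_gen s \<longleftrightarrow> (\<exists>G. finite G \<and>
     (\<forall>S. G \<subseteq> S \<and> 0 \<in> S \<and> 1 \<in> S \<and> (\<forall>a\<in>S. \<forall>b\<in>S. a + b \<in> S \<and> a * b \<in> S) \<and>
          (\<forall>c. \<forall>a\<in>S. s c a \<in> S) \<longrightarrow> S = UNIV))"

definition tsq_sub ::
  "('k::field \<Rightarrow> 'a::{ring, monoid_mult} \<Rightarrow> 'a) \<Rightarrow> ('a \<times> 'a \<Rightarrow>\<^sub>0 'k) set" where
  "tsq_sub s = fspan (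
     {gen (a + a', b) - gen (a, b) - gen (a', b) | a a' b. True} \<union>
     {gen (a, b + b') - gen (a, b) - gen (a, b') | a b b'. True} \<union>
     {gen (s c a, b) - fscale c (gen (a, b)) | c a b. True} \<union>
     {gen (a, s c b) - fscale c (gen (a, b)) | c a b. True})"

text \<open>\<open>A \<otimes> A\<close> with its outer bimodule structure; as a left module over \<open>A \<otimes> A\<^sup>o\<^sup>p\<close> it is free
  of rank one.\<close>

definition tsq :: "('k::field \<Rightarrow> 'a::{ring, monoid_mult} \<Rightarrow> 'a)
    \<Rightarrow> ('k, 'a, ('a \<times> 'a \<Rightarrow>\<^sub>0 'k) set) bimod" where
  "tsq s = \<lparr> mcar = range (cls (tsq_sub s)),
     madd = (\<lambda>X Y. cls (tsq_sub s) (rep X + rep Y)),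
     mscale = (\<lambda>c X. cls (tsq_sub s) (fscale c (rep X))),
     mleft = (\<lambda>a X. cls (tsq_sub s) (lext (\<lambda>(x, y). gen (a * x, y)) (rep X))),
     mright = (\<lambda>X b. cls (tsq_sub s) (lext (\<lambda>(x, y). gen (x, y * b)) (rep X))) \<rparr>"

definition inner_left :: "('k::field \<Rightarrow> 'a::{ring, monoid_mult} \<Rightarrow> 'a)
    \<Rightarrow> 'a \<Rightarrow> ('a \<times> 'a \<Rightarrow>\<^sub>0 'k) set \<Rightarrow> ('a \<times> 'a \<Rightarrow>\<^sub>0 'k) set" where
  "inner_left s a X = cls (tsq_sub s) (lext (\<lambda>(x, y). gen (x, a * y)) (rep X))"

definition inner_right :: "('k::field \<Rightarrow> 'a::{ring, monoid_mult} \<Rightarrow> 'a)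
    \<Rightarrow> ('a \<times> 'a \<Rightarrow>\<^sub>0 'k) set \<Rightarrow> 'a \<Rightarrow> ('a \<times> 'a \<Rightarrow>\<^sub>0 'k) set" where
  "inner_right s X b = cls (tsq_sub s) (lext (\<lambda>(x, y). gen (x * b, y)) (rep X))"

definition mult_map :: "('k::field \<Rightarrow> 'a::{ring, monoid_mult} \<Rightarrow> 'a)
    \<Rightarrow> ('a \<times> 'a \<Rightarrow>\<^sub>0 'k) set \<Rightarrow> 'a" where
  "mult_map s X =
     (\<Sum>(x, y)\<in>Poly_Mapping.keys (rep X). s (Poly_Mapping.lookup (rep X) (x, y)) (x * y))"

definition nc_Omega1 :: "('k::field \<Rightarrow> 'a::{ring, monoid_mult} \<Rightarrow> 'a)
    \<Rightarrow> ('k, 'a, ('a \<times> 'a \<Rightarrow>\<^sub>0 'k) set) bimod" where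
  "nc_Omega1 s = (tsq s)\<lparr> mcar := {X \<in> mcar (tsq s). mult_map s X = 0} \<rparr>"

text \<open>If \<open>\<Sum> x\<^sub>i y\<^sub>i = 0\<close> then \<open>\<Sum> x\<^sub>i \<otimes> y\<^sub>i = \<Sum> x\<^sub>i dy\<^sub>i\<close> for the following \<open>d\<close>.\<close>

definition nc_d0 :: "('k::field \<Rightarrow> 'a::{ring, monoid_mult} \<Rightarrow> 'a)
    \<Rightarrow> 'a \<Rightarrow> ('a \<times> 'a \<Rightarrow>\<^sub>0 'k) set" where
  "nc_d0 s a = cls (tsq_sub s) (gen (1, a) - gen (a, 1))"

text \<open>Direct sum of copies, indexed by \<open>X\<close>, of \<open>A \<otimes> A\<^sup>o\<^sup>p\<close> as a left module over itself.\<close>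

definition free_bimod :: "('k::field \<Rightarrow> 'a::{ring, monoid_mult} \<Rightarrow> 'a)
    \<Rightarrow> 'x set \<Rightarrow> ('k, 'a, 'x \<Rightarrow> ('a \<times> 'a \<Rightarrow>\<^sub>0 'k) set) bimod" where
  "free_bimod s X = \<lparr>
     mcar = {f. (\<forall>x. f x \<in> mcar (tsq s)) \<and> (\<forall>x. x \<notin> X \<longrightarrow> f x = cls (tsq_sub s) 0) \<and>
                finite {x. f x \<noteq> cls (tsq_sub s) 0}},
     madd = (\<lambda>f g x. madd (tsq s) (f x) (g x)),
     mscale = (\<lambda>c f x. mscale (tsq s) c (f x)),
     mleft = (\<lambda>a f x. mleft (tsq s) a (f x)),
     mright = (\<lambda>f b x. mright (tsq s) (f x) b) \<rparr>"

text \<open>Projective means direct summand of a free module. It suffices to consider free modules on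
  subsets of \<open>P\<close>, since every module is a quotient of the free module on its own elements.\<close>

definition projective_bimod :: "('k::field \<Rightarrow> 'a::{ring, monoid_mult} \<Rightarrow> 'a)
    \<Rightarrow> ('k, 'a, 'm) bimod \<Rightarrow> bool" where
  "projective_bimod s P \<longleftrightarrow>
     (\<exists>(X :: 'm set) \<sigma> \<rho>. bimod_hom UNIV P (free_bimod s X) \<sigma> \<and>
        bimod_hom UNIV (free_bimod s X) P \<rho> \<and> (\<forall>p\<in>mcar P. \<rho> (\<sigma> p) = p))"

definition smooth_algebra :: "('k::field \<Rightarrow> 'a::{ring, monoid_mult} \<Rightarrow> 'a) \<Rightarrow> bool" where
  "smooth_algebra s \<longleftrightarrow> fin_gen s \<and> projective_bimod s (nc_Omega1 s)"

text \<open>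
  \<open>DR\<^sup>n\<close> for \<open>n \<ge> 1\<close>: the relations of the tensor power together with the graded commutators of
  degree \<open>n\<close>, first those with an element of \<open>A\<close>, then those of two forms of positive degree.
\<close>

definition dr_sub :: "('k::field \<Rightarrow> 'a::{ring, monoid_mult} \<Rightarrow> 'a)
    \<Rightarrow> nat \<Rightarrow> (('a \<times> 'a \<Rightarrow>\<^sub>0 'k) set list \<Rightarrow>\<^sub>0 'k) set" where
  "dr_sub s n = (let M = nc_Omega1 s in fspan (
     tensor_rels UNIV M n \<union>
     {gen (mleft M a (hd w) # tl w) - gen (butlast w @ [mright M (last w) a]) | a w.
        w \<in> mwords M n} \<union>
     {gen (u @ v) - fscale ((-1) ^ (length u * length v)) (gen (v @ u)) | u v.
        u @ v \<in> mwords M n \<and> u \<noteq> [] \<and> v \<noteq> []}))"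

definition DR :: "('k::field \<Rightarrow> 'a::{ring, monoid_mult} \<Rightarrow> 'a)
    \<Rightarrow> nat \<Rightarrow> (('a \<times> 'a \<Rightarrow>\<^sub>0 'k) set list \<Rightarrow>\<^sub>0 'k) set set" where
  "DR s n = qspace (dr_sub s n) (mwords (nc_Omega1 s) n)"

definition dr_d :: "('k::field \<Rightarrow> 'a::{ring, monoid_mult} \<Rightarrow> 'a) \<Rightarrow> nat
    \<Rightarrow> (('a \<times> 'a \<Rightarrow>\<^sub>0 'k) set list \<Rightarrow>\<^sub>0 'k) set
    \<Rightarrow> (('a \<times> 'a \<Rightarrow>\<^sub>0 'k) set list \<Rightarrow>\<^sub>0 'k) set" where
  "dr_d s n \<omega> = cls (dr_sub s (Suc n)) (lext (d_word (nc_d0 s)) (rep \<omega>))"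


section \<open>Double derivations and bi-symplectic forms\<close>

definition DDer :: "('k::field \<Rightarrow> 'a::{ring, monoid_mult} \<Rightarrow> 'a)
    \<Rightarrow> ('k, 'a, 'a \<Rightarrow> ('a \<times> 'a \<Rightarrow>\<^sub>0 'k) set) bimod" where
  "DDer s = (let T = tsq s in \<lparr>
     mcar = {\<Theta>. (\<forall>a. \<Theta> a \<in> mcar T) \<and>
       (\<forall>a b. \<Theta> (a + b) = madd T (\<Theta> a) (\<Theta> b)) \<and>
       (\<forall>c a. \<Theta> (s c a) = mscale T c (\<Theta> a)) \<and>
       (\<forall>a b. \<Theta> (a * b) = madd T (mleft T a (\<Theta> b)) (mright T (\<Theta> a) b))},
     madd = (\<lambda>\<Theta> \<Phi> a. madd T (\<Theta> a) (\<Phi> a)),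
     mscale = (\<lambda>c \<Theta> a. mscale T c (\<Theta> a)),
     mleft = (\<lambda>b \<Theta> a. inner_left s b (\<Theta> a)),
     mright = (\<lambda>\<Theta> b a. inner_right s (\<Theta> a) b) \<rparr>)"

definition i_DD :: "('k::field \<Rightarrow> 'a::{ring, monoid_mult} \<Rightarrow> 'a)
    \<Rightarrow> ('a \<Rightarrow> ('a \<times> 'a \<Rightarrow>\<^sub>0 'k) set) \<Rightarrow> ('a \<times> 'a \<Rightarrow>\<^sub>0 'k) set \<Rightarrow> ('a \<times> 'a \<Rightarrow>\<^sub>0 'k) set" where
  "i_DD s \<Theta> = (THE h. bimod_hom UNIV (nc_Omega1 s) (tsq s) h \<and>
     h \<in> extensional (mcar (nc_Omega1 s)) \<and> (\<forall>a. h (nc_d0 s a) = \<Theta> a))"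

text \<open>A representative of \<open>Y'' \<alpha> Y'\<close>, where \<open>Y = Y' \<otimes> Y''\<close> in Sweedler notation.\<close>

definition sweedler :: "('k::field \<Rightarrow> 'a::{ring, monoid_mult} \<Rightarrow> 'a)
    \<Rightarrow> ('a \<times> 'a \<Rightarrow>\<^sub>0 'k) set \<Rightarrow> ('a \<times> 'a \<Rightarrow>\<^sub>0 'k) set \<Rightarrow> ('a \<times> 'a \<Rightarrow>\<^sub>0 'k)" where
  "sweedler s Y \<alpha> =
     lext (\<lambda>(p, q). rep (mright (tsq s) (mleft (tsq s) q \<alpha>) p)) (rep Y)"

definition iota :: "('k::field \<Rightarrow> 'a::{ring, monoid_mult} \<Rightarrow> 'a)
    \<Rightarrow> (('a \<times> 'a \<Rightarrow>\<^sub>0 'k) set list \<Rightarrow>\<^sub>0 'k) set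
    \<Rightarrow> ('a \<Rightarrow> ('a \<times> 'a \<Rightarrow>\<^sub>0 'k) set) \<Rightarrow> ('a \<times> 'a \<Rightarrow>\<^sub>0 'k) set" where
  "iota s \<omega> \<Theta> = cls (tsq_sub s)
     (lext (\<lambda>w. sweedler s (i_DD s \<Theta> (w ! 0)) (w ! 1) - sweedler s (i_DD s \<Theta> (w ! 1)) (w ! 0))
        (rep \<omega>))"

definition bisymplectic :: "('k::field \<Rightarrow> 'a::{ring, monoid_mult} \<Rightarrow> 'a)
    \<Rightarrow> (('a \<times> 'a \<Rightarrow>\<^sub>0 'k) set list \<Rightarrow>\<^sub>0 'k) set \<Rightarrow> bool" where
  "bisymplectic s \<omega> \<longleftrightarrow> \<omega> \<in> DR s 2 \<and>
     dr_d s 2 \<omega> = cls (dr_sub s 3) 0 \<and>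
     bimod_iso UNIV (DDer s) (nc_Omega1 s) (iota s \<omega>)"


section \<open>Forms and derivations of a commutative algebra\<close>

text \<open>Kaehler differentials of \<open>C\<close>: the class of \<open>(x, y)\<close> is \<open>x dy\<close>.\<close>

definition kaehler_sub :: "('k::field, 'c) module \<Rightarrow> ('c \<times> 'c \<Rightarrow>\<^sub>0 'k) set" where
  "kaehler_sub C = fspan (
     {gen (x \<oplus>\<^bsub>C\<^esub> x', y) - gen (x, y) - gen (x', y) | x x' y. {x, x', y} \<subseteq> carrier C} \<union>
     {gen (x, y \<oplus>\<^bsub>C\<^esub> y') - gen (x, y) - gen (x, y') | x y y'. {x, y, y'} \<subseteq> carrier C} \<union>
     {gen (c \<odot>\<^bsub>C\<^esub> x, y) - fscale c (gen (x, y)) | c x y. {x, y} \<subseteq> carrier C} \<union>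
     {gen (x, c \<odot>\<^bsub>C\<^esub> y) - fscale c (gen (x, y)) | c x y. {x, y} \<subseteq> carrier C} \<union>
     {gen (x, y \<otimes>\<^bsub>C\<^esub> z) - gen (x \<otimes>\<^bsub>C\<^esub> y, z) - gen (x \<otimes>\<^bsub>C\<^esub> z, y) | x y z.
        {x, y, z} \<subseteq> carrier C})"

definition Kaehler :: "('k::field, 'c) module \<Rightarrow> ('k, 'c, ('c \<times> 'c \<Rightarrow>\<^sub>0 'k) set) bimod" where
  "Kaehler C = \<lparr> mcar = qspace (kaehler_sub C) (carrier C \<times> carrier C),
     madd = (\<lambda>X Y. cls (kaehler_sub C) (rep X + rep Y)),
     mscale = (\<lambda>c X. cls (kaehler_sub C) (fscale c (rep X))),
     mleft = (\<lambda>z X. cls (kaehler_sub C) (lext (\<lambda>(x, y). gen (z \<otimes>\<^bsub>C\<^esub> x, y)) (rep X))),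
     mright = (\<lambda>X z. cls (kaehler_sub C) (lext (\<lambda>(x, y). gen (z \<otimes>\<^bsub>C\<^esub> x, y)) (rep X))) \<rparr>"

definition comm_d0 :: "('k::field, 'c) module \<Rightarrow> 'c \<Rightarrow> ('c \<times> 'c \<Rightarrow>\<^sub>0 'k) set" where
  "comm_d0 C y = cls (kaehler_sub C) (gen (\<one>\<^bsub>C\<^esub>, y))"

text \<open>The exterior power \<open>\<And>\<^sup>n\<close> over \<open>C\<close>, for \<open>n \<ge> 1\<close>.\<close>

definition ext_sub ::
  "('k::field, 'c) module \<Rightarrow> nat \<Rightarrow> (('c \<times> 'c \<Rightarrow>\<^sub>0 'k) set list \<Rightarrow>\<^sub>0 'k) set" where
  "ext_sub C n = fspan (tensor_rels (carrier C) (Kaehler C) n \<union>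
     {gen w | w. w \<in> mwords (Kaehler C) n \<and> \<not> distinct w})"

definition comm_Omega ::
  "('k::field, 'c) module \<Rightarrow> nat \<Rightarrow> (('c \<times> 'c \<Rightarrow>\<^sub>0 'k) set list \<Rightarrow>\<^sub>0 'k) set set" where
  "comm_Omega C n = qspace (ext_sub C n) (mwords (Kaehler C) n)"

definition comm_d :: "('k::field, 'c) module \<Rightarrow> nat
    \<Rightarrow> (('c \<times> 'c \<Rightarrow>\<^sub>0 'k) set list \<Rightarrow>\<^sub>0 'k) set
    \<Rightarrow> (('c \<times> 'c \<Rightarrow>\<^sub>0 'k) set list \<Rightarrow>\<^sub>0 'k) set" where
  "comm_d C n \<omega> = cls (ext_sub C (Suc n)) (lext (d_word (comm_d0 C)) (rep \<omega>))"

definition Der :: "('k::field, 'c) module \<Rightarrow> ('k, 'c, 'c \<Rightarrow> 'c) bimod" where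
  "Der C = \<lparr>
     mcar = {\<theta> \<in> carrier C \<rightarrow>\<^sub>E carrier C.
       (\<forall>x\<in>carrier C. \<forall>y\<in>carrier C. \<theta> (x \<oplus>\<^bsub>C\<^esub> y) = \<theta> x \<oplus>\<^bsub>C\<^esub> \<theta> y) \<and>
       (\<forall>c. \<forall>x\<in>carrier C. \<theta> (c \<odot>\<^bsub>C\<^esub> x) = c \<odot>\<^bsub>C\<^esub> \<theta> x) \<and>
       (\<forall>x\<in>carrier C. \<forall>y\<in>carrier C.
          \<theta> (x \<otimes>\<^bsub>C\<^esub> y) = x \<otimes>\<^bsub>C\<^esub> \<theta> y \<oplus>\<^bsub>C\<^esub> \<theta> x \<otimes>\<^bsub>C\<^esub> y)},
     madd = (\<lambda>\<theta> \<phi>. \<lambda>x\<in>carrier C. \<theta> x \<oplus>\<^bsub>C\<^esub> \<phi> x),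
     mscale = (\<lambda>c \<theta>. \<lambda>x\<in>carrier C. c \<odot>\<^bsub>C\<^esub> \<theta> x),
     mleft = (\<lambda>z \<theta>. \<lambda>x\<in>carrier C. z \<otimes>\<^bsub>C\<^esub> \<theta> x),
     mright = (\<lambda>\<theta> z. \<lambda>x\<in>carrier C. z \<otimes>\<^bsub>C\<^esub> \<theta> x) \<rparr>"

text \<open>The pairing of a derivation with a one-form: \<open>x dy \<mapsto> x \<theta>(y)\<close>.\<close>

definition pair_der ::
  "('k::field, 'c) module \<Rightarrow> ('c \<Rightarrow> 'c) \<Rightarrow> ('c \<times> 'c \<Rightarrow>\<^sub>0 'k) set \<Rightarrow> 'c" where
  "pair_der C \<theta> \<alpha> = (\<Oplus>\<^bsub>C\<^esub>p\<in>Poly_Mapping.keys (rep \<alpha>).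
     Poly_Mapping.lookup (rep \<alpha>) p \<odot>\<^bsub>C\<^esub> (fst p \<otimes>\<^bsub>C\<^esub> \<theta> (snd p)))"

text \<open>\<open>i\<^sub>\<theta>(\<alpha>\<^sub>1 \<and> \<alpha>\<^sub>2) = \<theta>(\<alpha>\<^sub>1) \<alpha>\<^sub>2 - \<theta>(\<alpha>\<^sub>2) \<alpha>\<^sub>1\<close>\<close>

definition contr2 :: "('k::field, 'c) module \<Rightarrow> (('c \<times> 'c \<Rightarrow>\<^sub>0 'k) set list \<Rightarrow>\<^sub>0 'k) set
    \<Rightarrow> ('c \<Rightarrow> 'c) \<Rightarrow> ('c \<times> 'c \<Rightarrow>\<^sub>0 'k) set" where
  "contr2 C \<omega> \<theta> = cls (kaehler_sub C)
     (lext (\<lambda>w. rep (mleft (Kaehler C) (pair_der C \<theta> (w ! 0)) (w ! 1)) -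
                rep (mleft (Kaehler C) (pair_der C \<theta> (w ! 1)) (w ! 0)))
        (rep \<omega>))"

definition symplectic ::
  "('k::field, 'c) module \<Rightarrow> (('c \<times> 'c \<Rightarrow>\<^sub>0 'k) set list \<Rightarrow>\<^sub>0 'k) set \<Rightarrow> bool" where
  "symplectic C \<omega> \<longleftrightarrow> \<omega> \<in> comm_Omega C 2 \<and>
     comm_d C 2 \<omega> = cls (ext_sub C 3) 0 \<and>
     bimod_iso (carrier C) (Der C) (Kaehler C) (contr2 C \<omega>)"


section \<open>The representation scheme\<close>

text \<open>
  A basis \<open>B\<close> of \<open>V\<close> identifies \<open>End V \<otimes> C\<close> with the algebra of \<open>B \<times> B\<close> matrices over \<open>C\<close>.
  The \<open>(i, j)\<close> entry of an endomorphism \<open>f\<close> is the coordinate at \<open>i\<close> of \<open>f j\<close>, so that composition is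
  the matrix product. \<open>matrix_rep\<close> says that \<open>\<rho>\<close> is a homomorphism from \<open>A\<close> to these matrices.
\<close>

lemma endomorphism_matrix_mult:
  fixes sV :: "'k::field \<Rightarrow> 'v::ab_group_add \<Rightarrow> 'v"
  assumes "finite_dimensional_vector_space sV B"
    and "Vector_Spaces.linear sV sV f"
  defines "M \<equiv> (\<lambda>f i j. Modules.module.representation sV B (f j) i)"
  shows "M (f \<circ> g) i j = (\<Sum>l\<in>B. M f i l * M g l j)"
proof -
  interpret V: finite_dimensional_vector_space sV B by fact
  interpret f: Vector_Spaces.linear sV sV f by fact
  note rep_laws = V.representation_sum[OF V.independent_Basis]
    V.representation_scale[OF V.independent_Basis]
  have "g j = (\<Sum>l\<in>B. sV (M g l j) l)"
    unfolding M_def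
    by (rule V.sum_representation_eq[symmetric])
      (simp_all add: V.independent_Basis V.span_Basis V.finite_Basis)
  then have "f (g j) = (\<Sum>l\<in>B. sV (M g l j) (f l))"
    by (simp add: f.sum f.scale)
  then show ?thesis
    by (simp add: M_def rep_laws V.span_Basis mult.commute)
qed

definition matrix_rep :: "('k::field \<Rightarrow> 'a::{ring, monoid_mult} \<Rightarrow> 'a) \<Rightarrow> 'v set
    \<Rightarrow> ('k, 'c) module \<Rightarrow> ('a \<Rightarrow> 'v \<Rightarrow> 'v \<Rightarrow> 'c) \<Rightarrow> bool" where
  "matrix_rep s B C \<rho> \<longleftrightarrow>
     (\<forall>i\<in>B. \<forall>j\<in>B.
        (\<forall>a. \<rho> a i j \<in> carrier C) \<and>
        (\<forall>a b. \<rho> (a + b) i j = \<rho> a i j \<oplus>\<^bsub>C\<^esub> \<rho> b i j) \<and>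
        (\<forall>c a. \<rho> (s c a) i j = c \<odot>\<^bsub>C\<^esub> \<rho> a i j) \<and>
        (\<forall>a b. \<rho> (a * b) i j = (\<Oplus>\<^bsub>C\<^esub>l\<in>B. \<rho> a i l \<otimes>\<^bsub>C\<^esub> \<rho> b l j)) \<and>
        \<rho> 1 i j = (if i = j then \<one>\<^bsub>C\<^esub> else \<zero>\<^bsub>C\<^esub>))"

text \<open>
  The polynomial ring in the indeterminates \<open>x a i j\<close>, the \<open>(i, j)\<close> entry of the universal
  representation at \<open>a\<close>. The indeterminates with an index outside of \<open>B\<close> are set to zero.
\<close>

type_synonym ('k, 'a, 'v) rep_poly = "('a \<times> 'v \<times> 'v \<Rightarrow>\<^sub>0 nat) \<Rightarrow>\<^sub>0 'k"

definition rvar :: "'a \<Rightarrow> 'v \<Rightarrow> 'v \<Rightarrow> ('k::field, 'a, 'v) rep_poly" where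
  "rvar a i j = gen (Poly_Mapping.single (a, i, j) 1)"

definition rep_ideal :: "('k::field \<Rightarrow> 'a::{ring, monoid_mult} \<Rightarrow> 'a) \<Rightarrow> 'v set
    \<Rightarrow> ('k, 'a, 'v) rep_poly set" where
  "rep_ideal s B = Modules.module.span (*) (
     {rvar a i j | a i j. i \<notin> B \<or> j \<notin> B} \<union>
     {rvar (a + b) i j - rvar a i j - rvar b i j | a b i j. i \<in> B \<and> j \<in> B} \<union>
     {rvar (s c a) i j - fscale c (rvar a i j) | c a i j. i \<in> B \<and> j \<in> B} \<union>
     {rvar (a * b) i j - (\<Sum>l\<in>B. rvar a i l * rvar b l j) | a b i j. i \<in> B \<and> j \<in> B} \<union>
     {rvar 1 i j - (if i = j then 1 else 0) | i j. i \<in> B \<and> j \<in> B})"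

definition rep_algebra :: "('k::field \<Rightarrow> 'a::{ring, monoid_mult} \<Rightarrow> 'a) \<Rightarrow> 'v set
    \<Rightarrow> ('k, ('k, 'a, 'v) rep_poly set) module" where
  "rep_algebra s B = (let I = rep_ideal s B in
     \<lparr> carrier = range (cls I),
       monoid.mult = (\<lambda>X Y. cls I (rep X * rep Y)),
       one = cls I 1,
       zero = cls I 0,
       add = (\<lambda>X Y. cls I (rep X + rep Y)),
       smult = (\<lambda>c X. cls I (fscale c (rep X))) \<rparr>)"

definition univ_rep :: "('k::field \<Rightarrow> 'a::{ring, monoid_mult} \<Rightarrow> 'a) \<Rightarrow> 'v set
    \<Rightarrow> 'a \<Rightarrow> 'v \<Rightarrow> 'v \<Rightarrow> ('k, 'a, 'v) rep_poly set" where
  "univ_rep s B a i j = cls (rep_ideal s B) (rvar a i j)"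

text \<open>
  The pair \<open>(rep_algebra s B, univ_rep s B)\<close> represents the functor sending a commutative algebra
  \<open>C\<close> to the set of homomorphisms from \<open>A\<close> to \<open>B \<times> B\<close> matrices over \<open>C\<close>: see
  \<open>rep_algebra_algebra\<close>, \<open>univ_rep_matrix_rep\<close> and \<open>rep_algebra_universal\<close> below.
\<close>

definition field_ring :: "'k::field ring" where
  "field_ring = \<lparr> carrier = UNIV, monoid.mult = (*), one = 1, zero = 0, add = (+) \<rparr>"

definition alg_hom :: "('k, 'c) module \<Rightarrow> ('k, 'd) module \<Rightarrow> ('c \<Rightarrow> 'd) \<Rightarrow> bool" where
  "alg_hom C D \<phi> \<longleftrightarrow> \<phi> \<in> ring_hom C D \<and>
     (\<forall>c. \<forall>x\<in>carrier C. \<phi> (c \<odot>\<^bsub>C\<^esub> x) = c \<odot>\<^bsub>D\<^esub> \<phi> x)"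

lemma cring_field_ring: "cring (field_ring :: 'k::field ring)"
proof (rule cringI)
  show "abelian_group (field_ring :: 'k ring)"
  proof (rule abelian_groupI)
    fix x :: 'k assume "x \<in> carrier field_ring"
    show "\<exists>y\<in>carrier field_ring. y \<oplus>\<^bsub>field_ring\<^esub> x = \<zero>\<^bsub>field_ring\<^esub>"
      by (rule bexI[of _ "- x"]) (simp_all add: field_ring_def)
  qed (simp_all add: field_ring_def algebra_simps)
  show "Group.comm_monoid (field_ring :: 'k ring)"
    by (rule comm_monoidI) (simp_all add: field_ring_def algebra_simps)
qed (simp add: field_ring_def algebra_simps)

lemma times_module: "Modules.module ((*) :: 'r::comm_ring_1 \<Rightarrow> 'r \<Rightarrow> 'r)"
  by unfold_locales (simp_all add: algebra_simps)

lemma fscale_poly: "fscale c p = Poly_Mapping.single 0 c * (p :: ('k::field, 'a, 'v) rep_poly)"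
  by (simp add: fscale_def mult_map_scale_conv_mult)

lemma fscale_laws:
  fixes p q :: "('k::field, 'a, 'v) rep_poly"
  shows "fscale (c + d) p = fscale c p + fscale d p" "fscale c (p + q) = fscale c p + fscale c q"
    "fscale (c * d) p = fscale c (fscale d p)" "fscale 1 p = p"
    "fscale c p * q = fscale c (p * q)"
proof -
  have "Poly_Mapping.single 0 (c * d) =
      Poly_Mapping.single 0 c * (Poly_Mapping.single 0 d :: ('k, 'a, 'v) rep_poly)"
    by (simp add: mult_single)
  then show "fscale (c * d) p = fscale c (fscale d p)"
    by (simp add: fscale_poly mult.assoc)
qed (simp_all add: fscale_poly single_add distrib_left distrib_right mult.assoc)

lemma rep_ideal_zero: "0 \<in> rep_ideal s B"
  unfolding rep_ideal_def by (rule Modules.module.span_zero[OF times_module])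

lemma rep_ideal_add: "p \<in> rep_ideal s B \<Longrightarrow> q \<in> rep_ideal s B \<Longrightarrow> p + q \<in> rep_ideal s B"
  unfolding rep_ideal_def by (rule Modules.module.span_add[OF times_module])

lemma rep_ideal_mult: "p \<in> rep_ideal s B \<Longrightarrow> q * p \<in> rep_ideal s B"
  unfolding rep_ideal_def by (rule Modules.module.span_scale[OF times_module])

lemma rep_ideal_uminus: "p \<in> rep_ideal s B \<Longrightarrow> - p \<in> rep_ideal s B"
  using rep_ideal_mult[of p s B "- 1"] by simp

lemma rep_ideal_diff: "p \<in> rep_ideal s B \<Longrightarrow> q \<in> rep_ideal s B \<Longrightarrow> p - q \<in> rep_ideal s B"
  using rep_ideal_add[of p s B "- q"] rep_ideal_uminus by fastforce

lemma cls_rep_ideal_eq: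
  "cls (rep_ideal s B) p = cls (rep_ideal s B) q \<longleftrightarrow> p - q \<in> rep_ideal s B"
proof
  assume "cls (rep_ideal s B) p = cls (rep_ideal s B) q"
  moreover have "p \<in> cls (rep_ideal s B) p" by (simp add: cls_def rep_ideal_zero)
  ultimately show "p - q \<in> rep_ideal s B" by (simp add: cls_def)
next
  assume a: "p - q \<in> rep_ideal s B"
  show "cls (rep_ideal s B) p = cls (rep_ideal s B) q"
  proof (rule Set.set_eqI)
    fix h
    have "h - q = (h - p) + (p - q)" "h - p = (h - q) - (p - q)" by simp_all
    then show "h \<in> cls (rep_ideal s B) p \<longleftrightarrow> h \<in> cls (rep_ideal s B) q"
      using a by (metis cls_def mem_Collect_eq rep_ideal_add rep_ideal_diff)
  qed
qed

lemma rep_cls_rep_ideal: "rep (cls (rep_ideal s B) p) - p \<in> rep_ideal s B"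
proof -
  have "p \<in> cls (rep_ideal s B) p" by (simp add: cls_def rep_ideal_zero)
  then have "rep (cls (rep_ideal s B) p) \<in> cls (rep_ideal s B) p"
    unfolding rep_def by (rule someI)
  then show ?thesis by (simp add: cls_def)
qed

lemma rep_algebra_simps:
  "carrier (rep_algebra s B) = range (cls (rep_ideal s B))"
  "\<one>\<^bsub>rep_algebra s B\<^esub> = cls (rep_ideal s B) 1"
  "\<zero>\<^bsub>rep_algebra s B\<^esub> = cls (rep_ideal s B) 0"
  "cls (rep_ideal s B) p \<oplus>\<^bsub>rep_algebra s B\<^esub> cls (rep_ideal s B) q = cls (rep_ideal s B) (p + q)"
  "cls (rep_ideal s B) p \<otimes>\<^bsub>rep_algebra s B\<^esub> cls (rep_ideal s B) q = cls (rep_ideal s B) (p * q)"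
  "c \<odot>\<^bsub>rep_algebra s B\<^esub> cls (rep_ideal s B) p = cls (rep_ideal s B) (fscale c p)"
proof -
  let ?I = "rep_ideal s B"
  let ?p = "rep (cls ?I p)" and ?q = "rep (cls ?I q)"
  have p: "?p - p \<in> ?I" and q: "?q - q \<in> ?I" by (rule rep_cls_rep_ideal)+
  have "?p + ?q - (p + q) = (?p - p) + (?q - q)" by simp
  then have 1: "?p + ?q - (p + q) \<in> ?I" using p q rep_ideal_add by metis
  have "?p * ?q - p * q = ?q * (?p - p) + p * (?q - q)" by (simp add: algebra_simps)
  then have 2: "?p * ?q - p * q \<in> ?I" using p q rep_ideal_add rep_ideal_mult by metis
  have "fscale c ?p - fscale c p = Poly_Mapping.single 0 c * (?p - p)"
    by (simp add: fscale_poly algebra_simps)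
  then have 3: "fscale c ?p - fscale c p \<in> ?I" using p rep_ideal_mult by metis
  show "cls ?I p \<oplus>\<^bsub>rep_algebra s B\<^esub> cls ?I q = cls ?I (p + q)"
    "cls ?I p \<otimes>\<^bsub>rep_algebra s B\<^esub> cls ?I q = cls ?I (p * q)"
    "c \<odot>\<^bsub>rep_algebra s B\<^esub> cls ?I p = cls ?I (fscale c p)"
    using 1 2 3 by (simp_all add: rep_algebra_def Let_def cls_rep_ideal_eq)
qed (simp_all add: rep_algebra_def Let_def)

theorem rep_algebra_algebra: "algebra field_ring (rep_algebra s B)"
proof (rule algebraI)
  let ?C = "rep_algebra s B"
  note simps = rep_algebra_simps[of s B] fscale_poly
  show "cring (field_ring :: 'a ring)" by (rule cring_field_ring)
  show "cring ?C"
  proof (rule cringI)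
    show "abelian_group ?C"
    proof (rule abelian_groupI)
      fix x assume "x \<in> carrier ?C"
      then obtain p where "x = cls (rep_ideal s B) p" by (auto simp: simps)
      then show "\<exists>y\<in>carrier ?C. y \<oplus>\<^bsub>?C\<^esub> x = \<zero>\<^bsub>?C\<^esub>"
        by (intro bexI[of _ "cls (rep_ideal s B) (- p)"]) (simp_all add: simps)
    qed (auto simp: simps algebra_simps)
    show "Group.comm_monoid ?C"
      by (rule comm_monoidI) (auto simp: simps algebra_simps)
  qed (auto simp: simps algebra_simps)
qed (auto simp: rep_algebra_simps fscale_laws field_ring_def)

lemma finsum_rep_algebra:
  assumes "finite S"
  shows "(\<Oplus>\<^bsub>rep_algebra s B\<^esub>l\<in>S. cls (rep_ideal s B) (f l)) = cls (rep_ideal s B) (\<Sum>l\<in>S. f l)"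
proof -
  interpret A: algebra field_ring "rep_algebra s B" by (rule rep_algebra_algebra)
  show ?thesis using assms
    by (induction S) (simp_all add: rep_algebra_simps A.finsum_insert Pi_def)
qed

theorem univ_rep_matrix_rep:
  assumes "finite B"
  shows "matrix_rep s B (rep_algebra s B) (univ_rep s B)"
proof -
  have rel: "p \<in> rep_ideal s B" if "p \<in>
     {rvar a i j | a i j. i \<notin> B \<or> j \<notin> B} \<union>
     {rvar (a + b) i j - rvar a i j - rvar b i j | a b i j. i \<in> B \<and> j \<in> B} \<union>
     {rvar (s c a) i j - fscale c (rvar a i j) | c a i j. i \<in> B \<and> j \<in> B} \<union>
     {rvar (a * b) i j - (\<Sum>l\<in>B. rvar a i l * rvar b l j) | a b i j. i \<in> B \<and> j \<in> B} \<union>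
     {rvar 1 i j - (if i = j then 1 else 0) | i j. i \<in> B \<and> j \<in> B}" for p
    using that unfolding rep_ideal_def by (rule Modules.module.span_base[OF times_module])
  show ?thesis unfolding matrix_rep_def
  proof (intro ballI conjI allI)
    fix i j assume ij: "i \<in> B" "j \<in> B"
    fix a b c
    show "univ_rep s B a i j \<in> carrier (rep_algebra s B)"
      by (simp add: univ_rep_def rep_algebra_simps)
    have "rvar (a + b) i j - (rvar a i j + rvar b i j) \<in> rep_ideal s B"
      unfolding diff_diff_eq[symmetric] by (rule rel) (use ij in blast)
    then show "univ_rep s B (a + b) i j = univ_rep s B a i j \<oplus>\<^bsub>rep_algebra s B\<^esub> univ_rep s B b i j"
      by (simp add: univ_rep_def rep_algebra_simps cls_rep_ideal_eq)
    have "rvar (s c a) i j - fscale c (rvar a i j) \<in> rep_ideal s B"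
      by (rule rel) (use ij in blast)
    then show "univ_rep s B (s c a) i j = c \<odot>\<^bsub>rep_algebra s B\<^esub> univ_rep s B a i j"
      by (simp add: univ_rep_def rep_algebra_simps cls_rep_ideal_eq)
    have "rvar (a * b) i j - (\<Sum>l\<in>B. rvar a i l * rvar b l j) \<in> rep_ideal s B"
      by (rule rel) (use ij in blast)
    then show "univ_rep s B (a * b) i j =
      (\<Oplus>\<^bsub>rep_algebra s B\<^esub>l\<in>B. univ_rep s B a i l \<otimes>\<^bsub>rep_algebra s B\<^esub> univ_rep s B b l j)"
      using assms
      by (simp add: univ_rep_def rep_algebra_simps finsum_rep_algebra cls_rep_ideal_eq)
    have "rvar 1 i j - (if i = j then 1 else 0) \<in> rep_ideal s B"
      by (rule rel) (use ij in blast)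
    then show "univ_rep s B 1 i j =
      (if i = j then \<one>\<^bsub>rep_algebra s B\<^esub> else \<zero>\<^bsub>rep_algebra s B\<^esub>)"
      by (simp add: univ_rep_def rep_algebra_simps cls_rep_ideal_eq split: if_splits)
  qed
qed

lemma poly_mapping_add_induct [case_names zero single add]:
  assumes "P 0" and "\<And>x c. P (Poly_Mapping.single x c)" and "\<And>f g. P f \<Longrightarrow> P g \<Longrightarrow> P (f + g)"
  shows "P (f :: 'x \<Rightarrow>\<^sub>0 'y::comm_monoid_add)"
proof (induction f rule: update_induct)
  case (update f a b)
  have "Poly_Mapping.update a b f = f + Poly_Mapping.single a b"
    using update by (intro poly_mapping_eqI)
      (auto simp: lookup_update lookup_add lookup_single not_in_keys_iff_lookup_eq_zero when_def)
  then show ?case using update assms by simp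
qed (rule assms(1))

context
  fixes C :: "('k::field, 'c) module" (structure) and g :: "'x \<Rightarrow> 'c"
  assumes alg: "algebra field_ring C" and g: "\<And>x. g x \<in> carrier C"
begin

interpretation algebra field_ring C by (rule alg)

definition eval_mon :: "('x \<Rightarrow>\<^sub>0 nat) \<Rightarrow> 'c" where
  "eval_mon m = (\<Otimes>x\<in>Poly_Mapping.keys m. g x [^] Poly_Mapping.lookup m x)"

definition eval_pol :: "(('x \<Rightarrow>\<^sub>0 nat) \<Rightarrow>\<^sub>0 'k) \<Rightarrow> 'c" where
  "eval_pol p = (\<Oplus>m\<in>Poly_Mapping.keys p. Poly_Mapping.lookup p m \<odot> eval_mon m)"

lemma sm_closed: "x \<in> carrier C \<Longrightarrow> c \<odot> x \<in> carrier C"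
  using smult_closed by (simp add: field_ring_def)

lemma sm_add: "x \<in> carrier C \<Longrightarrow> (c + d) \<odot> x = c \<odot> x \<oplus> d \<odot> x"
  using smult_l_distr by (simp add: field_ring_def)

lemma sm_zero: "x \<in> carrier C \<Longrightarrow> 0 \<odot> x = \<zero>"
  using smult_l_null by (simp add: field_ring_def)

lemma sm_one: "x \<in> carrier C \<Longrightarrow> 1 \<odot> x = x"
  using smult_one by (simp add: field_ring_def)

lemma sm_assoc: "x \<in> carrier C \<Longrightarrow> (c * d) \<odot> x = c \<odot> (d \<odot> x)"
  using smult_assoc1 by (simp add: field_ring_def)

lemma sm_mult:
  assumes "x \<in> carrier C" "y \<in> carrier C"
  shows "(c \<odot> x) \<otimes> (d \<odot> y) = (c * d) \<odot> (x \<otimes> y)"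
proof -
  have a2: "(c \<odot> x) \<otimes> y = c \<odot> (x \<otimes> y)" if "x \<in> carrier C" "y \<in> carrier C" for c x y
    using smult_assoc2 that by (simp add: field_ring_def)
  have "(c \<odot> x) \<otimes> (d \<odot> y) = c \<odot> ((d \<odot> y) \<otimes> x)"
    using assms by (simp add: a2 sm_closed m_comm)
  also have "\<dots> = c \<odot> (d \<odot> (x \<otimes> y))" using assms by (simp add: a2 m_comm)
  finally show ?thesis using assms by (simp add: sm_assoc)
qed

lemma eval_mon_closed: "eval_mon m \<in> carrier C"
  unfolding eval_mon_def by (rule finprod_closed) (use g in auto)

lemma eval_mon_superset:
  assumes "finite S" "Poly_Mapping.keys m \<subseteq> S"
  shows "eval_mon m = (\<Otimes>x\<in>S. g x [^] Poly_Mapping.lookup m x)"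
  unfolding eval_mon_def
  by (rule finprod_mono_neutral_cong_left)
    (use assms g in \<open>auto simp: in_keys_iff\<close>)

lemma eval_mon_add: "eval_mon (m + m') = eval_mon m \<otimes> eval_mon m'"
proof -
  let ?S = "Poly_Mapping.keys m \<union> Poly_Mapping.keys m'"
  have "eval_mon (m + m') = (\<Otimes>x\<in>?S. g x [^] Poly_Mapping.lookup (m + m') x)"
    by (rule eval_mon_superset) (use keys_add[of m m'] in auto)
  also have "\<dots> = (\<Otimes>x\<in>?S. g x [^] Poly_Mapping.lookup m x \<otimes> g x [^] Poly_Mapping.lookup m' x)"
    using g by (intro finprod_cong') (auto simp: lookup_add nat_pow_mult)
  also have "\<dots> = (\<Otimes>x\<in>?S. g x [^] Poly_Mapping.lookup m x) \<otimes>
      (\<Otimes>x\<in>?S. g x [^] Poly_Mapping.lookup m' x)"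
    using g by (intro finprod_multf) auto
  also have "\<dots> = eval_mon m \<otimes> eval_mon m'"
    by (simp add: eval_mon_superset[of ?S])
  finally show ?thesis .
qed

lemma eval_pol_closed: "eval_pol p \<in> carrier C"
  unfolding eval_pol_def by (rule finsum_closed) (auto intro: sm_closed eval_mon_closed)

lemma eval_pol_superset:
  assumes "finite S" "Poly_Mapping.keys p \<subseteq> S"
  shows "eval_pol p = (\<Oplus>m\<in>S. Poly_Mapping.lookup p m \<odot> eval_mon m)"
  unfolding eval_pol_def
  by (rule add.finprod_mono_neutral_cong_left)
    (use assms in \<open>auto simp: in_keys_iff sm_zero eval_mon_closed sm_closed\<close>)

lemma eval_pol_add: "eval_pol (p + q) = eval_pol p \<oplus> eval_pol q"
proof -
  let ?S = "Poly_Mapping.keys p \<union> Poly_Mapping.keys q"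
  have "eval_pol (p + q) = (\<Oplus>m\<in>?S. Poly_Mapping.lookup (p + q) m \<odot> eval_mon m)"
    by (rule eval_pol_superset) (use keys_add[of p q] in auto)
  also have "\<dots> = (\<Oplus>m\<in>?S. Poly_Mapping.lookup p m \<odot> eval_mon m \<oplus>
      Poly_Mapping.lookup q m \<odot> eval_mon m)"
    by (intro finsum_cong')
      (auto simp: lookup_add sm_add eval_mon_closed sm_closed)
  also have "\<dots> = (\<Oplus>m\<in>?S. Poly_Mapping.lookup p m \<odot> eval_mon m) \<oplus>
      (\<Oplus>m\<in>?S. Poly_Mapping.lookup q m \<odot> eval_mon m)"
    by (intro finsum_addf) (auto simp: sm_closed eval_mon_closed)
  also have "\<dots> = eval_pol p \<oplus> eval_pol q"
    by (simp add: eval_pol_superset[of ?S])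
  finally show ?thesis .
qed

lemma eval_pol_single: "eval_pol (Poly_Mapping.single m c) = c \<odot> eval_mon m"
  by (subst eval_pol_superset[of "{m}"]) (auto simp: sm_closed eval_mon_closed)

lemma eval_pol_zero: "eval_pol 0 = \<zero>"
  by (simp add: eval_pol_def)

lemma eval_pol_one: "eval_pol 1 = \<one>"
  using eval_pol_single[of 0 1] by (simp add: eval_mon_def sm_one)

lemma eval_pol_mult: "eval_pol (p * q) = eval_pol p \<otimes> eval_pol q"
proof (induction p rule: poly_mapping_add_induct)
  case (single m c)
  show ?case
  proof (induction q rule: poly_mapping_add_induct)
    case (single m' c')
    show ?case
      by (simp add: mult_single eval_pol_single eval_mon_add sm_mult eval_mon_closed)
  qed (simp_all add: eval_pol_zero eval_pol_add eval_pol_closed distrib_left r_distr)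
qed (simp_all add: eval_pol_zero eval_pol_add eval_pol_closed distrib_right l_distr)

lemma eval_pol_uminus: "eval_pol (- p) = \<ominus> eval_pol p"
  using eval_pol_add[of "- p" p] eval_pol_closed
  by (metis M.minus_equality ab_group_add_class.ab_left_minus eval_pol_zero)

lemma eval_pol_diff: "eval_pol (p - q) = eval_pol p \<ominus> eval_pol q"
  using eval_pol_add[of p "- q"] by (simp add: eval_pol_uminus a_minus_def)

lemma eval_pol_scale: "eval_pol (Poly_Mapping.single 0 c * p) = c \<odot> eval_pol p"
  using sm_mult[of \<one> "eval_pol p" c 1] eval_pol_closed[of p]
  by (simp add: eval_pol_mult eval_pol_single eval_mon_def sm_one)

lemma eval_pol_sum:
  assumes "finite S"
  shows "eval_pol (\<Sum>l\<in>S. f l) = (\<Oplus>l\<in>S. eval_pol (f l))"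
  using assms by (induction S) (auto simp: eval_pol_zero eval_pol_add eval_pol_closed)

lemma eval_pol_var: "eval_pol (gen (Poly_Mapping.single x 1)) = g x"
  unfolding gen_def using g[of x]
  by (simp add: eval_pol_single sm_one eval_mon_closed)
    (simp add: eval_mon_def)

end

lemma rep_poly_induct [case_names const var add mult]:
  assumes const: "\<And>c. P (Poly_Mapping.single 0 c)"
    and var: "\<And>a i j. P (rvar a i j)"
    and add: "\<And>p q. P p \<Longrightarrow> P q \<Longrightarrow> P (p + q)"
    and mult: "\<And>p q. P p \<Longrightarrow> P q \<Longrightarrow> P (p * q)"
  shows "P (p :: ('k::field, 'a, 'v) rep_poly)"
proof (induction p rule: poly_mapping_add_induct)
  case zero
  then show ?case using const[of 0] by simp
next
  case (single m c)
  have "P (Poly_Mapping.single m 1)"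
  proof (induction m rule: poly_mapping_add_induct)
    case (single x n)
    obtain a i j where x: "x = (a, i, j)" by (cases x)
    show ?case
    proof (induction n)
      case (Suc n)
      have "Poly_Mapping.single (Poly_Mapping.single x (Suc n)) 1 =
          rvar a i j * Poly_Mapping.single (Poly_Mapping.single x n) (1 :: 'k)"
        by (simp add: rvar_def gen_def mult_single x flip: single_add)
      then show ?case using Suc var mult by metis
    qed (use const[of 1] in simp)
  next
    case (add m m')
    then show ?case using mult[OF add] by (simp add: mult_single)
  qed (rule const)
  from mult[OF const[of c] this] show ?case by (simp add: mult_single)
qed (rule add)

theorem rep_algebra_universal:
  fixes s :: "'k::field \<Rightarrow> 'a::{ring, monoid_mult} \<Rightarrow> 'a" and C :: "('k, 'c) module"
  assumes alg: "algebra field_ring C" and fin: "finite B" and \<rho>: "matrix_rep s B C \<rho>"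
  shows "\<exists>!\<phi>. \<phi> \<in> extensional (carrier (rep_algebra s B)) \<and> alg_hom (rep_algebra s B) C \<phi> \<and>
    (\<forall>a. \<forall>i\<in>B. \<forall>j\<in>B. \<phi> (univ_rep s B a i j) = \<rho> a i j)"
proof -
  interpret algebra field_ring C by (rule alg)
  let ?A = "rep_algebra s B" and ?I = "rep_ideal s B"
  interpret A: algebra field_ring ?A by (rule rep_algebra_algebra)
  define g where "g = (\<lambda>(a, i, j). if i \<in> B \<and> j \<in> B then \<rho> a i j else \<zero>\<^bsub>C\<^esub>)"
  have g: "g x \<in> carrier C" for x
    using \<rho> by (auto simp: g_def matrix_rep_def split: prod.split)
  let ?e = "eval_pol C g"
  note ev = eval_pol_closed[OF alg, of g] eval_pol_add[OF alg, of g] eval_pol_mult[OF alg, of g]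
    eval_pol_diff[OF alg, of g] eval_pol_zero[OF alg, of g] eval_pol_one[OF alg, of g]
    eval_pol_scale[OF alg, of g] eval_pol_sum[OF alg, of g]
  note ev = ev[OF g]
  have ev_fscale: "?e (fscale c p) = c \<odot>\<^bsub>C\<^esub> ?e p" for c p
    unfolding fscale_poly by (rule ev(7))
  have var: "?e (rvar a i j) = (if i \<in> B \<and> j \<in> B then \<rho> a i j else \<zero>\<^bsub>C\<^esub>)" for a i j
    unfolding rvar_def by (subst eval_pol_var[OF alg g]) (simp add: g_def)
  have ideal: "?e p = \<zero>\<^bsub>C\<^esub>" if "p \<in> ?I" for p
  proof -
    have "?I \<subseteq> {p. ?e p = \<zero>\<^bsub>C\<^esub>}" unfolding rep_ideal_def
    proof (rule Modules.module.span_minimal[OF times_module])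
      show "Modules.module.subspace (*) {p. ?e p = \<zero>\<^bsub>C\<^esub>}"
        by (rule Modules.module.subspaceI[OF times_module]) (auto simp: ev)
      have r: "x \<ominus>\<^bsub>C\<^esub> x = \<zero>\<^bsub>C\<^esub>" if "x \<in> carrier C" for x
        using that by (simp add: M.r_neg a_minus_def)
      have r2: "x \<oplus>\<^bsub>C\<^esub> y \<ominus>\<^bsub>C\<^esub> x \<ominus>\<^bsub>C\<^esub> y = \<zero>\<^bsub>C\<^esub>"
        if "x \<in> carrier C" "y \<in> carrier C" for x y
        using that by algebra
      have sum: "(\<Oplus>\<^bsub>C\<^esub>l\<in>B. (if l \<in> B then \<rho> a i l else \<zero>\<^bsub>C\<^esub>) \<otimes>\<^bsub>C\<^esub>
           (if l \<in> B then \<rho> b l j else \<zero>\<^bsub>C\<^esub>)) =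
         (\<Oplus>\<^bsub>C\<^esub>l\<in>B. \<rho> a i l \<otimes>\<^bsub>C\<^esub> \<rho> b l j)" if "i \<in> B" "j \<in> B" for a b i j
        by (rule finsum_cong') (use that \<rho> in \<open>auto simp: matrix_rep_def\<close>)
      show "{rvar a i j | a i j. i \<notin> B \<or> j \<notin> B} \<union>
        {rvar (a + b) i j - rvar a i j - rvar b i j | a b i j. i \<in> B \<and> j \<in> B} \<union>
        {rvar (s c a) i j - fscale c (rvar a i j) | c a i j. i \<in> B \<and> j \<in> B} \<union>
        {rvar (a * b) i j - (\<Sum>l\<in>B. rvar a i l * rvar b l j) | a b i j. i \<in> B \<and> j \<in> B} \<union>
        {rvar 1 i j - (if i = j then 1 else 0) | i j. i \<in> B \<and> j \<in> B}
        \<subseteq> {p. ?e p = \<zero>\<^bsub>C\<^esub>}"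
        using \<rho> fin by (auto simp: ev var ev_fscale matrix_rep_def sum r r2 sm_closed[OF alg g])
    qed
    with that show ?thesis by blast
  qed
  have wd: "?e (rep (cls ?I p)) = ?e p" for p
  proof -
    have "?e (rep (cls ?I p)) = ?e (rep (cls ?I p) - p) \<oplus>\<^bsub>C\<^esub> ?e p"
      unfolding ev(2)[symmetric] by simp
    then show ?thesis using ideal[OF rep_cls_rep_ideal] by (simp add: ev)
  qed
  define \<phi> where "\<phi> = restrict (\<lambda>x. ?e (rep x)) (carrier ?A)"
  have \<phi>: "\<phi> (cls ?I p) = ?e p" for p
    by (simp add: \<phi>_def rep_algebra_simps wd)
  have hom: "alg_hom ?A C \<phi>"
    unfolding alg_hom_def
  proof (intro conjI allI ballI ring_hom_memI)
    show "\<phi> x \<in> carrier C" if "x \<in> carrier ?A" for x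
      using that by (auto simp: rep_algebra_simps \<phi> ev)
  qed (auto simp: rep_algebra_simps \<phi> ev ev_fscale)
  show ?thesis
  proof (rule ex1I[of _ \<phi>], intro conjI allI ballI)
    show "\<phi> \<in> extensional (carrier ?A)" by (simp add: \<phi>_def)
    show "alg_hom ?A C \<phi>" by (rule hom)
    show "\<phi> (univ_rep s B a i j) = \<rho> a i j" if "i \<in> B" "j \<in> B" for a i j
      using that by (simp add: univ_rep_def \<phi> var)
  next
    fix \<psi> assume \<psi>: "\<psi> \<in> extensional (carrier ?A) \<and> alg_hom ?A C \<psi> \<and>
      (\<forall>a. \<forall>i\<in>B. \<forall>j\<in>B. \<psi> (univ_rep s B a i j) = \<rho> a i j)"
    then have hom\<psi>: "\<psi> \<in> ring_hom ?A C" by (simp add: alg_hom_def)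
    have z: "\<psi> (cls ?I 0) = \<zero>\<^bsub>C\<^esub>"
      using ring_hom_zero[OF hom\<psi> A.ring_axioms ring_axioms] by (simp add: rep_algebra_simps)
    have in_car: "cls ?I p \<in> carrier ?A" for p by (simp add: rep_algebra_simps)
    have eq: "\<psi> (cls ?I p) = ?e p" for p
    proof (induction p rule: rep_poly_induct)
      case (const c)
      have "cls ?I (Poly_Mapping.single 0 c) = c \<odot>\<^bsub>?A\<^esub> \<one>\<^bsub>?A\<^esub>"
        by (simp add: rep_algebra_simps fscale_poly)
      then have "\<psi> (cls ?I (Poly_Mapping.single 0 c)) = c \<odot>\<^bsub>C\<^esub> \<psi> \<one>\<^bsub>?A\<^esub>"
        using \<psi> by (simp add: alg_hom_def)
      also have "\<dots> = c \<odot>\<^bsub>C\<^esub> \<one>\<^bsub>C\<^esub>" using ring_hom_one[OF hom\<psi>] by simp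
      also have "\<dots> = ?e (Poly_Mapping.single 0 c)"
        using ev(7)[of c 1] ev(6) by simp
      finally show ?case .
    next
      case (var a i j)
      show ?case
      proof (cases "i \<in> B \<and> j \<in> B")
        case True
        then show ?thesis using \<psi> \<open>?e (rvar a i j) = _\<close> by (simp add: univ_rep_def)
      next
        case False
        have "rvar a i j \<in> ?I" unfolding rep_ideal_def
          by (rule Modules.module.span_base[OF times_module]) (use False in blast)
        then have "cls ?I (rvar a i j) = cls ?I 0" by (simp add: cls_rep_ideal_eq)
        then show ?thesis using z False \<open>?e (rvar a i j) = _\<close> by auto
      qed
    next
      case (add p q)
      then show ?case
        using ring_hom_add[OF hom\<psi> in_car in_car, of p q] by (simp add: rep_algebra_simps ev)
    next
      case (mult p q)
      then show ?case
        using ring_hom_mult[OF hom\<psi> in_car in_car, of p q] by (simp add: rep_algebra_simps ev)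
    qed
    show "\<psi> = \<phi>"
    proof (rule extensionalityI)
      show "\<psi> \<in> extensional (carrier ?A)" using \<psi> by blast
      show "\<phi> \<in> extensional (carrier ?A)" by (simp add: \<phi>_def)
      show "\<psi> x = \<phi> x" if "x \<in> carrier ?A" for x
        using that by (auto simp: rep_algebra_simps eq \<phi>)
    qed
  qed
qed

text \<open>
  The form \<open>\<omega>\<^sub>V\<close>. A formal sum \<open>F\<close> of triples with \<open>nc_form s F = \<omega>\<close> is a presentation of \<open>\<omega>\<close> as
  \<open>\<Sum> a\<^sub>0 da\<^sub>1 da\<^sub>2\<close>, and \<open>trace_form s B F\<close> is the trace of the corresponding sum of products of
  matrices \<open>\<pi>(a\<^sub>0) d\<pi>(a\<^sub>1) d\<pi>(a\<^sub>2)\<close>.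
\<close>

definition nc_form :: "('k::field \<Rightarrow> 'a::{ring, monoid_mult} \<Rightarrow> 'a)
    \<Rightarrow> ('a \<times> 'a \<times> 'a \<Rightarrow>\<^sub>0 'k) \<Rightarrow> (('a \<times> 'a \<Rightarrow>\<^sub>0 'k) set list \<Rightarrow>\<^sub>0 'k) set" where
  "nc_form s F = cls (dr_sub s 2)
     (lext (\<lambda>(a0, a1, a2). gen [mleft (nc_Omega1 s) a0 (nc_d0 s a1), nc_d0 s a2]) F)"

definition trace_form :: "('k::field \<Rightarrow> 'a::{ring, monoid_mult} \<Rightarrow> 'a) \<Rightarrow> 'v set
    \<Rightarrow> ('a \<times> 'a \<times> 'a \<Rightarrow>\<^sub>0 'k)
    \<Rightarrow> ((('k, 'a, 'v) rep_poly set \<times> ('k, 'a, 'v) rep_poly set \<Rightarrow>\<^sub>0 'k) set list \<Rightarrow>\<^sub>0 'k) set" where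
  "trace_form s B F = (let C = rep_algebra s B; x = univ_rep s B; d = comm_d0 C in
     cls (ext_sub C 2)
       (lext (\<lambda>(a0, a1, a2). \<Sum>i\<in>B. \<Sum>j\<in>B. \<Sum>l\<in>B.
                gen [mleft (Kaehler C) (x a0 i j) (d (x a1 j l)), d (x a2 l i)]) F))"

definition induced_form :: "('k::field \<Rightarrow> 'a::{ring, monoid_mult} \<Rightarrow> 'a) \<Rightarrow> 'v set
    \<Rightarrow> (('a \<times> 'a \<Rightarrow>\<^sub>0 'k) set list \<Rightarrow>\<^sub>0 'k) set
    \<Rightarrow> ((('k, 'a, 'v) rep_poly set \<times> ('k, 'a, 'v) rep_poly set \<Rightarrow>\<^sub>0 'k) set list \<Rightarrow>\<^sub>0 'k) set" where
  "induced_form s B \<omega> = trace_form s B (SOME F. nc_form s F = \<omega>)"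

end

theory Submission
  imports Defs
begin

text \<open>
  A double derivation \<open>\<Theta>\<close> of \<open>A\<close> induces derivations \<open>\<Theta>\<^sub>i\<^sub>j\<close> of \<open>A\<^sub>V\<close>, and a one-form \<open>\<alpha>\<close> on \<open>A\<close> induces a
  matrix of one-forms \<open>\<alpha>\<^sub>i\<^sub>j\<close> on \<open>A\<^sub>V\<close>, in such a way that contracting \<open>\<omega>\<^sub>V\<close> with \<open>\<Theta>\<^sub>i\<^sub>j\<close> gives \<open>(\<iota>\<^sub>\<Theta>\<omega>)\<^sub>i\<^sub>j\<close>. Since
  \<open>da = \<iota>\<^sub>\<Theta>\<omega>\<close> for some \<open>\<Theta>\<close>, the differentials of the generators \<open>a\<^sub>i\<^sub>j\<close> of \<open>A\<^sub>V\<close> are contractions of \<open>\<omega>\<^sub>V\<close>; hence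
  all one-forms are. If \<open>i\<^sub>\<theta>\<omega>\<^sub>V = 0\<close>, then \<open>\<langle>\<theta>, i\<^sub>\<psi>\<omega>\<^sub>V\<rangle> = - \<langle>\<psi>, i\<^sub>\<theta>\<omega>\<^sub>V\<rangle> = 0\<close> for all \<open>\<psi>\<close>, so \<open>\<theta>\<close> kills all
  one-forms and vanishes. Closedness holds because the trace \<open>\<alpha> \<dots> \<gamma> \<mapsto> \<Sum> \<alpha>\<^sub>i\<^sub>j \<dots> \<gamma>\<^sub>k\<^sub>i\<close> is well
  defined on Karoubi-de Rham forms and commutes with \<open>d\<close>.
\<close>

section \<open>Linear algebra of formal sums\<close>

text \<open>The shape of the derivation \<open>\<Theta>\<^sub>i\<^sub>j\<close> is dictated by the
  flip in the reduced contraction, where the two factors of \<Theta> surround a form \<beta> in the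
  order \<Theta>'' \<beta> \<Theta>'. The (i, j) entry of this product is the sum over u, v of
  \<Theta>''_iv \<beta>_vu \<Theta>'_uj. Contracting the trace \<Sum> \<alpha>_uv \<beta>_vu with a
  derivation multiplies \<beta>_vu by the value on \<alpha>_uv, so that value has to be \<Theta>'_uj
  \<Theta>''_iv. The indices i, j then sit on the inside and stay free, while u, v sit on the
  outside, where the outer Leibniz rule turns into matrix multiplication. The other obstacle is
  formal. Every quotient consists of cosets, and every map out of it is evaluated on an arbitrarily
  chosen representative, so each identity contains a claim of well-definedness. Presenting elements
  by formal sums, and comparing them through a linear projection whose kernel is the span of the
  relations, reduces such claims to checks on generators.\<close>

lemma lookup_fscale [simp]: "Poly_Mapping.lookup (fscale c f) x = c * Poly_Mapping.lookup f x"
  by (simp add: fscale_def Poly_Mapping.map.rep_eq when_def)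

interpretation fvs: vector_space "fscale :: 'k::field \<Rightarrow> ('x \<Rightarrow>\<^sub>0 'k) \<Rightarrow> _"
  by unfold_locales (auto intro!: poly_mapping_eqI simp: lookup_add algebra_simps)

interpretation fvp: vector_space_pair "fscale :: 'k::field \<Rightarrow> ('x \<Rightarrow>\<^sub>0 'k) \<Rightarrow> _"
    "fscale :: 'k::field \<Rightarrow> ('y \<Rightarrow>\<^sub>0 'k) \<Rightarrow> _"
  by unfold_locales

abbreviation flinear :: "(('x \<Rightarrow>\<^sub>0 'k::field) \<Rightarrow> ('y \<Rightarrow>\<^sub>0 'k)) \<Rightarrow> bool" where
  "flinear \<equiv> Vector_Spaces.linear fscale fscale"

lemma flinearI:
  assumes "\<And>x y. L (x + y) = L x + L y" "\<And>c x. L (fscale c x) = fscale c (L x)"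
  shows "flinear L"
  using assms by unfold_locales auto

lemmas fl_add = fvp.linear_add and fl_scale = fvp.linear_scale and fl_diff = fvp.linear_diff
  and fl_zero = fvp.linear_0 and fl_neg = fvp.linear_neg and fl_sum = fvp.linear_sum

lemma flinear_compose: "flinear L \<Longrightarrow> flinear M \<Longrightarrow> flinear (\<lambda>x. M (L x))"
  by (intro flinearI) (simp_all add: fl_add fl_scale)

lemma flinear_plus: "flinear L \<Longrightarrow> flinear M \<Longrightarrow> flinear (\<lambda>x. L x + M x)"
  by (intro flinearI) (simp_all add: fl_add fl_scale fvs.scale_right_distrib)

lemma flinear_minus: "flinear L \<Longrightarrow> flinear M \<Longrightarrow> flinear (\<lambda>x. L x - M x)"
  by (intro flinearI) (simp_all add: fl_add fl_scale fvs.scale_right_diff_distrib)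

lemma flinear_fscale: "flinear L \<Longrightarrow> flinear (\<lambda>x. fscale c (L x))"
  by (intro flinearI) (simp_all add: fl_add fl_scale fvs.scale_right_distrib mult.commute)

lemma flinear_sum: "(\<And>i. i \<in> S \<Longrightarrow> flinear (L i)) \<Longrightarrow> flinear (\<lambda>x. \<Sum>i\<in>S. L i x)"
  by (intro flinearI) (simp_all add: fl_add fl_scale sum.distrib fvs.scale_sum_right)

lemma flinear_id: "flinear (\<lambda>x. x)"
  by (intro flinearI) simp_all

lemma single_gen: "Poly_Mapping.single x c = fscale c (gen x)"
  by (rule poly_mapping_eqI) (simp add: gen_def lookup_single when_def)

lemma lookup_gen: "Poly_Mapping.lookup (gen x) y = (if x = y then 1 else 0)"
  by (simp add: gen_def lookup_single when_def)

lemma keys_gen [simp]: "Poly_Mapping.keys (gen x :: 'x \<Rightarrow>\<^sub>0 'k::field) = {x}"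
  by (simp add: gen_def)

lemma fsum_induct [case_names zero gen add scale]:
  assumes "P 0" "\<And>x. P (gen x)" "\<And>f g. P f \<Longrightarrow> P g \<Longrightarrow> P (f + g)" "\<And>c f. P f \<Longrightarrow> P (fscale c f)"
  shows "P (f :: 'x \<Rightarrow>\<^sub>0 'k::field)"
  by (induction f rule: poly_mapping_add_induct) (simp_all add: single_gen assms)

lemma flinear_ext:
  assumes "flinear L" "flinear M" "\<And>x. L (gen x) = M (gen x)"
  shows "L f = M f"
  by (induction f rule: fsum_induct)
    (simp_all add: assms fl_add[OF assms(1)] fl_add[OF assms(2)] fl_scale[OF assms(1)]
      fl_scale[OF assms(2)] fl_zero[OF assms(1)] fl_zero[OF assms(2)])

lemma flinear_ext2:
  assumes "\<And>g. flinear (\<lambda>f. L f g)" "\<And>f. flinear (L f)"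
    and "\<And>g. flinear (\<lambda>f. M f g)" "\<And>f. flinear (M f)"
    and "\<And>x y. L (gen x) (gen y) = M (gen x) (gen y)"
  shows "L f g = M f g"
proof (rule flinear_ext[of "\<lambda>f. L f g" "\<lambda>f. M f g"])
  show "L (gen x) g = M (gen x) g" for x
    by (rule flinear_ext) (rule assms)+
qed (rule assms)+

lemma lext_superset:
  fixes f :: "'x \<Rightarrow>\<^sub>0 'k::field"
  assumes "finite S" "Poly_Mapping.keys f \<subseteq> S"
  shows "lext g f = (\<Sum>x\<in>S. fscale (Poly_Mapping.lookup f x) (g x))"
  unfolding lext_def by (rule sum.mono_neutral_left) (use assms in \<open>auto simp: in_keys_iff\<close>)

lemma flinear_lext: "flinear (lext g :: ('x \<Rightarrow>\<^sub>0 'k::field) \<Rightarrow> _)"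
proof (rule flinearI)
  fix f h :: "'x \<Rightarrow>\<^sub>0 'k" and c
  let ?S = "Poly_Mapping.keys f \<union> Poly_Mapping.keys h"
  have "lext g (f + h) = (\<Sum>x\<in>?S. fscale (Poly_Mapping.lookup (f + h) x) (g x))"
    by (rule lext_superset) (use keys_add[of f h] in auto)
  also have "\<dots> = lext g f + lext g h"
    by (simp add: lookup_add fvs.scale_left_distrib sum.distrib lext_superset[of ?S])
  finally show "lext g (f + h) = lext g f + lext g h" .
  have "lext g (fscale c f) =
      (\<Sum>x\<in>Poly_Mapping.keys f. fscale (Poly_Mapping.lookup (fscale c f) x) (g x))"
    by (rule lext_superset) (auto simp: in_keys_iff)
  then show "lext g (fscale c f) = fscale c (lext g f)"
    by (simp add: lext_def fvs.scale_sum_right)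
qed

lemmas lext_add = fl_add[OF flinear_lext] and lext_scale = fl_scale[OF flinear_lext]
  and lext_diff = fl_diff[OF flinear_lext]
  and lext_neg = fl_neg[OF flinear_lext] and lext_sum = fl_sum[OF flinear_lext]

lemma lext_gen [simp]: "lext g (gen x :: _ \<Rightarrow>\<^sub>0 'k::field) = g x"
  by (simp add: lext_def lookup_gen)

lemma lext_cong: "(\<And>x. x \<in> Poly_Mapping.keys f \<Longrightarrow> g x = h x) \<Longrightarrow> lext g f = lext h f"
  unfolding lext_def by (rule sum.cong) simp_all

lemma flinear_lext_comp: "flinear L \<Longrightarrow> L (lext g f) = lext (\<lambda>x. L (g x)) f"
  by (rule flinear_ext) (simp_all add: flinear_compose[OF flinear_lext] flinear_lext)

lemma lext_lext: "lext g (lext h (f :: _ \<Rightarrow>\<^sub>0 'k::field)) = lext (\<lambda>x. lext g (h x)) f"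
  by (rule flinear_lext_comp[OF flinear_lext])

lemma lext_gen_id [simp]: "lext gen f = (f :: _ \<Rightarrow>\<^sub>0 'k::field)"
  by (rule flinear_ext[OF flinear_lext flinear_id]) simp

text \<open>Linearity in the coefficient map rather than in the formal sum; together with
  \<open>flinear_lext\<close> it makes iterated extensions such as \<open>d_wedge\<close>
  bilinear.\<close>

lemma flinear_lext_param:
  assumes "\<And>x. flinear (\<lambda>f. G f x)"
  shows "flinear (\<lambda>f. lext (G f) h)"
  by (intro flinearI)
    (simp_all add: lext_def fl_add[OF assms] fl_scale[OF assms] fvs.scale_right_distrib
      sum.distrib fvs.scale_sum_right mult.commute)

lemma lext_plus_fun: "lext (\<lambda>x. g x + h x) (f :: _ \<Rightarrow>\<^sub>0 'k::field) = lext g f + lext h f"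
  by (simp add: lext_def fvs.scale_right_distrib sum.distrib)

lemma lext_uminus_fun: "lext (\<lambda>x. - g x) (f :: _ \<Rightarrow>\<^sub>0 'k::field) = - lext g f"
  by (simp add: lext_def sum_negf)

lemma lext_fscale_fun: "lext (\<lambda>x. fscale c (g x)) (f :: _ \<Rightarrow>\<^sub>0 'k::field) = fscale c (lext g f)"
  by (simp add: lext_def fvs.scale_sum_right mult.commute)

lemma lext_sum_fun: "lext (\<lambda>x. \<Sum>i\<in>S. g i x) (f :: _ \<Rightarrow>\<^sub>0 'k::field) = (\<Sum>i\<in>S. lext (g i) f)"
  by (simp add: lext_def fvs.scale_sum_right sum.swap[of _ S])

section \<open>Spans of relations and their cosets\<close>

lemma fspan_simps:
  fixes R :: "('x \<Rightarrow>\<^sub>0 'k::field) set"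
  shows
  "0 \<in> fspan R" "f \<in> fspan R \<Longrightarrow> g \<in> fspan R \<Longrightarrow> f + g \<in> fspan R"
  "f \<in> fspan R \<Longrightarrow> g \<in> fspan R \<Longrightarrow> f - g \<in> fspan R" "f \<in> fspan R \<Longrightarrow> fscale c f \<in> fspan R"
  "f \<in> R \<Longrightarrow> f \<in> fspan R" "fspan (fspan R) = fspan R"
  by (simp_all add: fspan_def fvs.span_zero fvs.span_add fvs.span_diff fvs.span_scale fvs.span_base
      fvs.span_span)

text \<open>The entry point for well-definedness: a linear map descends to a quotient as soon as it
  kills the generating relations.\<close>

lemma fspan_kernel:
  assumes "flinear L" "\<And>r. r \<in> R \<Longrightarrow> L r = 0" "f \<in> fspan R"
  shows "L f = 0"
  using assms(3) unfolding fspan_def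
  by (induction rule: fvs.span_induct_alt)
    (simp_all add: fl_zero[OF assms(1)] fl_add[OF assms(1)] fl_scale[OF assms(1)] assms(2))

lemma fspan_keys:
  fixes R :: "('x \<Rightarrow>\<^sub>0 'k::field) set"
  assumes "\<And>r. r \<in> R \<Longrightarrow> Poly_Mapping.keys r \<subseteq> G" "f \<in> fspan R"
  shows "Poly_Mapping.keys f \<subseteq> G"
  using assms(2) unfolding fspan_def
proof (induction rule: fvs.span_induct_alt)
  case (step c x y)
  have "Poly_Mapping.keys (fscale c x) \<subseteq> Poly_Mapping.keys x" by (auto simp: in_keys_iff)
  then show ?case
    using step assms(1)[of x] keys_add[of "fscale c x" y] by blast
qed simp

text \<open>Over a field the span has a complement. The map \<open>?c\<close> fixes a basis of the
  span and kills the remaining vectors of an extension to a basis of the whole space, so it projects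
  onto the span, and \<open>f - ?c f\<close> vanishes exactly there.\<close>

lemma projection_along_span:
  "\<exists>\<pi> :: ('x \<Rightarrow>\<^sub>0 'k::field) \<Rightarrow> ('x \<Rightarrow>\<^sub>0 'k). flinear \<pi> \<and> (\<forall>f. \<pi> f = 0 \<longleftrightarrow> f \<in> fspan S)"
proof -
  obtain D where D: "D \<subseteq> S" "fvs.independent D" "S \<subseteq> fvs.span D"
    using fvs.maximal_independent_subset[of S] by blast
  have span: "fvs.span D = fspan S"
    unfolding fspan_def using D by (meson fvs.span_mono fvs.span_minimal fvs.subspace_span subset_antisym)
  let ?c = "fvp.construct D (\<lambda>x. x)"
  have lin: "flinear ?c" by (rule fvp.linear_construct[OF D(2)])
  have "?c f \<in> fspan S" for f
    using fvp.construct_in_span[OF D(2), of "\<lambda>x. x" f] by (simp add: span)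
  moreover have "?c f = f" if "f \<in> fspan S" for f
  proof (rule fvp.linear_eq_on[OF lin flinear_id])
    show "f \<in> fvs.span D" using that span by simp
  qed (simp add: fvp.construct_basis[OF D(2)])
  ultimately have ker: "f - ?c f = 0 \<longleftrightarrow> f \<in> fspan S" for f
    by (metis eq_iff_diff_eq_0)
  show ?thesis
  proof (intro exI conjI allI)
    show "flinear (\<lambda>f. f - ?c f)" by (rule flinear_minus[OF flinear_id lin])
  qed (rule ker)
qed

text \<open>Applying \<open>prj S\<close> turns congruences modulo the span of \<open>S\<close> into equations, so that calculations
  in a quotient take place in a type that is an abelian group.\<close>

definition prj :: "('x \<Rightarrow>\<^sub>0 'k::field) set \<Rightarrow> ('x \<Rightarrow>\<^sub>0 'k) \<Rightarrow> ('x \<Rightarrow>\<^sub>0 'k)" where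
  "prj S = (SOME \<pi>. flinear \<pi> \<and> (\<forall>f. \<pi> f = 0 \<longleftrightarrow> f \<in> fspan S))"

lemma flinear_prj: "flinear (prj S)" and prj_eq_0_iff: "prj S f = 0 \<longleftrightarrow> f \<in> fspan S"
  using someI_ex[OF projection_along_span[of S]] unfolding prj_def by blast+

lemmas prj_add = fl_add[OF flinear_prj] and prj_scale = fl_scale[OF flinear_prj]
  and prj_diff = fl_diff[OF flinear_prj] and prj_zero = fl_zero[OF flinear_prj]
  and prj_neg = fl_neg[OF flinear_prj] and prj_sum = fl_sum[OF flinear_prj]

lemma prj_lext: "prj S (lext g f) = lext (\<lambda>x. prj S (g x)) f"
  by (rule flinear_lext_comp[OF flinear_prj])

text \<open>\<open>prj S\<close> kills the span of \<open>S\<close>, whereas \<open>cls S\<close>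
  uses \<open>S\<close> itself; under this condition the two agree. It holds for
  \<open>tsq_sub\<close>, \<open>dr_sub\<close>, \<open>kaehler_sub\<close> and
  \<open>ext_sub\<close>.\<close>

definition is_span :: "('x \<Rightarrow>\<^sub>0 'k::field) set \<Rightarrow> bool" where
  "is_span S \<longleftrightarrow> fspan S = S"

lemma is_span_fspan: "is_span (fspan R)"
  by (simp add: is_span_def fspan_simps)

lemma cls_eq_iff:
  assumes "is_span S"
  shows "cls S f = cls S g \<longleftrightarrow> prj S f = prj S g"
proof -
  have S: "fspan S = S" using assms by (simp add: is_span_def)
  have "cls S f = cls S g \<longleftrightarrow> f - g \<in> S"
  proof
    assume "cls S f = cls S g"
    then show "f - g \<in> S" using fspan_simps(1)[of S] by (auto simp: cls_def S)
  next
    assume a: "f - g \<in> S"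
    have "h - f \<in> S \<longleftrightarrow> h - g \<in> S" for h
      using fspan_simps(2)[of "h - f" S "f - g"] fspan_simps(3)[of "h - g" S "f - g"] a
      by (auto simp: S)
    then show "cls S f = cls S g" by (simp add: cls_def)
  qed
  also have "\<dots> \<longleftrightarrow> prj S f = prj S g"
    using prj_eq_0_iff[of S "f - g"] by (simp add: prj_diff S)
  finally show ?thesis .
qed

lemma rep_cls_mem:
  assumes "is_span S"
  shows "rep (cls S f) - f \<in> S"
proof -
  have "f \<in> cls S f" using fspan_simps(1)[of S] assms by (simp add: cls_def is_span_def)
  then have "rep (cls S f) \<in> cls S f" unfolding rep_def by (rule someI)
  then show ?thesis by (simp add: cls_def)
qed

text \<open>\<open>rep\<close> is an arbitrary choice in the coset, but it differs from
  \<open>f\<close> only by an element of \<open>S\<close>. This is how a map evaluated on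
  \<open>rep\<close> is computed on a known representative.\<close>

lemma linear_rep_cls:
  assumes "is_span S" "flinear L" "\<And>f. f \<in> S \<Longrightarrow> L f = 0"
  shows "L (rep (cls S f)) = L f"
  using assms(3)[OF rep_cls_mem[OF assms(1), of f]] by (simp add: fl_diff[OF assms(2)])

lemma prj_rep_cls [simp]: "is_span S \<Longrightarrow> prj S (rep (cls S f)) = prj S f"
  by (rule linear_rep_cls) (auto simp: flinear_prj prj_eq_0_iff is_span_def)

lemma cls_rep: "is_span S \<Longrightarrow> X = cls S f \<Longrightarrow> cls S (rep X) = X"
  by (simp add: cls_eq_iff)

lemma keys_diff_subset: "Poly_Mapping.keys (f - g) \<subseteq> Poly_Mapping.keys f \<union> Poly_Mapping.keys (g :: 'x \<Rightarrow>\<^sub>0 'k::field)"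
  by (auto simp: in_keys_iff lookup_minus)

lemma keys_fscale_subset: "Poly_Mapping.keys (fscale c f) \<subseteq> Poly_Mapping.keys (f :: 'x \<Rightarrow>\<^sub>0 'k::field)"
  by (auto simp: in_keys_iff)

text \<open>The relations involve only generators from \<open>G\<close>, so every element of the
  coset does too, whichever one \<open>rep\<close> picks. Needed where a map is meaningful only on
  such generators, for instance on elements of a carrier or on words of a fixed length.\<close>

lemma keys_rep_cls:
  fixes R :: "('x \<Rightarrow>\<^sub>0 'k::field) set"
  assumes "\<And>r. r \<in> R \<Longrightarrow> Poly_Mapping.keys r \<subseteq> G" "Poly_Mapping.keys f \<subseteq> G"
  shows "Poly_Mapping.keys (rep (cls (fspan R) f)) \<subseteq> G"
proof -
  let ?h = "rep (cls (fspan R) f)"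
  have "Poly_Mapping.keys (?h - f) \<subseteq> G"
    by (rule fspan_keys[of R]) (use assms(1) rep_cls_mem[OF is_span_fspan] in auto)
  then show ?thesis using keys_add[of "?h - f" f] assms(2) by auto
qed

lemma keys_lext:
  fixes f :: "'x \<Rightarrow>\<^sub>0 'k::field"
  assumes "\<And>x. x \<in> Poly_Mapping.keys f \<Longrightarrow> Poly_Mapping.keys (g x) \<subseteq> G"
  shows "Poly_Mapping.keys (lext g f) \<subseteq> G"
proof -
  have "Poly_Mapping.keys (lext g f) \<subseteq>
      (\<Union>x\<in>Poly_Mapping.keys f. Poly_Mapping.keys (fscale (Poly_Mapping.lookup f x) (g x)))"
    unfolding lext_def by (rule keys_sum)
  also have "\<dots> \<subseteq> G" using assms keys_fscale_subset by fast
  finally show ?thesis .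
qed

section \<open>Differential forms of a presented commutative algebra\<close>

lemma fscale_conv_mult: "fscale c p = Poly_Mapping.single 0 c * (p :: 'm::comm_monoid_add \<Rightarrow>\<^sub>0 'k::field)"
  by (simp add: fscale_def mult_map_scale_conv_mult)

lemma fscale_mult:
  "fscale c p * r = fscale c (p * (r :: 'm::comm_monoid_add \<Rightarrow>\<^sub>0 'k::field))"
  "p * fscale c r = fscale c (p * r)"
  by (simp_all add: fscale_conv_mult ac_simps)

lemma prj_eq_0_is_span: "is_span S \<Longrightarrow> prj S f = 0 \<longleftrightarrow> f \<in> S"
  by (simp add: prj_eq_0_iff is_span_def)

section \<open>Tensor powers of a bimodule given by representatives\<close>

lemma tensor_rels_cases [consumes 1, case_names add scale balance]:
  assumes "r \<in> tensor_rels R M n"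
  obtains u x y v where "r = gen (u @ [madd M x y] @ v) - gen (u @ [x] @ v) - gen (u @ [y] @ v)"
      "u @ [x] @ v \<in> mwords M n" "y \<in> mcar M"
    | u c x v where "r = gen (u @ [mscale M c x] @ v) - fscale c (gen (u @ [x] @ v))"
      "u @ [x] @ v \<in> mwords M n"
    | u x z y v where "r = gen (u @ [mright M x z, y] @ v) - gen (u @ [x, mleft M z y] @ v)"
      "u @ [x, y] @ v \<in> mwords M n" "z \<in> R"
  using assms unfolding tensor_rels_def
  by (elim UnE CollectE exE conjE)
    (rule that(1), assumption, assumption, assumption | rule that(2), assumption, assumption |
      rule that(3), assumption, assumption, assumption)+

text \<open>Common frame for \<open>Kaehler C\<close> and \<open>nc_Omega1 s\<close>: elements are
  \<open>\<kappa> f\<close> for formal sums \<open>f\<close>, and both actions are computed on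
  \<open>f\<close>. Multilinearity of words can then be stated as linearity in formal sums.\<close>

locale presented_bimodule =
  fixes R :: "'r set" and M :: "('k::field, 'r, 'm) bimod" and \<iota> :: "'z \<Rightarrow> 'r"
    and \<kappa> :: "('f \<Rightarrow>\<^sub>0 'k) \<Rightarrow> 'm" and lmul form_rmul :: "'z \<Rightarrow> ('f \<Rightarrow>\<^sub>0 'k) \<Rightarrow> ('f \<Rightarrow>\<^sub>0 'k)"
  assumes R_range: "R = range \<iota>" and mcar_range: "mcar M = range \<kappa>"
    and madd_pres: "madd M (\<kappa> f) (\<kappa> g) = \<kappa> (f + g)"
    and mscale_pres: "mscale M c (\<kappa> f) = \<kappa> (fscale c f)"
    and mleft_pres: "mleft M (\<iota> z) (\<kappa> f) = \<kappa> (lmul z f)"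
    and mright_pres: "mright M (\<kappa> f) (\<iota> z) = \<kappa> (form_rmul z f)"
begin

lemma map_mwords: "map \<kappa> w \<in> mwords M n \<longleftrightarrow> length w = n"
  by (auto simp: mwords_def mcar_range)

text \<open>Lifting letter by letter with one section of \<open>\<kappa>\<close> gives equal letters
  equal lifts. The second conjunct records this: a word with a repeated letter has a lift with a
  repeated letter, as the alternating relations require.\<close>

lemma list_lift:
  assumes "set w \<subseteq> mcar M"
  shows "\<exists>w'. w = map \<kappa> w' \<and> (distinct w' \<longrightarrow> distinct w)"
proof (intro exI conjI)
  let ?l = "inv_into UNIV \<kappa>"
  have *: "\<kappa> (?l X) = X" if "X \<in> set w" for X
    using that assms by (auto simp: mcar_range f_inv_into_f)
  then show "w = map \<kappa> (map ?l w)" by (simp add: map_idI)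
  show "distinct (map ?l w) \<longrightarrow> distinct w" by (simp add: distinct_map)
qed

lemma word_lift:
  assumes "w \<in> mwords M n"
  shows "\<exists>w'. w = map \<kappa> w' \<and> length w' = n \<and> (distinct w' \<longrightarrow> distinct w)"
  using list_lift[of w] assms by (auto simp: mwords_def)

lemma flinear_word:
  assumes L: "flinear L" and rel: "\<And>r. r \<in> tensor_rels R M (length u + Suc (length v)) \<Longrightarrow> L r = 0"
  shows "flinear (\<lambda>f. L (gen (map \<kappa> (u @ [f] @ v))))"
proof (rule flinearI)
  fix f g c
  let ?n = "length u + Suc (length v)"
  have m: "map \<kappa> u @ [\<kappa> f] @ map \<kappa> v \<in> mwords M ?n" "\<kappa> g \<in> mcar M"
    using map_mwords[of "u @ [f] @ v" ?n] by (simp_all add: mcar_range)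
  have "gen (map \<kappa> u @ [madd M (\<kappa> f) (\<kappa> g)] @ map \<kappa> v) - gen (map \<kappa> u @ [\<kappa> f] @ map \<kappa> v)
       - gen (map \<kappa> u @ [\<kappa> g] @ map \<kappa> v) \<in> tensor_rels R M ?n"
    unfolding tensor_rels_def using m by blast
  from rel[OF this] show "L (gen (map \<kappa> (u @ [f + g] @ v))) =
      L (gen (map \<kappa> (u @ [f] @ v))) + L (gen (map \<kappa> (u @ [g] @ v)))"
    by (simp add: fl_diff[OF L] madd_pres diff_eq_eq add.commute)
  have "gen (map \<kappa> u @ [mscale M c (\<kappa> f)] @ map \<kappa> v)
       - fscale c (gen (map \<kappa> u @ [\<kappa> f] @ map \<kappa> v)) \<in> tensor_rels R M ?n"
    unfolding tensor_rels_def using m by blast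
  from rel[OF this] show "L (gen (map \<kappa> (u @ [fscale c f] @ v))) =
      fscale c (L (gen (map \<kappa> (u @ [f] @ v))))"
    by (simp add: fl_diff[OF L] fl_scale[OF L] mscale_pres)
qed

lemma word_balance:
  assumes L: "flinear L"
    and rel: "\<And>r. r \<in> tensor_rels R M (length u + Suc (Suc (length v))) \<Longrightarrow> L r = 0"
  shows "L (gen (map \<kappa> (u @ [form_rmul z f, g] @ v))) = L (gen (map \<kappa> (u @ [f, lmul z g] @ v)))"
proof -
  let ?n = "length u + Suc (Suc (length v))"
  have m: "map \<kappa> u @ [\<kappa> f, \<kappa> g] @ map \<kappa> v \<in> mwords M ?n" "\<iota> z \<in> R"
    using map_mwords[of "u @ [f, g] @ v" ?n] by (simp_all add: R_range)
  have "gen (map \<kappa> u @ [mright M (\<kappa> f) (\<iota> z), \<kappa> g] @ map \<kappa> v)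
     - gen (map \<kappa> u @ [\<kappa> f, mleft M (\<iota> z) (\<kappa> g)] @ map \<kappa> v) \<in> tensor_rels R M ?n"
    unfolding tensor_rels_def using m by blast
  from rel[OF this] show ?thesis by (simp add: fl_diff[OF L] mleft_pres mright_pres)
qed

text \<open>Converse of \<open>flinear_word\<close> and \<open>word_balance\<close>: since every
  letter is some \<open>\<kappa> f\<close>, a map that is linear in each slot and balanced between
  neighbours kills all tensor relations.\<close>

lemma tensor_rels_kernel:
  assumes L: "flinear L"
    and lin: "\<And>u v. length u + length v + 1 = n \<Longrightarrow> flinear (\<lambda>f. L (gen (map \<kappa> (u @ [f] @ v))))"
    and balance: "\<And>u v z f g. length u + length v + 2 = n \<Longrightarrow>
        L (gen (map \<kappa> (u @ [form_rmul z f, g] @ v))) = L (gen (map \<kappa> (u @ [f, lmul z g] @ v)))"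
    and "r \<in> tensor_rels R M n"
  shows "L r = 0"
proof -
  have word: "set u \<subseteq> mcar M" "set v \<subseteq> mcar M" "x \<in> mcar M" if "u @ [x] @ v \<in> mwords M n" for u x v
    using that by (simp_all add: mwords_def)
  have mcar: "\<exists>f. x = \<kappa> f" if "x \<in> mcar M" for x
    using that unfolding mcar_range by (rule rangeE) (rule exI)
  show ?thesis
    using assms(4)
  proof (cases rule: tensor_rels_cases)
    case (add u x y v)
    obtain u' v' f g where *: "u = map \<kappa> u'" "v = map \<kappa> v'" "x = \<kappa> f" "y = \<kappa> g"
      using list_lift[OF word(1)[OF add(2)]] list_lift[OF word(2)[OF add(2)]]
        mcar[OF word(3)[OF add(2)]] mcar[OF add(3)] by metis
    with add(2) have n: "length u' + length v' + 1 = n" by (auto simp: mwords_def)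
    show ?thesis
      using fl_add[OF lin[OF n], of f g] by (simp add: add(1) * madd_pres fl_diff[OF L])
  next
    case (scale u c x v)
    obtain u' v' f where *: "u = map \<kappa> u'" "v = map \<kappa> v'" "x = \<kappa> f"
      using list_lift[OF word(1)[OF scale(2)]] list_lift[OF word(2)[OF scale(2)]]
        mcar[OF word(3)[OF scale(2)]] by metis
    with scale(2) have n: "length u' + length v' + 1 = n" by (auto simp: mwords_def)
    show ?thesis
      using fl_scale[OF lin[OF n], of c f]
      by (simp add: scale(1) * mscale_pres fl_diff[OF L] fl_scale[OF L])
  next
    case (balance u x z y v)
    have m: "u @ [x] @ y # v \<in> mwords M n" "(u @ [x]) @ [y] @ v \<in> mwords M n"
      using balance(2) by simp_all
    have "set v \<subseteq> mcar M" using balance(2) by (simp add: mwords_def)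
    then obtain u' v' f g p where *: "u = map \<kappa> u'" "v = map \<kappa> v'" "x = \<kappa> f" "y = \<kappa> g" "z = \<iota> p"
      using list_lift[OF word(1)[OF m(1)]] list_lift[of v] mcar[OF word(3)[OF m(1)]]
        mcar[OF word(3)[OF m(2)]] balance(3) unfolding R_range by (metis imageE)
    with balance(2) have n: "length u' + length v' + 2 = n" by (auto simp: mwords_def)
    show ?thesis
      using assms(3)[OF n, of p f g]
      by (simp add: balance(1) * mright_pres mleft_pres fl_diff[OF L])
  qed
qed

end

text \<open>A commutative algebra given as the image of a ring \<open>'m \<Rightarrow>\<^sub>0 'k\<close>, whose elements, unlike those
  of \<open>C\<close>, form a type.\<close>

locale presented_algebra =
  fixes C :: "('k::field, 'c) module" (structure)
    and q :: "('m::comm_monoid_add \<Rightarrow>\<^sub>0 'k) \<Rightarrow> 'c"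
  assumes alg: "algebra field_ring C"
    and carrier_q: "carrier C = range q"
    and q_add: "q p \<oplus> q r = q (p + r)"
    and q_mult: "q p \<otimes> q r = q (p * r)"
    and q_one: "\<one> = q 1"
    and q_zero: "\<zero> = q 0"
    and q_smult: "c \<odot> q p = q (fscale c p)"
begin

lemma q_closed [simp]: "q p \<in> carrier C"
  by (simp add: carrier_q)

lemma q_sum: "finite S \<Longrightarrow> (\<Oplus>i\<in>S. q (h i)) = q (\<Sum>i\<in>S. h i)"
proof (induction S rule: finite_induct)
  interpret algebra field_ring C by (rule alg)
  {
    case empty
    show ?case by (simp add: q_zero)
  next
    case (insert x F)
    then show ?case by (simp add: q_add Pi_def)
  }
qed

definition qker :: "('m \<Rightarrow>\<^sub>0 'k) set" where
  "qker = {p. q p = q 0}"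

lemma is_span_qker: "is_span qker"
proof -
  have "fvs.subspace qker"
  proof (rule fvs.subspaceI)
    fix x y c assume x: "x \<in> qker"
    then show "fscale c x \<in> qker"
      using q_smult[of c x] q_smult[of c 0] by (simp add: qker_def)
    assume "y \<in> qker"
    with x show "x + y \<in> qker" using q_add[of x y] q_add[of 0 0] by (simp add: qker_def)
  qed (simp add: qker_def)
  then show ?thesis by (simp add: is_span_def fspan_def fvs.span_eq_iff)
qed

lemma q_eq_iff: "q p = q r \<longleftrightarrow> prj qker p = prj qker r"
proof -
  have "q p = q r \<longleftrightarrow> p - r \<in> qker"
    using q_add[of "p - r" r] q_add[of p "- r"] q_add[of r "- r"] q_add[of 0 r]
    by (auto simp: qker_def)
  also have "\<dots> \<longleftrightarrow> prj qker p = prj qker r"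
    by (simp flip: prj_eq_0_is_span[OF is_span_qker] add: prj_diff)
  finally show ?thesis .
qed

lemma q_cong_add: "q p = q p' \<Longrightarrow> q r = q r' \<Longrightarrow> q (p + r) = q (p' + r')"
  by (simp flip: q_add)

lemma q_cong_mult: "q p = q p' \<Longrightarrow> q r = q r' \<Longrightarrow> q (p * r) = q (p' * r')"
  by (simp flip: q_mult)

lemma q_cong_sum: "(\<And>i. i \<in> S \<Longrightarrow> q (h i) = q (h' i)) \<Longrightarrow> q (\<Sum>i\<in>S. h i) = q (\<Sum>i\<in>S. h' i)"
  by (simp add: q_eq_iff prj_sum)

lemma q_cong_lext: "(\<And>x. q (h x) = q (h' x)) \<Longrightarrow> q (lext h f) = q (lext h' f)"
  by (simp add: q_eq_iff prj_lext)

subsection \<open>One-forms\<close>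

text \<open>A formal sum of pairs \<open>(p, r)\<close> of elements of \<open>'m \<Rightarrow>\<^sub>0 'k\<close> stands for the one-form \<open>\<Sum> p dr\<close>.
  The latter is \<open>form_cls f\<close>; two sums represent the same one-form iff their \<open>form_val\<close> agree.\<close>

type_synonym (in -) ('m, 'k) form = "('m \<Rightarrow>\<^sub>0 'k) \<times> ('m \<Rightarrow>\<^sub>0 'k) \<Rightarrow>\<^sub>0 'k"

definition form_lift :: "('m, 'k) form \<Rightarrow> ('c \<times> 'c \<Rightarrow>\<^sub>0 'k)" where
  "form_lift = lext (\<lambda>(p, r). gen (q p, q r))"

definition form_cls :: "('m, 'k) form \<Rightarrow> ('c \<times> 'c \<Rightarrow>\<^sub>0 'k) set" where
  "form_cls f = cls (kaehler_sub C) (form_lift f)"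

definition form_val :: "('m, 'k) form \<Rightarrow> ('c \<times> 'c \<Rightarrow>\<^sub>0 'k)" where
  "form_val f = prj (kaehler_sub C) (form_lift f)"

definition act :: "('m \<Rightarrow>\<^sub>0 'k) \<Rightarrow> ('m, 'k) form \<Rightarrow> ('m, 'k) form" where
  "act z = lext (\<lambda>(p, r). gen (z * p, r))"

lemma is_span_kaehler: "is_span (kaehler_sub C)"
  by (simp add: kaehler_sub_def is_span_fspan)

lemma form_cls_eq_iff: "form_cls f = form_cls g \<longleftrightarrow> form_val f = form_val g"
  by (simp add: form_cls_def form_val_def cls_eq_iff is_span_kaehler)

lemma flinear_form_lift: "flinear form_lift"
  by (simp add: form_lift_def flinear_lext)

lemma flinear_form_val: "flinear form_val"
  unfolding form_val_def using flinear_compose[OF flinear_form_lift flinear_prj] .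

lemma flinear_act: "flinear (act z)"
  by (simp add: act_def flinear_lext)

lemmas form_val_add = fl_add[OF flinear_form_val] and form_val_scale = fl_scale[OF flinear_form_val]
  and form_val_diff = fl_diff[OF flinear_form_val] and form_val_zero = fl_zero[OF flinear_form_val]
  and form_val_sum = fl_sum[OF flinear_form_val]

lemmas act_diff = fl_diff[OF flinear_act] and act_sum = fl_sum[OF flinear_act]

lemma act_gen [simp]: "act z (gen (p, r)) = gen (z * p, r)"
  by (simp add: act_def)

lemma act_act: "act z (act y f) = act (z * y) f"
  by (rule flinear_ext) (auto simp: flinear_compose[OF flinear_act flinear_act] flinear_act mult.assoc)

lemma act_one [simp]: "act 1 f = f"
  by (rule flinear_ext[OF flinear_act flinear_id]) auto

lemma kaehler_rels:
  "form_val (gen (p + p', r)) = form_val (gen (p, r)) + form_val (gen (p', r))"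
  "form_val (gen (p, r + r')) = form_val (gen (p, r)) + form_val (gen (p, r'))"
  "form_val (gen (fscale c p, r)) = fscale c (form_val (gen (p, r)))"
  "form_val (gen (p, fscale c r)) = fscale c (form_val (gen (p, r)))"
  "form_val (gen (p, r * t)) = form_val (gen (p * r, t)) + form_val (gen (p * t, r))"
proof -
  let ?R = "{gen (x \<oplus> x', y) - gen (x, y) - gen (x', y) | x x' y. {x, x', y} \<subseteq> carrier C} \<union>
     {gen (x, y \<oplus> y') - gen (x, y) - gen (x, y') | x y y'. {x, y, y'} \<subseteq> carrier C} \<union>
     {gen (c \<odot> x, y) - fscale c (gen (x, y)) | c x y. {x, y} \<subseteq> carrier C} \<union>
     {gen (x, c \<odot> y) - fscale c (gen (x, y)) | c x y. {x, y} \<subseteq> carrier C} \<union>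
     {gen (x, y \<otimes> z) - gen (x \<otimes> y, z) - gen (x \<otimes> z, y) | x y z. {x, y, z} \<subseteq> carrier C}"
  have rel: "prj (kaehler_sub C) r = 0" if "r \<in> ?R" for r
    unfolding prj_eq_0_is_span[OF is_span_kaehler] unfolding kaehler_sub_def
    by (rule fspan_simps(5)[OF that])
  have "gen (q p \<oplus> q p', q r) - gen (q p, q r) - gen (q p', q r) \<in> ?R"
    by (rule UnI1, rule UnI1, rule UnI1, rule UnI1, rule CollectI, (rule exI)+, rule conjI, rule refl, simp)
  from rel[OF this] show "form_val (gen (p + p', r)) = form_val (gen (p, r)) + form_val (gen (p', r))"
    by (simp add: form_val_def form_lift_def q_add prj_diff prj_add algebra_simps)
  have "gen (q p, q r \<oplus> q r') - gen (q p, q r) - gen (q p, q r') \<in> ?R"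
    by (rule UnI1, rule UnI1, rule UnI1, rule UnI2, rule CollectI, (rule exI)+, rule conjI, rule refl, simp)
  from rel[OF this] show "form_val (gen (p, r + r')) = form_val (gen (p, r)) + form_val (gen (p, r'))"
    by (simp add: form_val_def form_lift_def q_add prj_diff prj_add algebra_simps)
  have "gen (c \<odot> q p, q r) - fscale c (gen (q p, q r)) \<in> ?R"
    by (rule UnI1, rule UnI1, rule UnI2, rule CollectI, (rule exI)+, rule conjI, rule refl, simp)
  from rel[OF this] show "form_val (gen (fscale c p, r)) = fscale c (form_val (gen (p, r)))"
    by (simp add: form_val_def form_lift_def q_smult prj_diff prj_scale)
  have "gen (q p, c \<odot> q r) - fscale c (gen (q p, q r)) \<in> ?R"
    by (rule UnI1, rule UnI2, rule CollectI, (rule exI)+, rule conjI, rule refl, simp)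
  from rel[OF this] show "form_val (gen (p, fscale c r)) = fscale c (form_val (gen (p, r)))"
    by (simp add: form_val_def form_lift_def q_smult prj_diff prj_scale)
  have "gen (q p, q r \<otimes> q t) - gen (q p \<otimes> q r, q t) - gen (q p \<otimes> q t, q r) \<in> ?R"
    by (rule UnI2, rule CollectI, (rule exI)+, rule conjI, rule refl, simp)
  from rel[OF this] show "form_val (gen (p, r * t)) = form_val (gen (p * r, t)) + form_val (gen (p * t, r))"
    by (simp add: form_val_def form_lift_def q_mult prj_diff prj_add algebra_simps)
qed

lemma form_val_gen_cong: "q p = q p' \<Longrightarrow> q r = q r' \<Longrightarrow> form_val (gen (p, r)) = form_val (gen (p', r'))"
  by (simp add: form_val_def form_lift_def)

lemma flinear_form_val_gen: "flinear (\<lambda>p. form_val (gen (p, r)))" "flinear (\<lambda>r. form_val (gen (p, r)))"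
  by (intro flinearI; simp add: kaehler_rels)+

text \<open>The universal property of Kaehler differentials in the form used below: every element of
  the carrier is some \<open>q p\<close>, so a bilinear assignment obeying the Leibniz rule kills
  all relations and does not see the choice made by \<open>rep\<close>.\<close>

lemma linear_rep_form_cls:
  fixes L :: "('c \<times> 'c \<Rightarrow>\<^sub>0 'k) \<Rightarrow> ('y \<Rightarrow>\<^sub>0 'k)"
  defines "M \<equiv> \<lambda>p r. L (gen (q p, q r))"
  assumes L: "flinear L"
    and add: "\<And>p p' r. M (p + p') r = M p r + M p' r" "\<And>p r r'. M p (r + r') = M p r + M p r'"
    and scale: "\<And>c p r. M (fscale c p) r = fscale c (M p r)"
      "\<And>c p r. M p (fscale c r) = fscale c (M p r)"
    and leibniz: "\<And>p r t. M p (r * t) = M (p * r) t + M (p * t) r"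
  shows "L (rep (form_cls f)) = lext (\<lambda>(p, r). L (gen (q p, q r))) f"
proof -
  have "L r = 0" if "r \<in> kaehler_sub C" for r
    using that unfolding kaehler_sub_def
  proof (rule fspan_kernel[OF L, rotated])
    fix r
    assume "r \<in> {gen (x \<oplus> x', y) - gen (x, y) - gen (x', y) | x x' y. {x, x', y} \<subseteq> carrier C} \<union>
     {gen (x, y \<oplus> y') - gen (x, y) - gen (x, y') | x y y'. {x, y, y'} \<subseteq> carrier C} \<union>
     {gen (c \<odot> x, y) - fscale c (gen (x, y)) | c x y. {x, y} \<subseteq> carrier C} \<union>
     {gen (x, c \<odot> y) - fscale c (gen (x, y)) | c x y. {x, y} \<subseteq> carrier C} \<union>
     {gen (x, y \<otimes> z) - gen (x \<otimes> y, z) - gen (x \<otimes> z, y) | x y z. {x, y, z} \<subseteq> carrier C}"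
    then show "L r = 0"
      by (elim UnE; simp only: carrier_q mem_Collect_eq)
        (auto simp: q_add q_smult q_mult fl_diff[OF L] fl_scale[OF L]
          add[unfolded M_def] scale[unfolded M_def] leibniz[unfolded M_def])
  qed
  then have "L (rep (form_cls f)) = L (form_lift f)"
    unfolding form_cls_def by (intro linear_rep_cls[OF is_span_kaehler L])
  also have "\<dots> = lext (\<lambda>(p, r). L (gen (q p, q r))) f"
    unfolding form_lift_def flinear_lext_comp[OF L] by (intro lext_cong) auto
  finally show ?thesis .
qed

lemma mcar_Kaehler: "mcar (Kaehler C) = range form_cls"
proof -
  have "\<exists>f'. f = form_lift f'" if "Poly_Mapping.keys f \<subseteq> carrier C \<times> carrier C" for f
  proof
    let ?l = "inv_into UNIV q"
    have "form_lift (lext (\<lambda>(x, y). gen (?l x, ?l y)) f) = lext gen f"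
      unfolding form_lift_def lext_lext
      by (rule lext_cong) (use that in \<open>auto simp: carrier_q f_inv_into_f\<close>)
    then show "f = form_lift (lext (\<lambda>(x, y). gen (?l x, ?l y)) f)" by simp
  qed
  moreover have "Poly_Mapping.keys (form_lift f) \<subseteq> carrier C \<times> carrier C" for f
    unfolding form_lift_def by (rule keys_lext) auto
  ultimately show ?thesis by (fastforce simp: Kaehler_def qspace_def form_cls_def)
qed

lemma form_cls_mem [simp]: "form_cls f \<in> mcar (Kaehler C)"
  by (simp add: mcar_Kaehler)

lemma madd_form_cls: "madd (Kaehler C) (form_cls f) (form_cls g) = form_cls (f + g)"
  using is_span_kaehler
  by (simp add: Kaehler_def form_cls_def cls_eq_iff prj_add fl_add[OF flinear_form_lift])

lemma mscale_form_cls: "mscale (Kaehler C) c (form_cls f) = form_cls (fscale c f)"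
  using is_span_kaehler
  by (simp add: Kaehler_def form_cls_def cls_eq_iff prj_scale fl_scale[OF flinear_form_lift])

lemma mleft_form_cls: "mleft (Kaehler C) (q z) (form_cls f) = form_cls (act z f)"
proof -
  let ?L = "\<lambda>f. prj (kaehler_sub C) (lext (\<lambda>(x, y). gen (q z \<otimes> x, y)) f)"
  have gen: "?L (gen (q p, q r)) = form_val (gen (z * p, r))" for p r
    by (simp add: q_mult form_val_def form_lift_def)
  have "?L (rep (form_cls f)) = lext (\<lambda>(p, r). ?L (gen (q p, q r))) f"
    by (rule linear_rep_form_cls)
      (simp_all only: gen flinear_compose[OF flinear_lext flinear_prj] kaehler_rels distrib_left
        fscale_mult mult.assoc)
  also have "\<dots> = form_val (act z f)"
    unfolding gen
    by (rule flinear_ext[OF flinear_lext flinear_compose[OF flinear_act flinear_form_val]]) auto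
  finally show ?thesis
    using is_span_kaehler by (simp add: Kaehler_def form_cls_def form_val_def cls_eq_iff)
qed

lemma mright_form_cls: "mright (Kaehler C) (form_cls f) (q z) = form_cls (act z f)"
  unfolding mleft_form_cls[symmetric] by (simp add: Kaehler_def)

text \<open>Both sides represent the product of the same class with the same element of
  \<open>C\<close>, so \<open>mleft_form_cls\<close> already contains the well-definedness.\<close>

lemma act_cong: "form_val f = form_val g \<Longrightarrow> q z = q y \<Longrightarrow> form_val (act z f) = form_val (act y g)"
  using mleft_form_cls[of z f] mleft_form_cls[of y g] by (simp flip: form_cls_eq_iff)

lemma act_add_left: "form_val (act (z + y) f) = form_val (act z f) + form_val (act y f)"
  by (rule flinear_ext[OF flinear_compose[OF flinear_act flinear_form_val]
        flinear_plus[OF flinear_compose[OF flinear_act flinear_form_val]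
          flinear_compose[OF flinear_act flinear_form_val]]])
    (auto simp: distrib_right kaehler_rels)

lemma act_scale_left: "form_val (act (fscale c z) f) = fscale c (form_val (act z f))"
  by (rule flinear_ext[OF flinear_compose[OF flinear_act flinear_form_val]
        flinear_fscale[OF flinear_compose[OF flinear_act flinear_form_val]]])
    (auto simp: fscale_mult kaehler_rels)

lemma flinear_act_left: "flinear (\<lambda>z. form_val (act z f))"
  by (intro flinearI act_add_left act_scale_left)

lemma comm_d0_q: "comm_d0 C (q p) = form_cls (gen (1, p))"
  by (simp add: comm_d0_def form_cls_def form_lift_def q_one)

lemma form_val_d_add: "form_val (gen (1, p + r)) = form_val (gen (1, p) + gen (1, r))"
  and form_val_d_scale: "form_val (gen (1, fscale c p)) = form_val (fscale c (gen (1, p)))"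
  and form_val_d_mult: "form_val (gen (1, p * r)) = form_val (act p (gen (1, r)) + act r (gen (1, p)))"
  by (simp_all add: kaehler_rels form_val_add form_val_scale)

lemma form_val_d_one: "form_val (gen (p, 1)) = 0"
  using kaehler_rels(5)[of p 1 1] by simp

subsection \<open>Exterior powers\<close>

text \<open>The value of a product of one-forms as an element of a vector space instead of a coset,
  so that sums and signs make sense.\<close>

definition wedge :: "('m, 'k) form list \<Rightarrow> (('c \<times> 'c \<Rightarrow>\<^sub>0 'k) set list \<Rightarrow>\<^sub>0 'k)" where
  "wedge w = prj (ext_sub C (length w)) (gen (map form_cls w))"

lemma is_span_ext: "is_span (ext_sub C n)"
  by (simp add: ext_sub_def is_span_fspan)

lemma map_form_cls_mwords [simp]: "map form_cls w \<in> mwords (Kaehler C) n \<longleftrightarrow> length w = n"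
  by (auto simp: mwords_def)

lemma ext_rel:
  assumes "r \<in> tensor_rels (carrier C) (Kaehler C) n \<union>
     {gen w | w. w \<in> mwords (Kaehler C) n \<and> \<not> distinct w}"
  shows "prj (ext_sub C n) r = 0"
  unfolding prj_eq_0_is_span[OF is_span_ext] unfolding ext_sub_def
  by (rule fspan_simps(5)[OF assms])

lemma wedge_cong: "map form_val w = map form_val w' \<Longrightarrow> wedge w = wedge w'"
proof -
  assume a: "map form_val w = map form_val w'"
  then have "map form_cls w = map form_cls w'"
    by (auto simp: list_eq_iff_nth_eq form_cls_eq_iff)
  with a show ?thesis by (metis wedge_def length_map)
qed

sublocale kaehler: presented_bimodule "carrier C" "Kaehler C" q form_cls act act
  by unfold_locales (simp_all add: carrier_q mcar_Kaehler madd_form_cls mscale_form_cls mleft_form_cls mright_form_cls)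

lemma flinear_wedge: "flinear (\<lambda>f. wedge (u @ [f] @ v))"
  using kaehler.flinear_word[OF flinear_prj ext_rel[OF UnI1], where u = u and v = v] by (simp add: wedge_def)

lemma wedge_act: "wedge (u @ [act z f, g] @ v) = wedge (u @ [f, act z g] @ v)"
  using kaehler.word_balance[OF flinear_prj ext_rel[OF UnI1], where u = u and v = v] by (simp add: wedge_def)

lemma wedge_not_distinct: "\<not> distinct w \<Longrightarrow> wedge w = 0"
proof -
  assume "\<not> distinct w"
  then have "\<not> distinct (map form_cls w)" by (simp add: distinct_map)
  then show ?thesis unfolding wedge_def by (intro ext_rel UnI2) (use map_form_cls_mwords in blast)
qed

lemma ext_sub_kernel:
  assumes L: "flinear L"
    and lin: "\<And>u v. length u + length v + 1 = n \<Longrightarrow> flinear (\<lambda>f. L (gen (map form_cls (u @ [f] @ v))))"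
    and act: "\<And>u v z f g. length u + length v + 2 = n \<Longrightarrow>
        L (gen (map form_cls (u @ [act z f, g] @ v))) = L (gen (map form_cls (u @ [f, act z g] @ v)))"
    and alt: "\<And>w. length w = n \<Longrightarrow> \<not> distinct w \<Longrightarrow> L (gen (map form_cls w)) = 0"
    and r: "r \<in> ext_sub C n"
  shows "L r = 0"
  using r unfolding ext_sub_def
proof (rule fspan_kernel[OF L, rotated])
  have alt': "L (gen w) = 0" if w: "w \<in> mwords (Kaehler C) n" "\<not> distinct w" for w
    using kaehler.word_lift[OF w(1)] w alt by blast
  fix r
  assume "r \<in> tensor_rels (carrier C) (Kaehler C) n \<union>
     {gen w | w. w \<in> mwords (Kaehler C) n \<and> \<not> distinct w}"
  then show "L r = 0" using kaehler.tensor_rels_kernel[OF L lin act] alt' by blast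
qed

lemmas flinear_wedge2 = flinear_wedge[of "[]" "[g]" for g, simplified]
    flinear_wedge[of "[f]" "[]" for f, simplified]
  and flinear_wedge3 = flinear_wedge[of "[]" "[g, h]" for g h, simplified]
    flinear_wedge[of "[f]" "[h]" for f h, simplified]
    flinear_wedge[of "[f, g]" "[]" for f g, simplified]
  and wedge2_act = wedge_act[of "[]" z f g "[]" for z f g, simplified]
  and wedge3_act = wedge_act[of "[]" z f g "[h]" for z f g h, simplified]
    wedge_act[of "[f]" z g h "[]" for z f g h, simplified]

text \<open>Only words with a repeated letter are declared zero; the sign rule follows by polarising
  (f + g) \<and> (f + g) = 0.\<close>

lemma wedge2_swap: "wedge [f, g] = - wedge [g, f]"
  using wedge_not_distinct[of "[f + g, f + g]"] wedge_not_distinct[of "[f, f]"] wedge_not_distinct[of "[g, g]"]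
    flinear_wedge2[THEN fl_add] by (simp add: eq_neg_iff_add_eq_0 add.commute)

lemma wedge3_swap: "wedge [f, g, h] = - wedge [g, f, h]" "wedge [f, g, h] = - wedge [f, h, g]"
  using wedge_not_distinct[of "[f + g, f + g, h]"] wedge_not_distinct[of "[f, f, h]"]
    wedge_not_distinct[of "[g, g, h]"] wedge_not_distinct[of "[f, g + h, g + h]"]
    wedge_not_distinct[of "[f, h, h]"] wedge_not_distinct[of "[f, g, g]"]
    flinear_wedge3[THEN fl_add] by (simp_all add: eq_neg_iff_add_eq_0 add.commute)

text \<open>A three-cycle is a product of two transpositions. This is why traces of three one-forms
  are invariant under rotation without a sign.\<close>

lemma wedge3_rotate: "wedge [f, g, h] = wedge [g, h, f]"
  using wedge3_swap(1)[of f g h] wedge3_swap(2)[of g f h] by simp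

end

context presented_algebra
begin

subsection \<open>The de Rham differential of a two-form\<close>

definition form2 :: "(('m, 'k) form \<times> ('m, 'k) form \<Rightarrow>\<^sub>0 'k) \<Rightarrow> (('c \<times> 'c \<Rightarrow>\<^sub>0 'k) set list \<Rightarrow>\<^sub>0 'k)" where
  "form2 = lext (\<lambda>(f, g). gen [form_cls f, form_cls g])"

lemma form2_closed: "cls (ext_sub C 2) (form2 G) \<in> comm_Omega C 2"
proof -
  have "Poly_Mapping.keys (form2 G) \<subseteq> mwords (Kaehler C) 2"
    unfolding form2_def by (rule keys_lext) (auto simp: mwords_def)
  then show ?thesis by (auto simp: comm_Omega_def qspace_def)
qed

lemma ext_sub2_kernel:
  fixes L :: "(('c \<times> 'c \<Rightarrow>\<^sub>0 'k) set list \<Rightarrow>\<^sub>0 'k) \<Rightarrow> ('y \<Rightarrow>\<^sub>0 'k)"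
  assumes L: "flinear L" and M: "\<And>f g. L (gen [form_cls f, form_cls g]) = M f g"
    and lin: "\<And>g. flinear (\<lambda>f. M f g)" "\<And>f. flinear (M f)"
    and act: "\<And>z f g. M (act z f) g = M f (act z g)" and alt: "\<And>f. M f f = 0"
    and r: "r \<in> ext_sub C 2"
  shows "L r = 0"
proof (rule ext_sub_kernel[OF L _ _ _ r])
  fix u v :: "('m, 'k) form list" assume "length u + length v + 1 = 2"
  then consider g where "u = []" "v = [g]" | f where "u = [f]" "v = []"
    by (cases u; cases v) auto
  then show "flinear (\<lambda>f. L (gen (map form_cls (u @ [f] @ v))))"
    by cases (simp_all add: M lin)
next
  fix u v :: "('m, 'k) form list" and z f g assume "length u + length v + 2 = 2"
  then show "L (gen (map form_cls (u @ [act z f, g] @ v))) = L (gen (map form_cls (u @ [f, act z g] @ v)))"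
    by (simp add: M act)
next
  fix w :: "('m, 'k) form list" assume "length w = 2" "\<not> distinct w"
  then obtain f where "w = [f, f]" by (auto simp: numeral_2_eq_2 length_Suc_conv)
  then show "L (gen (map form_cls w)) = 0" by (simp add: M alt)
qed

lemma linear_rep_form2:
  fixes L :: "(('c \<times> 'c \<Rightarrow>\<^sub>0 'k) set list \<Rightarrow>\<^sub>0 'k) \<Rightarrow> ('y \<Rightarrow>\<^sub>0 'k)"
  assumes L: "flinear L" and M: "\<And>f g. L (gen [form_cls f, form_cls g]) = M f g"
    and lin: "\<And>g. flinear (\<lambda>f. M f g)" "\<And>f. flinear (M f)"
    and act: "\<And>z f g. M (act z f) g = M f (act z g)" and alt: "\<And>f. M f f = 0"
  shows "L (rep (cls (ext_sub C 2) (form2 G))) = lext (\<lambda>(f, g). M f g) G"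
proof -
  have "L (rep (cls (ext_sub C 2) (form2 G))) = L (form2 G)"
    using ext_sub2_kernel[OF L M lin act alt] by (intro linear_rep_cls[OF is_span_ext L])
  also have "\<dots> = lext (\<lambda>(f, g). M f g) G"
    unfolding form2_def flinear_lext_comp[OF L] by (intro lext_cong) (auto simp: M)
  finally show ?thesis .
qed

abbreviation dform :: "('m \<Rightarrow>\<^sub>0 'k) \<Rightarrow> ('m, 'k) form" where
  "dform p \<equiv> gen (1, p)"

text \<open>df \<and> g for the one-form f = \<Sum> p dr, whose differential is \<Sum> dp \<and> dr.
  Independence of the presentation of f is shown inside \<open>prj_d_word\<close>.\<close>

definition d_wedge :: "('m, 'k) form \<Rightarrow> ('m, 'k) form \<Rightarrow> (('c \<times> 'c \<Rightarrow>\<^sub>0 'k) set list \<Rightarrow>\<^sub>0 'k)" where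
  "d_wedge f g = lext (\<lambda>(p, r). wedge [dform p, dform r, g]) f"

lemma flinear_d_wedge: "flinear (\<lambda>f. d_wedge f g)" "flinear (d_wedge f)"
  unfolding d_wedge_def by (rule flinear_lext, rule flinear_lext_param) (auto simp: flinear_wedge3)

lemma wedge_dform_rels:
  "wedge [dform (p + p'), f, g] = wedge [dform p, f, g] + wedge [dform p', f, g]"
  "wedge [f, dform (p + p'), g] = wedge [f, dform p, g] + wedge [f, dform p', g]"
  "wedge [dform (fscale c p), f, g] = fscale c (wedge [dform p, f, g])"
  "wedge [f, dform (fscale c p), g] = fscale c (wedge [f, dform p, g])"
  "wedge [dform (p * r), f, g] = wedge [dform r, f, act p g] + wedge [dform p, f, act r g]"
  "wedge [f, dform (p * r), g] = wedge [f, dform r, act p g] + wedge [f, dform p, act r g]"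
proof -
  note lin = flinear_wedge3[THEN fl_add] flinear_wedge3[THEN fl_scale]
  note c = wedge_cong[of "[_, f, g]" "[_, f, g]"] wedge_cong[of "[f, _, g]" "[f, _, g]"]
  show "wedge [dform (p + p'), f, g] = wedge [dform p, f, g] + wedge [dform p', f, g]"
    by (subst lin(1)[symmetric], rule c) (simp add: form_val_d_add)
  show "wedge [f, dform (p + p'), g] = wedge [f, dform p, g] + wedge [f, dform p', g]"
    by (subst lin(2)[symmetric], rule c) (simp add: form_val_d_add)
  show "wedge [dform (fscale c p), f, g] = fscale c (wedge [dform p, f, g])"
    by (subst lin(4)[symmetric], rule c) (simp add: form_val_d_scale)
  show "wedge [f, dform (fscale c p), g] = fscale c (wedge [f, dform p, g])"
    by (subst lin(5)[symmetric], rule c) (simp add: form_val_d_scale)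
  have "wedge [dform (p * r), f, g] = wedge [act p (dform r) + act r (dform p), f, g]"
    by (rule c) (simp only: form_val_d_mult list.map)
  also have "\<dots> = wedge [dform r, f, act p g] + wedge [dform p, f, act r g]"
    by (simp only: lin wedge3_act)
  finally show "wedge [dform (p * r), f, g] = wedge [dform r, f, act p g] + wedge [dform p, f, act r g]" .
  have "wedge [f, dform (p * r), g] = wedge [f, act p (dform r) + act r (dform p), g]"
    by (rule c) (simp only: form_val_d_mult list.map)
  also have "\<dots> = wedge [f, dform r, act p g] + wedge [f, dform p, act r g]"
    by (simp only: lin wedge3_act)
  finally show "wedge [f, dform (p * r), g] = wedge [f, dform r, act p g] + wedge [f, dform p, act r g]" .
qed

text \<open>The Leibniz rule d(z f) = z df + dz \<and> f, with the factor z passed on to g.\<close>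

lemma d_wedge_act: "d_wedge (act z f) g = d_wedge f (act z g) + wedge [dform z, f, g]"
proof (rule flinear_ext[of "\<lambda>f. d_wedge (act z f) g" "\<lambda>f. d_wedge f (act z g) + wedge [dform z, f, g]"])
  show "flinear (\<lambda>f. d_wedge (act z f) g)"
    by (rule flinear_compose[OF flinear_act flinear_d_wedge(1)])
  show "flinear (\<lambda>f. d_wedge f (act z g) + wedge [dform z, f, g])"
    by (rule flinear_plus[OF flinear_d_wedge(1) flinear_wedge3(2)])
  fix x :: "('m \<Rightarrow>\<^sub>0 'k) \<times> ('m \<Rightarrow>\<^sub>0 'k)"
  obtain p r where x: "x = (p, r)" by (cases x)
  have "wedge [dform z, dform r, act p g] = wedge [dform z, gen (p, r), g]"
    unfolding wedge3_act(2)[symmetric] by simp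
  then show "d_wedge (act z (gen x)) g = d_wedge (gen x) (act z g) + wedge [dform z, gen x, g]"
    by (simp add: d_wedge_def wedge_dform_rels(5) x)
qed

text \<open>d(f g) = df g - f dg, and moving the one-form f past the two-form dg is a rotation of
  three factors, which costs no sign. Hence both terms have the shape
  \<open>d_wedge\<close>.\<close>

lemma prj_d_word:
  "prj (ext_sub C 3) (d_word (comm_d0 C) [form_cls f, form_cls g]) = d_wedge f g - d_wedge g f"
proof -
  have rep1: "prj (ext_sub C 3) (lext (\<lambda>(x, y). gen [comm_d0 C x, comm_d0 C y, form_cls g]) (rep (form_cls f)))
      = d_wedge f g" for f g
  proof -
    let ?L = "\<lambda>f. prj (ext_sub C 3) (lext (\<lambda>(x, y). gen [comm_d0 C x, comm_d0 C y, form_cls g]) f)"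
    have gen: "?L (gen (q p, q r)) = wedge [dform p, dform r, g]" for p r
      by (simp add: comm_d0_q wedge_def numeral_3_eq_3)
    have "?L (rep (form_cls f)) = lext (\<lambda>(p, r). ?L (gen (q p, q r))) f"
    proof (rule linear_rep_form_cls)
      show "flinear ?L" by (rule flinear_compose[OF flinear_lext flinear_prj])
      \<comment> \<open>p d(r t) and p r dt + p t dr have the same differential because p dr \<and>
        dt and p dt \<and> dr cancel.\<close>
      show "?L (gen (q p, q (r * t))) = ?L (gen (q (p * r), q t)) + ?L (gen (q (p * t), q r))" for p r t
        unfolding gen wedge_dform_rels using wedge3_swap(1)[of "dform r" "dform t"] by simp
    qed (simp_all only: gen wedge_dform_rels)
    then show ?thesis unfolding gen by (simp add: d_wedge_def)
  qed
  have rep2: "prj (ext_sub C 3) (lext (\<lambda>(x, y). gen [form_cls f, comm_d0 C x, comm_d0 C y]) (rep (form_cls g)))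
      = d_wedge g f" for f g
  proof -
    let ?L = "\<lambda>g. prj (ext_sub C 3) (lext (\<lambda>(x, y). gen [form_cls f, comm_d0 C x, comm_d0 C y]) g)"
    have gen: "?L (gen (q p, q r)) = wedge [dform p, dform r, f]" for p r
      using wedge3_rotate[of f "dform p" "dform r"] by (simp add: comm_d0_q wedge_def numeral_3_eq_3)
    have "?L (rep (form_cls g)) = lext (\<lambda>(p, r). ?L (gen (q p, q r))) g"
    proof (rule linear_rep_form_cls)
      show "flinear ?L" by (rule flinear_compose[OF flinear_lext flinear_prj])
      show "?L (gen (q p, q (r * t))) = ?L (gen (q (p * r), q t)) + ?L (gen (q (p * t), q r))" for p r t
        unfolding gen wedge_dform_rels using wedge3_swap(1)[of "dform r" "dform t"] by simp
    qed (simp_all only: gen wedge_dform_rels)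
    then show ?thesis unfolding gen by (simp add: d_wedge_def)
  qed
  show ?thesis
    by (simp add: d_word_def numeral_2_eq_2 lext_fscale_fun prj_diff prj_add prj_neg
        fvs.scale_minus_left rep1 rep2)
qed

text \<open>\<open>comm_d\<close> differentiates the representative chosen by \<open>rep\<close>.
  Since d sends the relations of the exterior square into those of the exterior cube, the known sum
  \<open>form2 G\<close> may be differentiated instead.\<close>

lemma comm_d_form2:
  "comm_d C 2 (cls (ext_sub C 2) (form2 G)) = cls (ext_sub C 3) 0 \<longleftrightarrow>
    prj (ext_sub C 3) (lext (d_word (comm_d0 C)) (form2 G)) = 0"
proof -
  let ?L = "\<lambda>f. prj (ext_sub C 3) (lext (d_word (comm_d0 C)) f)"
  have "?L (rep (cls (ext_sub C 2) (form2 G))) = lext (\<lambda>(f, g). d_wedge f g - d_wedge g f) G"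
  proof (rule linear_rep_form2)
    show "flinear ?L" by (rule flinear_compose[OF flinear_lext flinear_prj])
    show "?L (gen [form_cls f, form_cls g]) = d_wedge f g - d_wedge g f" for f g
      by (simp add: prj_d_word)
    \<comment> \<open>By \<open>d_wedge_act\<close> the two sides differ by dz \<and> f \<and> g +
      dz \<and> g \<and> f.\<close>
    show "d_wedge (act z f) g - d_wedge g (act z f) = d_wedge f (act z g) - d_wedge (act z g) f" for z f g
      using wedge3_swap(2)[of "dform z" f g] by (simp add: d_wedge_act)
  qed (auto intro!: flinear_minus flinear_d_wedge)
  moreover have "?L (form2 G) = lext (\<lambda>(f, g). d_wedge f g - d_wedge g f) G"
    unfolding form2_def lext_lext prj_lext by (intro lext_cong) (auto simp: prj_d_word)
  ultimately have "?L (rep (cls (ext_sub C 2) (form2 G))) = ?L (form2 G)" by simp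
  then show ?thesis
    using is_span_ext by (simp add: comm_d_def cls_eq_iff prj_zero numeral_3_eq_3 numeral_2_eq_2)
qed

subsection \<open>Contraction\<close>

text \<open>A lift of \<open>\<theta> \<circ> q\<close> along \<open>q\<close>; in general it is linear only modulo the kernel of \<open>q\<close>.\<close>

definition der_lift :: "('c \<Rightarrow> 'c) \<Rightarrow> ('m \<Rightarrow>\<^sub>0 'k) \<Rightarrow> ('m \<Rightarrow>\<^sub>0 'k)" where
  "der_lift \<theta> p = inv_into UNIV q (\<theta> (q p))"

definition pair_form :: "('c \<Rightarrow> 'c) \<Rightarrow> ('m, 'k) form \<Rightarrow> ('m \<Rightarrow>\<^sub>0 'k)" where
  "pair_form \<theta> = lext (\<lambda>(p, r). p * der_lift \<theta> r)"

lemma flinear_pair_form: "flinear (pair_form \<theta>)"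
  by (simp add: pair_form_def flinear_lext)

lemma pair_form_gen [simp]: "pair_form \<theta> (gen (p, r)) = p * der_lift \<theta> r"
  by (simp add: pair_form_def)

lemma pair_form_act: "pair_form \<theta> (act z f) = z * pair_form \<theta> f"
proof (rule flinear_ext[of "\<lambda>f. pair_form \<theta> (act z f)"])
  show "flinear (\<lambda>f. z * pair_form \<theta> f)"
    by (intro flinearI) (simp_all add: fl_add[OF flinear_pair_form] fl_scale[OF flinear_pair_form] distrib_left fscale_mult)
qed (auto simp: flinear_compose[OF flinear_act flinear_pair_form] mult.assoc)

lemma q_der_lift:
  assumes "\<theta> \<in> mcar (Der C)"
  shows "q (der_lift \<theta> p) = \<theta> (q p)"
proof -
  have "\<theta> (q p) \<in> range q" using assms q_closed[of p] by (auto simp: Der_def carrier_q)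
  then show ?thesis by (simp add: der_lift_def f_inv_into_f)
qed

lemma der_lift_rels:
  assumes "\<theta> \<in> mcar (Der C)"
  shows "q (der_lift \<theta> (p + r)) = q (der_lift \<theta> p + der_lift \<theta> r)"
    "q (der_lift \<theta> (fscale c p)) = q (fscale c (der_lift \<theta> p))"
    "q (der_lift \<theta> (p * r)) = q (p * der_lift \<theta> r + der_lift \<theta> p * r)"
  using assms q_closed[of p] q_closed[of r] unfolding q_der_lift[OF assms]
  by (simp_all flip: q_add q_smult q_mult add: q_der_lift[OF assms] Der_def)

text \<open>\<open>pair_der\<close> sums, inside the ring \<open>C\<close>, over the keys of an
  arbitrary representative. Pulling all factors back along \<open>q\<close> turns it into the linear
  map \<open>?L\<close> of formal sums, to which \<open>linear_rep_form_cls\<close> applies by the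
  Leibniz rule of \<theta>.\<close>

lemma pair_der_form_cls:
  assumes \<theta>: "\<theta> \<in> mcar (Der C)"
  shows "pair_der C \<theta> (form_cls f) = q (pair_form \<theta> f)"
proof -
  let ?l = "inv_into UNIV q"
  have l: "q (?l x) = x" if "x \<in> carrier C" for x
    using that by (simp add: carrier_q f_inv_into_f)
  have \<theta>c: "\<theta> x \<in> carrier C" if "x \<in> carrier C" for x
    using that \<theta> by (auto simp: Der_def)
  let ?M = "lext (\<lambda>(x, y). ?l x * ?l (\<theta> y))"
  let ?L = "\<lambda>f. prj qker (?M f)"
  \<comment> \<open>Preimages under \<open>q\<close> exist only for elements of the carrier, so
    every key has to lie there.\<close>
  have keys: "Poly_Mapping.keys (rep (form_cls f)) \<subseteq> carrier C \<times> carrier C"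
    unfolding form_cls_def kaehler_sub_def
  proof (rule keys_rep_cls)
    interpret algebra field_ring C by (rule alg)
    have sm: "c \<odot> x \<in> carrier C" if "x \<in> carrier C" for c x
      using that by (auto simp: carrier_q q_smult)
    fix r
    assume "r \<in> {gen (x \<oplus> x', y) - gen (x, y) - gen (x', y) | x x' y. {x, x', y} \<subseteq> carrier C} \<union>
     {gen (x, y \<oplus> y') - gen (x, y) - gen (x, y') | x y y'. {x, y, y'} \<subseteq> carrier C} \<union>
     {gen (c \<odot> x, y) - fscale c (gen (x, y)) | c x y. {x, y} \<subseteq> carrier C} \<union>
     {gen (x, c \<odot> y) - fscale c (gen (x, y)) | c x y. {x, y} \<subseteq> carrier C} \<union>
     {gen (x, y \<otimes> z) - gen (x \<otimes> y, z) - gen (x \<otimes> z, y) | x y z. {x, y, z} \<subseteq> carrier C}"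
    then show "Poly_Mapping.keys r \<subseteq> carrier C \<times> carrier C"
      by (elim UnE CollectE exE conjE; hypsubst)
        (auto dest!: subsetD[OF keys_diff_subset] subsetD[OF keys_fscale_subset] simp: sm)
  next
    show "Poly_Mapping.keys (form_lift f) \<subseteq> carrier C \<times> carrier C"
      unfolding form_lift_def by (rule keys_lext) auto
  qed
  have "pair_der C \<theta> (form_cls f) =
      (\<Oplus>p\<in>Poly_Mapping.keys (rep (form_cls f)). q (fscale (Poly_Mapping.lookup (rep (form_cls f)) p)
         (case p of (x, y) \<Rightarrow> ?l x * ?l (\<theta> y))))"
    unfolding pair_der_def
  proof -
    interpret algebra field_ring C by (rule alg)
    show "(\<Oplus>p\<in>Poly_Mapping.keys (rep (form_cls f)). Poly_Mapping.lookup (rep (form_cls f)) p \<odot> (fst p \<otimes> \<theta> (snd p))) =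
      (\<Oplus>p\<in>Poly_Mapping.keys (rep (form_cls f)). q (fscale (Poly_Mapping.lookup (rep (form_cls f)) p)
         (case p of (x, y) \<Rightarrow> ?l x * ?l (\<theta> y))))"
    proof (rule finsum_cong')
      fix p assume "p \<in> Poly_Mapping.keys (rep (form_cls f))"
      then show "Poly_Mapping.lookup (rep (form_cls f)) p \<odot> (fst p \<otimes> \<theta> (snd p)) =
        q (fscale (Poly_Mapping.lookup (rep (form_cls f)) p) (case p of (x, y) \<Rightarrow> ?l x * ?l (\<theta> y)))"
        using keys by (auto simp flip: q_smult q_mult simp: l \<theta>c)
    qed auto
  qed
  also have "\<dots> = q (?M (rep (form_cls f)))"
    by (simp add: q_sum lext_def)
  also have "\<dots> = q (pair_form \<theta> f)"
  proof -
    have gen: "?L (gen (q p, q r)) = prj qker (p * der_lift \<theta> r)" for p r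
      using q_cong_mult[of "?l (q p)" p "?l (\<theta> (q r))" "der_lift \<theta> r"] \<theta>c
      by (simp flip: q_eq_iff add: l q_der_lift[OF \<theta>])
    note th = der_lift_rels[OF \<theta>]
    have "?L (rep (form_cls f)) = lext (\<lambda>(p, r). ?L (gen (q p, q r))) f"
    proof (rule linear_rep_form_cls)
      show "flinear ?L" by (rule flinear_compose[OF flinear_lext flinear_prj])
      show "?L (gen (q p, q (r + t))) = ?L (gen (q p, q r)) + ?L (gen (q p, q t))" for p r t
        unfolding gen by (simp flip: prj_add q_eq_iff distrib_left) (rule q_cong_mult[OF refl th(1)])
      show "?L (gen (q p, q (fscale c r))) = fscale c (?L (gen (q p, q r)))" for p r c
        using q_cong_mult[OF refl th(2), of p c r] unfolding gen
        by (simp add: q_eq_iff fscale_mult prj_scale)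
      show "?L (gen (q p, q (r * t))) = ?L (gen (q (p * r), q t)) + ?L (gen (q (p * t), q r))" for p r t
        using q_cong_mult[OF refl th(3), of p r t] unfolding gen
        by (simp flip: prj_add q_eq_iff add: distrib_left ac_simps)
    qed (simp_all only: gen distrib_right fscale_mult prj_add prj_scale)
    then show ?thesis
      unfolding gen by (simp add: pair_form_def q_eq_iff prj_lext case_prod_unfold)
  qed
  finally show ?thesis .
qed

definition contr_form :: "('c \<Rightarrow> 'c) \<Rightarrow> (('m, 'k) form \<times> ('m, 'k) form \<Rightarrow>\<^sub>0 'k) \<Rightarrow> ('m, 'k) form" where
  "contr_form \<theta> = lext (\<lambda>(f, g). act (pair_form \<theta> f) g - act (pair_form \<theta> g) f)"

lemma contr2_form2:
  assumes \<theta>: "\<theta> \<in> mcar (Der C)"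
  shows "contr2 C (cls (ext_sub C 2) (form2 G)) \<theta> = form_cls (contr_form \<theta> G)"
proof -
  let ?c = "\<lambda>w. rep (mleft (Kaehler C) (pair_der C \<theta> (w ! 0)) (w ! 1)) -
                rep (mleft (Kaehler C) (pair_der C \<theta> (w ! 1)) (w ! 0))"
  let ?L = "\<lambda>f. prj (kaehler_sub C) (lext ?c f)"
  have rep: "prj (kaehler_sub C) (rep (form_cls f)) = form_val f" for f
    by (simp add: form_cls_def form_val_def is_span_kaehler)
  have lin: "flinear (\<lambda>f. form_val (act (pair_form \<theta> f) g))" "flinear (\<lambda>f. form_val (act z f))" for g z
    using flinear_compose[OF flinear_pair_form flinear_act_left] flinear_compose[OF flinear_act flinear_form_val] .
  have "?L (rep (cls (ext_sub C 2) (form2 G))) =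
      lext (\<lambda>(f, g). form_val (act (pair_form \<theta> f) g) - form_val (act (pair_form \<theta> g) f)) G"
  proof (rule linear_rep_form2)
    show "flinear ?L" by (rule flinear_compose[OF flinear_lext flinear_prj])
    show "?L (gen [form_cls f, form_cls g]) = form_val (act (pair_form \<theta> f) g) - form_val (act (pair_form \<theta> g) f)" for f g
      by (simp add: pair_der_form_cls[OF \<theta>] mleft_form_cls prj_diff rep)
    show "form_val (act (pair_form \<theta> (act z f)) g) - form_val (act (pair_form \<theta> g) (act z f)) =
      form_val (act (pair_form \<theta> f) (act z g)) - form_val (act (pair_form \<theta> (act z g)) f)" for z f g
      by (simp add: pair_form_act act_act mult.commute)
  qed (auto intro!: flinear_minus lin)
  also have "\<dots> = form_val (contr_form \<theta> G)"
    unfolding contr_form_def flinear_lext_comp[OF flinear_form_val] by (intro lext_cong) (auto simp: form_val_diff)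
  finally show ?thesis
    using is_span_kaehler by (simp add: contr2_def form_cls_def form_val_def cls_eq_iff)
qed

text \<open>On a pair (f, g) both sides are \<psi>(f) \<theta>(g) - \<psi>(g) \<theta>(f). This
  holds for the lifts themselves, not only modulo the kernel of \<open>q\<close>, because
  \<open>pair_form\<close> commutes exactly with multiplication.\<close>

lemma pair_form_contr_form_antisym: "pair_form \<theta> (contr_form \<psi> G) = - pair_form \<psi> (contr_form \<theta> G)"
  unfolding contr_form_def flinear_lext_comp[OF flinear_pair_form] lext_uminus_fun[symmetric]
  by (intro lext_cong) (auto simp: pair_form_act fl_diff[OF flinear_pair_form] mult.commute)

section \<open>The module of derivations, and contraction as a module map\<close>

lemma Der_memI:
  assumes "\<rho> \<in> extensional (carrier C)" "\<And>p. \<rho> (q p) = q (h p)"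
    and "\<And>p r. q (h (p + r)) = q (h p + h r)" "\<And>c p. q (h (fscale c p)) = q (fscale c (h p))"
    and "\<And>p r. q (h (p * r)) = q (p * h r + h p * r)"
  shows "\<rho> \<in> mcar (Der C)"
  using assms by (auto simp: Der_def carrier_q PiE_def q_add q_smult q_mult)

lemma pair_form_cong:
  assumes "\<theta> \<in> mcar (Der C)" "\<And>r. \<theta> (q r) = q (h r)"
  shows "q (pair_form \<theta> f) = q (lext (\<lambda>(p, r). p * h r) f)"
  unfolding pair_form_def
  by (rule q_cong_lext) (auto intro!: q_cong_mult simp: q_der_lift[OF assms(1)] assms(2))

lemma
  assumes "\<theta> \<in> mcar (Der C)" "\<phi> \<in> mcar (Der C)"
  shows Der_madd: "madd (Der C) \<theta> \<phi> \<in> mcar (Der C)"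
    and pair_form_madd: "q (pair_form (madd (Der C) \<theta> \<phi>) f) = q (pair_form \<theta> f + pair_form \<phi> f)"
proof -
  have v: "madd (Der C) \<theta> \<phi> (q p) = q (der_lift \<theta> p + der_lift \<phi> p)" for p
    using assms by (simp add: Der_def flip: q_add) (simp add: q_der_lift assms)
  show D: "madd (Der C) \<theta> \<phi> \<in> mcar (Der C)"
    by (rule Der_memI[where h = "\<lambda>p. der_lift \<theta> p + der_lift \<phi> p"])
      (simp add: Der_def, rule v, auto simp: q_eq_iff prj_add prj_scale algebra_simps
        fvs.scale_right_distrib assms[THEN der_lift_rels(1), unfolded q_eq_iff]
        assms[THEN der_lift_rels(2), unfolded q_eq_iff] assms[THEN der_lift_rels(3), unfolded q_eq_iff])
  show "q (pair_form (madd (Der C) \<theta> \<phi>) f) = q (pair_form \<theta> f + pair_form \<phi> f)"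
    unfolding pair_form_cong[OF D v] by (simp add: pair_form_def distrib_left lext_plus_fun case_prod_unfold)
qed

lemma
  assumes "\<theta> \<in> mcar (Der C)"
  shows Der_mleft: "mleft (Der C) (q z) \<theta> \<in> mcar (Der C)"
    and pair_form_mleft: "q (pair_form (mleft (Der C) (q z) \<theta>) f) = q (z * pair_form \<theta> f)"
proof -
  have v: "mleft (Der C) (q z) \<theta> (q p) = q (z * der_lift \<theta> p)" for p
    using assms by (simp add: Der_def flip: q_mult) (simp add: q_der_lift assms)
  note c = q_cong_mult[OF refl, of _ _ z]
  show D: "mleft (Der C) (q z) \<theta> \<in> mcar (Der C)"
  proof (rule Der_memI[where h = "\<lambda>p. z * der_lift \<theta> p"])
    show "q (z * der_lift \<theta> (p + r)) = q (z * der_lift \<theta> p + z * der_lift \<theta> r)" for p r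
      using c[OF der_lift_rels(1)[OF assms]] by (simp add: distrib_left)
    show "q (z * der_lift \<theta> (fscale c p)) = q (fscale c (z * der_lift \<theta> p))" for c p
      using c[OF der_lift_rels(2)[OF assms]] by (simp add: fscale_mult)
    show "q (z * der_lift \<theta> (p * r)) = q (p * (z * der_lift \<theta> r) + z * der_lift \<theta> p * r)" for p r
      using c[OF der_lift_rels(3)[OF assms]] by (simp add: distrib_left ac_simps)
  qed (simp add: Der_def, rule v)
  have "flinear (\<lambda>p. z * p)" by (intro flinearI) (simp_all add: distrib_left fscale_mult)
  note lin = flinear_lext_comp[OF this]
  show "q (pair_form (mleft (Der C) (q z) \<theta>) f) = q (z * pair_form \<theta> f)"
    unfolding pair_form_cong[OF D v] unfolding pair_form_def lin by (simp add: case_prod_unfold ac_simps)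
qed

text \<open>Scalars act through constant polynomials, so linearity over the field follows from
  linearity over \<open>C\<close>.\<close>

lemma mscale_Der: "mscale (Der C) c \<theta> = mleft (Der C) (q (Poly_Mapping.single 0 c)) \<theta>"
  if "\<theta> \<in> mcar (Der C)"
proof -
  have "c \<odot> \<theta> x = q (Poly_Mapping.single 0 c) \<otimes> \<theta> x" if "x \<in> carrier C" for x
  proof -
    have "\<theta> x \<in> range q" using that \<open>\<theta> \<in> _\<close> by (auto simp: Der_def simp flip: carrier_q)
    then show ?thesis by (auto simp: q_smult q_mult fscale_conv_mult)
  qed
  then show ?thesis by (auto simp: Der_def intro!: restrict_ext)
qed

lemma form_val_contr_form_cong:
  assumes "\<And>f. q (pair_form \<theta> f) = q (h f)"
  shows "form_val (contr_form \<theta> G) = lext (\<lambda>(f, g). form_val (act (h f) g) - form_val (act (h g) f)) G"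
  unfolding contr_form_def flinear_lext_comp[OF flinear_form_val]
  by (rule lext_cong) (auto simp: form_val_diff act_cong[OF refl assms])

lemma contr2_hom:
  defines "\<omega> G \<equiv> cls (ext_sub C 2) (form2 G)"
  shows "bimod_hom (carrier C) (Der C) (Kaehler C) (contr2 C (\<omega> G))"
proof -
  have left: "contr2 C (\<omega> G) (mleft (Der C) r \<theta>) = mleft (Kaehler C) r (contr2 C (\<omega> G) \<theta>)"
    if "r \<in> carrier C" "\<theta> \<in> mcar (Der C)" for r \<theta>
  proof -
    obtain z where r: "r = q z" using \<open>r \<in> _\<close> by (auto simp: carrier_q)
    have "form_val (contr_form (mleft (Der C) (q z) \<theta>) G) = form_val (act z (contr_form \<theta> G))"
      unfolding form_val_contr_form_cong[OF pair_form_mleft[OF that(2)]]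
      unfolding contr_form_def flinear_lext_comp[OF flinear_act] flinear_lext_comp[OF flinear_form_val]
      by (rule lext_cong) (auto simp: act_diff form_val_diff act_act)
    then show ?thesis
      unfolding \<omega>_def r by (simp add: contr2_form2 Der_mleft that mleft_form_cls form_cls_eq_iff)
  qed
  show ?thesis
    unfolding bimod_hom_def
  proof (intro conjI ballI allI Pi_I)
    fix \<theta> \<phi> c r assume \<theta>: "\<theta> \<in> mcar (Der C)"
    show "contr2 C (\<omega> G) \<theta> \<in> mcar (Kaehler C)"
      using \<theta> by (simp add: \<omega>_def contr2_form2)
    have single: "mscale (Kaehler C) c (form_cls f) = mleft (Kaehler C) (q (Poly_Mapping.single 0 c)) (form_cls f)" for f
      unfolding mscale_form_cls mleft_form_cls form_cls_eq_iff
      using act_scale_left[of c 1 f] by (simp add: fscale_conv_mult form_val_scale flip: form_val_scale)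
    show "contr2 C (\<omega> G) (mscale (Der C) c \<theta>) = mscale (Kaehler C) c (contr2 C (\<omega> G) \<theta>)"
      unfolding mscale_Der[OF \<theta>] using left[OF q_closed \<theta>] contr2_form2[OF \<theta>]
      by (simp add: single \<omega>_def)
    { assume "\<phi> \<in> mcar (Der C)"
      with \<theta> show "contr2 C (\<omega> G) (madd (Der C) \<theta> \<phi>) =
          madd (Kaehler C) (contr2 C (\<omega> G) \<theta>) (contr2 C (\<omega> G) \<phi>)"
      proof -
        have "form_val (contr_form (madd (Der C) \<theta> \<phi>) G) = form_val (contr_form \<theta> G + contr_form \<phi> G)"
          unfolding form_val_contr_form_cong[OF pair_form_madd[OF \<theta> \<open>\<phi> \<in> _\<close>]] form_val_add
          unfolding contr_form_def flinear_lext_comp[OF flinear_form_val] lext_plus_fun[symmetric]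
          by (rule lext_cong) (auto simp: form_val_diff act_add_left)
        then show ?thesis
          unfolding \<omega>_def by (simp add: contr2_form2 Der_madd \<theta> \<open>\<phi> \<in> _\<close> madd_form_cls form_cls_eq_iff)
      qed }
    assume "r \<in> carrier C"
    then show "contr2 C (\<omega> G) (mleft (Der C) r \<theta>) = mleft (Kaehler C) r (contr2 C (\<omega> G) \<theta>)"
      by (rule left[OF _ \<theta>])
    moreover have "mright (Der C) \<theta> r = mleft (Der C) r \<theta>"
      "mright (Kaehler C) X r = mleft (Kaehler C) r X" for X
      by (simp_all add: Der_def Kaehler_def)
    ultimately show "contr2 C (\<omega> G) (mright (Der C) \<theta> r) = mright (Kaehler C) (contr2 C (\<omega> G) \<theta>) r"
      by simp
  qed
qed

text \<open>If every one-form is of the form \<open>i\<^sub>\<psi>\<omega>\<close>, then \<open>i\<^sub>\<theta>\<omega>\<close> determines the values of \<open>\<theta>\<close> on all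
  one-forms, by antisymmetry. Hence no separate argument for injectivity is needed.\<close>

lemma contr2_iso:
  defines "\<omega> G \<equiv> cls (ext_sub C 2) (form2 G)"
  assumes surj: "\<And>p. \<exists>\<psi>\<in>mcar (Der C). contr2 C (\<omega> G) \<psi> = form_cls (dform p)"
  shows "bimod_iso (carrier C) (Der C) (Kaehler C) (contr2 C (\<omega> G))"
proof -
  let ?c = "contr2 C (\<omega> G)"
  note hom = contr2_hom[of G, folded \<omega>_def, unfolded bimod_hom_def]
  have "?c ` mcar (Der C) = mcar (Kaehler C)"
  proof (rule antisym)
    show "?c ` mcar (Der C) \<subseteq> mcar (Kaehler C)" using hom by auto
    \<comment> \<open>The image is a submodule, and one-forms are generated by the exact ones
      dp.\<close>
    have "\<exists>\<theta>\<in>mcar (Der C). ?c \<theta> = form_cls f" for f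
    proof (induction f rule: fsum_induct)
      case (gen x)
      obtain p r where x: "x = (p, r)" by (cases x)
      obtain \<psi> where \<psi>: "\<psi> \<in> mcar (Der C)" "?c \<psi> = form_cls (dform r)" using surj by blast
      show ?case
      proof (rule bexI[OF _ Der_mleft[OF \<psi>(1)]])
        show "?c (mleft (Der C) (q p) \<psi>) = form_cls (gen x)" using hom \<psi> by (simp add: mleft_form_cls x)
      qed
    next
      case (add f g)
      obtain \<theta> where \<theta>: "\<theta> \<in> mcar (Der C)" "?c \<theta> = form_cls f" using add(1) by (rule bexE)
      obtain \<phi> where \<phi>: "\<phi> \<in> mcar (Der C)" "?c \<phi> = form_cls g" using add(2) by (rule bexE)
      show ?case
      proof (rule bexI[OF _ Der_madd[OF \<theta>(1) \<phi>(1)]])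
        show "?c (madd (Der C) \<theta> \<phi>) = form_cls (f + g)" using hom \<theta> \<phi> by (simp add: madd_form_cls)
      qed
    next
      case (scale c f)
      obtain \<theta> where \<theta>: "\<theta> \<in> mcar (Der C)" "?c \<theta> = form_cls f" using scale by (rule bexE)
      show ?case
      proof (rule bexI)
        show "?c (mscale (Der C) c \<theta>) = form_cls (fscale c f)" using hom \<theta> by (simp add: mscale_form_cls)
        show "mscale (Der C) c \<theta> \<in> mcar (Der C)" by (simp add: mscale_Der Der_mleft \<theta>)
      qed
    next
      case zero
      have "form_cls (dform 0) = form_cls 0" unfolding form_cls_eq_iff using form_val_d_scale[of 0 0] by simp
      then show ?case using surj[of 0] by simp
    qed
    then show "mcar (Kaehler C) \<subseteq> ?c ` mcar (Der C)"
      unfolding mcar_Kaehler by (metis image_eqI image_subsetI)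
  qed
  moreover have "inj_on ?c (mcar (Der C))"
  proof (rule inj_onI)
    fix \<theta> \<phi> assume \<theta>: "\<theta> \<in> mcar (Der C)" and \<phi>: "\<phi> \<in> mcar (Der C)" and eq: "?c \<theta> = ?c \<phi>"
    have pair: "q (pair_form \<psi> (contr_form \<theta> G)) = q (pair_form \<psi> (contr_form \<phi> G))" if "\<psi> \<in> mcar (Der C)" for \<psi>
      using eq that \<theta> \<phi> by (simp add: \<omega>_def contr2_form2 flip: pair_der_form_cls)
    have "\<theta> (q p) = \<phi> (q p)" for p
    proof -
      obtain \<psi> where \<psi>: "\<psi> \<in> mcar (Der C)" "?c \<psi> = form_cls (dform p)" using surj by blast
      then have k: "form_cls (dform p) = form_cls (contr_form \<psi> G)" by (simp add: \<omega>_def contr2_form2)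
      have "\<theta> (q p) = q (pair_form \<theta> (dform p))" if "\<theta> \<in> mcar (Der C)" for \<theta>
        using that by (simp add: q_der_lift)
      then have *: "\<theta> (q p) = q (- pair_form \<psi> (contr_form \<theta> G))" if "\<theta> \<in> mcar (Der C)" for \<theta>
        using that pair_der_form_cls[OF that, of "dform p"] pair_der_form_cls[OF that, of "contr_form \<psi> G"] k
        by (simp add: pair_form_contr_form_antisym[of \<theta>])
      show ?thesis
        unfolding *[OF \<theta>] *[OF \<phi>] using pair[OF \<psi>(1)] by (simp add: q_eq_iff prj_neg)
    qed
    then show "\<theta> = \<phi>"
      using \<theta> \<phi> by (intro extensionalityI[of _ "carrier C"]) (auto simp: Der_def carrier_q PiE_def)
  qed
  ultimately show ?thesis
    using contr2_hom[of G, folded \<omega>_def] by (simp add: bimod_iso_def bij_betw_def)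
qed

end

section \<open>Noncommutative forms\<close>

locale k_alg =
  fixes s :: "'k::field \<Rightarrow> 'a::{ring, monoid_mult} \<Rightarrow> 'a"
  assumes alg: "k_algebra s"
begin

sublocale vector_space s
  using alg by (simp add: k_algebra_def)

lemma s_mult: "s c a * b = s c (a * b)" "a * s c b = s c (a * b)"
  using alg unfolding k_algebra_def by metis+

definition tsq_cls :: "('a \<times> 'a \<Rightarrow>\<^sub>0 'k) \<Rightarrow> ('a \<times> 'a \<Rightarrow>\<^sub>0 'k) set" where
  "tsq_cls f = cls (tsq_sub s) f"

definition tsq_val :: "('a \<times> 'a \<Rightarrow>\<^sub>0 'k) \<Rightarrow> ('a \<times> 'a \<Rightarrow>\<^sub>0 'k)" where
  "tsq_val f = prj (tsq_sub s) f"

lemma is_span_tsq: "is_span (tsq_sub s)"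
  by (simp add: tsq_sub_def is_span_fspan)

lemma tsq_cls_eq_iff: "tsq_cls f = tsq_cls g \<longleftrightarrow> tsq_val f = tsq_val g"
  by (simp add: tsq_cls_def tsq_val_def cls_eq_iff is_span_tsq)

lemma flinear_tsq_val: "flinear tsq_val"
  unfolding tsq_val_def by (rule flinear_prj)

lemmas tsq_val_add = fl_add[OF flinear_tsq_val] and tsq_val_scale = fl_scale[OF flinear_tsq_val]
  and tsq_val_diff = fl_diff[OF flinear_tsq_val] and tsq_val_zero = fl_zero[OF flinear_tsq_val]

lemma tsq_val_rep_tsq_cls [simp]: "tsq_val (rep (tsq_cls f)) = tsq_val f"
  by (simp add: tsq_cls_def tsq_val_def is_span_tsq)

lemma tsq_cls_rep: "X \<in> range tsq_cls \<Longrightarrow> tsq_cls (rep X) = X"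
  by (elim rangeE) (simp add: tsq_cls_eq_iff)

lemma tsq_rels:
  "tsq_val (gen (a + a', b)) = tsq_val (gen (a, b)) + tsq_val (gen (a', b))"
  "tsq_val (gen (a, b + b')) = tsq_val (gen (a, b)) + tsq_val (gen (a, b'))"
  "tsq_val (gen (s c a, b)) = fscale c (tsq_val (gen (a, b)))"
  "tsq_val (gen (a, s c b)) = fscale c (tsq_val (gen (a, b)))"
proof -
  let ?R = "{gen (a + a', b) - gen (a, b) - gen (a', b) | a a' b. True} \<union>
     {gen (a, b + b') - gen (a, b) - gen (a, b') | a b b'. True} \<union>
     {gen (s c a, b) - fscale c (gen (a, b)) | c a b. True} \<union>
     {gen (a, s c b) - fscale c (gen (a, b)) | c a b. True}"
  have rel: "tsq_val r = 0" if "r \<in> ?R" for r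
    unfolding tsq_val_def prj_eq_0_is_span[OF is_span_tsq] unfolding tsq_sub_def
    by (rule fspan_simps(5)[OF that])
  have "gen (a + a', b) - gen (a, b) - gen (a', b) \<in> ?R" by blast
  from rel[OF this] show "tsq_val (gen (a + a', b)) = tsq_val (gen (a, b)) + tsq_val (gen (a', b))"
    by (simp add: tsq_val_diff diff_eq_eq add.commute)
  have "gen (a, b + b') - gen (a, b) - gen (a, b') \<in> ?R" by blast
  from rel[OF this] show "tsq_val (gen (a, b + b')) = tsq_val (gen (a, b)) + tsq_val (gen (a, b'))"
    by (simp add: tsq_val_diff diff_eq_eq add.commute)
  have "gen (s c a, b) - fscale c (gen (a, b)) \<in> ?R" by blast
  from rel[OF this] show "tsq_val (gen (s c a, b)) = fscale c (tsq_val (gen (a, b)))"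
    by (simp add: tsq_val_diff tsq_val_scale)
  have "gen (a, s c b) - fscale c (gen (a, b)) \<in> ?R" by blast
  from rel[OF this] show "tsq_val (gen (a, s c b)) = fscale c (tsq_val (gen (a, b)))"
    by (simp add: tsq_val_diff tsq_val_scale)
qed

lemma linear_rep_tsq_cls:
  fixes L :: "('a \<times> 'a \<Rightarrow>\<^sub>0 'k) \<Rightarrow> ('y \<Rightarrow>\<^sub>0 'k)"
  assumes L: "flinear L"
    and add: "\<And>a a' b. L (gen (a + a', b)) = L (gen (a, b)) + L (gen (a', b))"
      "\<And>a b b'. L (gen (a, b + b')) = L (gen (a, b)) + L (gen (a, b'))"
    and scale: "\<And>c a b. L (gen (s c a, b)) = fscale c (L (gen (a, b)))"
      "\<And>c a b. L (gen (a, s c b)) = fscale c (L (gen (a, b)))"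
  shows "L (rep (tsq_cls f)) = L f"
proof -
  have "L r = 0" if "r \<in> tsq_sub s" for r
    using that unfolding tsq_sub_def
    by (rule fspan_kernel[OF L, rotated])
      (elim UnE CollectE exE conjE; simp add: fl_diff[OF L] fl_scale[OF L] add scale)
  then show ?thesis unfolding tsq_cls_def by (intro linear_rep_cls[OF is_span_tsq L])
qed

lemma linear_tsq_val_cong:
  assumes "flinear L"
    and "\<And>a a' b. L (gen (a + a', b)) = L (gen (a, b)) + L (gen (a', b))"
      "\<And>a b b'. L (gen (a, b + b')) = L (gen (a, b)) + L (gen (a, b'))"
    and "\<And>c a b. L (gen (s c a, b)) = fscale c (L (gen (a, b)))"
      "\<And>c a b. L (gen (a, s c b)) = fscale c (L (gen (a, b)))"
    and "tsq_val f = tsq_val g"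
  shows "L f = L g"
proof -
  note r = linear_rep_tsq_cls[of L, OF assms(1-5)]
  show ?thesis using r[of f] r[of g] assms(6) by (simp flip: tsq_cls_eq_iff)
qed

definition lmul :: "'a \<Rightarrow> ('a \<times> 'a \<Rightarrow>\<^sub>0 'k) \<Rightarrow> ('a \<times> 'a \<Rightarrow>\<^sub>0 'k)" where
  "lmul a = lext (\<lambda>(x, y). gen (a * x, y))"

definition rmul :: "'a \<Rightarrow> ('a \<times> 'a \<Rightarrow>\<^sub>0 'k) \<Rightarrow> ('a \<times> 'a \<Rightarrow>\<^sub>0 'k)" where
  "rmul b = lext (\<lambda>(x, y). gen (x, y * b))"

lemma flinear_lmul: "flinear (lmul a)" and flinear_rmul: "flinear (rmul a)"
  by (simp_all add: lmul_def rmul_def flinear_lext)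

lemma lmul_gen [simp]: "lmul a (gen (x, y)) = gen (a * x, y)"
  and rmul_gen [simp]: "rmul a (gen (x, y)) = gen (x, y * a)"
  by (simp_all add: lmul_def rmul_def)

lemma tsq_val_lmul_cong: "tsq_val f = tsq_val g \<Longrightarrow> tsq_val (lmul a f) = tsq_val (lmul a g)"
  by (rule linear_tsq_val_cong[OF flinear_compose[OF flinear_lmul flinear_tsq_val]])
    (auto simp: tsq_rels distrib_left s_mult)

lemma tsq_val_rmul_cong: "tsq_val f = tsq_val g \<Longrightarrow> tsq_val (rmul a f) = tsq_val (rmul a g)"
  by (rule linear_tsq_val_cong[OF flinear_compose[OF flinear_rmul flinear_tsq_val]])
    (auto simp: tsq_rels distrib_right s_mult)

lemma lmul_one [simp]: "lmul 1 f = f"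
  by (rule flinear_ext[OF flinear_lmul flinear_id]) auto

lemma lmul_lmul: "lmul a (lmul b f) = lmul (a * b) f"
  by (rule flinear_ext[OF flinear_compose[OF flinear_lmul flinear_lmul] flinear_lmul])
    (auto simp: mult.assoc)

lemma lmul_rmul: "lmul a (rmul b f) = rmul b (lmul a f)"
  by (rule flinear_ext[OF flinear_compose[OF flinear_rmul flinear_lmul]
        flinear_compose[OF flinear_lmul flinear_rmul]]) auto

lemma lmul_left:
  "tsq_val (lmul (a + b) f) = tsq_val (lmul a f) + tsq_val (lmul b f)" "tsq_val (lmul (s c a) f) = fscale c (tsq_val (lmul a f))"
proof -
  note lin = flinear_compose[OF flinear_lmul flinear_tsq_val]
  show "tsq_val (lmul (a + b) f) = tsq_val (lmul a f) + tsq_val (lmul b f)"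
    by (rule flinear_ext[OF lin flinear_plus[OF lin lin]]) (auto simp: distrib_right tsq_rels)
  show "tsq_val (lmul (s c a) f) = fscale c (tsq_val (lmul a f))"
    by (rule flinear_ext[OF lin flinear_fscale[OF lin]]) (auto simp: s_mult tsq_rels)
qed

lemma mcar_tsq: "mcar (tsq s) = range tsq_cls"
  by (simp add: tsq_def tsq_cls_def[abs_def])

lemma tsq_ops:
  "madd (tsq s) (tsq_cls f) (tsq_cls g) = tsq_cls (f + g)" "mscale (tsq s) c (tsq_cls f) = tsq_cls (fscale c f)"
  "mleft (tsq s) a (tsq_cls f) = tsq_cls (lmul a f)" "mright (tsq s) (tsq_cls f) b = tsq_cls (rmul b f)"
proof -
  show "madd (tsq s) (tsq_cls f) (tsq_cls g) = tsq_cls (f + g)" "mscale (tsq s) c (tsq_cls f) = tsq_cls (fscale c f)"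
    by (simp_all add: tsq_def tsq_cls_eq_iff tsq_val_add tsq_val_scale flip: tsq_cls_def)
  show "mleft (tsq s) a (tsq_cls f) = tsq_cls (lmul a f)" "mright (tsq s) (tsq_cls f) b = tsq_cls (rmul b f)"
    by (simp_all add: tsq_def tsq_cls_eq_iff tsq_val_lmul_cong[OF tsq_val_rep_tsq_cls] tsq_val_rmul_cong[OF tsq_val_rep_tsq_cls]
        flip: tsq_cls_def lmul_def rmul_def)
qed

text \<open>A formal sum of pairs \<open>(x, y)\<close> stands, via \<open>ncf\<close>, for the one-form \<open>\<Sum> x dy\<close>.\<close>

definition d_rep :: "('a \<times> 'a \<Rightarrow>\<^sub>0 'k) \<Rightarrow> ('a \<times> 'a \<Rightarrow>\<^sub>0 'k)" where
  "d_rep = lext (\<lambda>(x, y). gen (x, y) - gen (x * y, 1))"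

definition ncf :: "('a \<times> 'a \<Rightarrow>\<^sub>0 'k) \<Rightarrow> ('a \<times> 'a \<Rightarrow>\<^sub>0 'k) set" where
  "ncf f = tsq_cls (d_rep f)"

text \<open>\<open>(x dy) b = x d(y b) - x y db\<close>\<close>

definition form_rmul :: "'a \<Rightarrow> ('a \<times> 'a \<Rightarrow>\<^sub>0 'k) \<Rightarrow> ('a \<times> 'a \<Rightarrow>\<^sub>0 'k)" where
  "form_rmul b = lext (\<lambda>(x, y). gen (x, y * b) - gen (x * y, b))"

lemma flinear_d_rep: "flinear d_rep" and flinear_form_rmul: "flinear (form_rmul b)"
  by (simp_all add: d_rep_def form_rmul_def flinear_lext)

lemma d_rep_gen [simp]: "d_rep (gen (x, y)) = gen (x, y) - gen (x * y, 1)"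
  and form_rmul_gen [simp]: "form_rmul b (gen (x, y)) = gen (x, y * b) - gen (x * y, b)"
  by (simp_all add: d_rep_def form_rmul_def)

section \<open>One-forms as the kernel of multiplication\<close>

definition mult_sum :: "('a \<times> 'a \<Rightarrow>\<^sub>0 'k) \<Rightarrow> 'a" where
  "mult_sum f = (\<Sum>(x, y)\<in>Poly_Mapping.keys f. s (Poly_Mapping.lookup f (x, y)) (x * y))"

lemma mult_sum_gen [simp]: "mult_sum (gen (x, y)) = x * y"
  by (simp add: mult_sum_def lookup_gen)

lemma mult_sum_superset:
  assumes "finite S" "Poly_Mapping.keys f \<subseteq> S"
  shows "mult_sum f = (\<Sum>(x, y)\<in>S. s (Poly_Mapping.lookup f (x, y)) (x * y))"
  unfolding mult_sum_def by (rule sum.mono_neutral_left) (use assms in \<open>auto simp: in_keys_iff\<close>)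

lemma mult_sum_add: "mult_sum (f + g) = mult_sum f + mult_sum g"
proof -
  let ?S = "Poly_Mapping.keys f \<union> Poly_Mapping.keys g"
  have "mult_sum (f + g) = (\<Sum>(x, y)\<in>?S. s (Poly_Mapping.lookup (f + g) (x, y)) (x * y))"
    by (rule mult_sum_superset) (use keys_add[of f g] in auto)
  also have "\<dots> = mult_sum f + mult_sum g"
    by (simp add: mult_sum_superset[of ?S] lookup_add scale_left_distrib case_prod_unfold sum.distrib)
  finally show ?thesis .
qed

lemma mult_sum_scale: "mult_sum (fscale c f) = s c (mult_sum f)"
proof -
  have "mult_sum (fscale c f) =
      (\<Sum>(x, y)\<in>Poly_Mapping.keys f. s (Poly_Mapping.lookup (fscale c f) (x, y)) (x * y))"
    by (rule mult_sum_superset[OF finite_keys keys_fscale_subset])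
  then show ?thesis by (simp add: mult_sum_def case_prod_unfold scale_sum_right)
qed

lemma mult_sum_diff: "mult_sum (f - g) = mult_sum f - mult_sum g"
  using mult_sum_add[of "f - g" g] by simp

lemma mult_sum_zero: "mult_sum 0 = 0"
  by (simp add: mult_sum_def)

lemma mult_map_tsq_cls: "mult_map s (tsq_cls f) = mult_sum f"
proof -
  have "mult_sum r = 0" if "r \<in> tsq_sub s" for r
    using that unfolding tsq_sub_def fspan_def
    by (induction rule: fvs.span_induct_alt)
      (auto simp: mult_sum_zero mult_sum_add mult_sum_scale mult_sum_diff distrib_left distrib_right s_mult)
  from this[OF rep_cls_mem[OF is_span_tsq, of f]] show ?thesis
    by (simp add: mult_map_def mult_sum_def[symmetric] mult_sum_diff tsq_cls_def)
qed

text \<open>x dy = x \<otimes> y - xy \<otimes> 1, so \<open>d_rep\<close> induces the projection of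
  A \<otimes> A onto the kernel of multiplication along A \<otimes> 1. Consequently a tensor \<Sum>
  x \<otimes> y in the kernel equals \<Sum> x dy and serves as its own presentation.\<close>

lemma tsq_val_d_rep: "tsq_val (d_rep f) = tsq_val f - tsq_val (gen (mult_sum f, 1))"
proof (induction f rule: fsum_induct)
  case zero
  show ?case using tsq_rels(3)[of 0 0 1] by (simp add: mult_sum_zero tsq_val_zero fl_zero[OF flinear_d_rep])
next
  case (gen x)
  then show ?case by (cases x) (simp add: tsq_val_diff)
next
  case (add f g)
  then show ?case by (simp add: fl_add[OF flinear_d_rep] tsq_val_add mult_sum_add tsq_rels)
next
  case (scale c f)
  then show ?case
    by (simp add: fl_scale[OF flinear_d_rep] tsq_val_scale mult_sum_scale tsq_rels fvs.scale_right_diff_distrib)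
qed

lemma mult_sum_d_rep: "mult_sum (d_rep f) = 0"
proof (induction f rule: fsum_induct)
  case (gen x)
  then show ?case by (cases x) (simp add: mult_sum_diff)
qed (simp_all add: fl_add[OF flinear_d_rep] fl_scale[OF flinear_d_rep] fl_zero[OF flinear_d_rep] mult_sum_add
    mult_sum_scale mult_sum_zero)

lemma mcar_nc_Omega1: "mcar (nc_Omega1 s) = range ncf"
proof -
  have "tsq_cls f \<in> range ncf" if "mult_sum f = 0" for f
  proof
    have "tsq_val (gen (0, 1)) = 0" using tsq_rels(3)[of 0 0 1] by simp
    then show "tsq_cls f = ncf f" using that by (simp add: ncf_def tsq_cls_eq_iff tsq_val_d_rep)
  qed simp
  then show ?thesis
    by (auto simp: nc_Omega1_def mcar_tsq mult_map_tsq_cls ncf_def mult_sum_d_rep)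
qed

lemma nc_d0_ncf: "nc_d0 s a = ncf (gen (1, a))"
  by (simp add: nc_d0_def ncf_def tsq_cls_def)

lemma ncf_ops:
  "madd (tsq s) (ncf f) (ncf g) = ncf (f + g)" "mscale (tsq s) c (ncf f) = ncf (fscale c f)"
  "mleft (tsq s) a (ncf f) = ncf (lmul a f)" "mright (tsq s) (ncf f) b = ncf (form_rmul b f)"
proof -
  show "madd (tsq s) (ncf f) (ncf g) = ncf (f + g)" "mscale (tsq s) c (ncf f) = ncf (fscale c f)"
    by (simp_all add: ncf_def tsq_ops fl_add[OF flinear_d_rep] fl_scale[OF flinear_d_rep])
  have "lmul a (d_rep f) = d_rep (lmul a f)"
    by (rule flinear_ext[OF flinear_compose[OF flinear_d_rep flinear_lmul]
          flinear_compose[OF flinear_lmul flinear_d_rep]])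
      (auto simp: fl_diff[OF flinear_lmul] mult.assoc)
  then show "mleft (tsq s) a (ncf f) = ncf (lmul a f)"
    by (simp add: ncf_def tsq_ops)
  have "rmul b (d_rep f) = d_rep (form_rmul b f)"
    by (rule flinear_ext[OF flinear_compose[OF flinear_d_rep flinear_rmul]
          flinear_compose[OF flinear_form_rmul flinear_d_rep]])
      (auto simp: fl_diff[OF flinear_rmul] fl_diff[OF flinear_d_rep] mult.assoc)
  then show "mright (tsq s) (ncf f) b = ncf (form_rmul b f)"
    by (simp add: ncf_def tsq_ops)
qed

lemma nc_Omega1_ops: "madd (nc_Omega1 s) = madd (tsq s)" "mscale (nc_Omega1 s) = mscale (tsq s)"
  "mleft (nc_Omega1 s) = mleft (tsq s)" "mright (nc_Omega1 s) = mright (tsq s)"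
  by (simp_all add: nc_Omega1_def)

sublocale nc: presented_bimodule UNIV "nc_Omega1 s" "\<lambda>a. a" ncf lmul form_rmul
  by unfold_locales (simp_all add: mcar_nc_Omega1 nc_Omega1_ops ncf_ops)

subsection \<open>The Karoubi--de Rham relations\<close>

lemma is_span_dr: "is_span (dr_sub s n)"
  by (simp add: dr_sub_def Let_def is_span_fspan)

lemma dr_sub_kernel:
  assumes L: "flinear L" and "n \<ge> 1"
    and lin: "\<And>u v. length u + length v + 1 = n \<Longrightarrow> flinear (\<lambda>f. L (gen (map ncf (u @ [f] @ v))))"
    and balance: "\<And>u v z f g. length u + length v + 2 = n \<Longrightarrow>
        L (gen (map ncf (u @ [form_rmul z f, g] @ v))) = L (gen (map ncf (u @ [f, lmul z g] @ v)))"
    and rot: "\<And>a w. length w = n \<Longrightarrow>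
        L (gen (map ncf (lmul a (hd w) # tl w))) = L (gen (map ncf (butlast w @ [form_rmul a (last w)])))"
    and comm: "\<And>u v. length u + length v = n \<Longrightarrow> u \<noteq> [] \<Longrightarrow> v \<noteq> [] \<Longrightarrow>
        L (gen (map ncf (u @ v))) = fscale ((-1) ^ (length u * length v)) (L (gen (map ncf (v @ u))))"
    and r: "r \<in> dr_sub s n"
  shows "L r = 0"
proof -
  let ?M = "nc_Omega1 s"
  have A: "L (gen (mleft ?M a (hd w) # tl w) - gen (butlast w @ [mright ?M (last w) a])) = 0"
    if w: "w \<in> mwords ?M n" for a w
  proof -
    obtain w' where w': "w = map ncf w'" "length w' = n" using nc.word_lift[OF w] by blast
    with \<open>n \<ge> 1\<close> have "w' \<noteq> []" by auto
    then show ?thesis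
      using rot[OF w'(2), of a]
      by (simp add: w' nc.mleft_pres nc.mright_pres fl_diff[OF L] hd_map last_map map_tl map_butlast)
  qed
  have B: "L (gen (u @ v) - fscale ((-1) ^ (length u * length v)) (gen (v @ u))) = 0"
    if w: "u @ v \<in> mwords ?M n" "u \<noteq> []" "v \<noteq> []" for u v
  proof -
    have "set u \<subseteq> mcar ?M" "set v \<subseteq> mcar ?M" using w by (auto simp: mwords_def)
    then obtain u' v' where *: "u = map ncf u'" "v = map ncf v'" using nc.list_lift by meson
    with w have "length u' + length v' = n" "u' \<noteq> []" "v' \<noteq> []" by (auto simp: mwords_def)
    from comm[OF this] show ?thesis by (simp add: * fl_diff[OF L] fl_scale[OF L])
  qed
  show ?thesis
    using r unfolding dr_sub_def Let_def
  proof (rule fspan_kernel[OF L, rotated])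
    fix r
    assume "r \<in> tensor_rels UNIV ?M n \<union>
     {gen (mleft ?M a (hd w) # tl w) - gen (butlast w @ [mright ?M (last w) a]) | a w.
        w \<in> mwords ?M n} \<union>
     {gen (u @ v) - fscale ((-1) ^ (length u * length v)) (gen (v @ u)) | u v.
        u @ v \<in> mwords ?M n \<and> u \<noteq> [] \<and> v \<noteq> []}"
    then show "L r = 0"
      using nc.tensor_rels_kernel[OF L lin balance] A B by (elim UnE CollectE exE conjE) simp_all
  qed
qed

lemma dr_sub2_kernel:
  assumes L: "flinear L" and M: "\<And>f g. L (gen [ncf f, ncf g]) = M f g"
    and lin: "\<And>g. flinear (\<lambda>f. M f g)" "\<And>f. flinear (M f)"
    and balance: "\<And>z f g. M (form_rmul z f) g = M f (lmul z g)" "\<And>z f g. M (lmul z f) g = M f (form_rmul z g)"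
    and comm: "\<And>f g. M f g = - M g f"
    and r: "r \<in> dr_sub s 2"
  shows "L r = 0"
proof (rule dr_sub_kernel[OF L _ _ _ _ _ r])
  fix u v :: "('a \<times> 'a \<Rightarrow>\<^sub>0 'k) list" assume "length u + length v + 1 = 2"
  then consider g where "u = []" "v = [g]" | f where "u = [f]" "v = []"
    by (cases u; cases v) auto
  then show "flinear (\<lambda>f. L (gen (map ncf (u @ [f] @ v))))"
    by cases (simp_all add: M lin)
next
  fix u v :: "('a \<times> 'a \<Rightarrow>\<^sub>0 'k) list" and z f g assume "length u + length v + 2 = 2"
  then show "L (gen (map ncf (u @ [form_rmul z f, g] @ v))) = L (gen (map ncf (u @ [f, lmul z g] @ v)))"
    by (simp add: M balance)
next
  fix w :: "('a \<times> 'a \<Rightarrow>\<^sub>0 'k) list" and a assume "length w = 2"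
  then obtain f g where "w = [f, g]" by (auto simp: numeral_2_eq_2 length_Suc_conv)
  then show "L (gen (map ncf (lmul a (hd w) # tl w))) = L (gen (map ncf (butlast w @ [form_rmul a (last w)])))"
    by (simp add: M balance)
next
  fix u v :: "('a \<times> 'a \<Rightarrow>\<^sub>0 'k) list" assume "length u + length v = 2" "u \<noteq> []" "v \<noteq> []"
  then obtain f g where "u = [f]" "v = [g]" by (cases u; cases v) auto
  then show "L (gen (map ncf (u @ v))) =
      fscale ((-1) ^ (length u * length v)) (L (gen (map ncf (v @ u))))"
    using comm[of f g] by (simp add: M fvs.scale_minus_left)
qed simp

text \<open>In degree three a commutator splits a word into lengths 1 and 2, so its sign is (-1)^2,
  and either split only demands invariance under rotation.\<close>

lemma dr_sub3_kernel:
  assumes L: "flinear L" and M: "\<And>f g h. L (gen [ncf f, ncf g, ncf h]) = M f g h"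
    and lin: "\<And>g h. flinear (\<lambda>f. M f g h)" "\<And>f h. flinear (\<lambda>g. M f g h)" "\<And>f g. flinear (M f g)"
    and balance: "\<And>z f g h. M (form_rmul z f) g h = M f (lmul z g) h"
      "\<And>z f g h. M f (form_rmul z g) h = M f g (lmul z h)" "\<And>z f g h. M (lmul z f) g h = M f g (form_rmul z h)"
    and comm: "\<And>f g h. M f g h = M g h f"
    and r: "r \<in> dr_sub s 3"
  shows "L r = 0"
proof (rule dr_sub_kernel[OF L _ _ _ _ _ r])
  fix u v :: "('a \<times> 'a \<Rightarrow>\<^sub>0 'k) list" assume "length u + length v + 1 = 3"
  then consider g h where "u = []" "v = [g, h]" | f h where "u = [f]" "v = [h]"
    | f g where "u = [f, g]" "v = []"
    by (cases u; cases "tl u"; cases v; cases "tl v") auto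
  then show "flinear (\<lambda>f. L (gen (map ncf (u @ [f] @ v))))"
    by cases (simp_all add: M lin)
next
  fix u v :: "('a \<times> 'a \<Rightarrow>\<^sub>0 'k) list" and z f g assume "length u + length v + 2 = 3"
  then consider h where "u = []" "v = [h]" | h where "u = [h]" "v = []"
    by (cases u; cases v) auto
  then show "L (gen (map ncf (u @ [form_rmul z f, g] @ v))) = L (gen (map ncf (u @ [f, lmul z g] @ v)))"
    by cases (simp_all add: M balance)
next
  fix w :: "('a \<times> 'a \<Rightarrow>\<^sub>0 'k) list" and a assume "length w = 3"
  then obtain f g h where "w = [f, g, h]" by (auto simp: numeral_3_eq_3 length_Suc_conv)
  then show "L (gen (map ncf (lmul a (hd w) # tl w))) = L (gen (map ncf (butlast w @ [form_rmul a (last w)])))"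
    by (simp add: M balance)
next
  fix u v :: "('a \<times> 'a \<Rightarrow>\<^sub>0 'k) list" assume "length u + length v = 3" "u \<noteq> []" "v \<noteq> []"
  then consider f g h where "u = [f]" "v = [g, h]" | f g h where "u = [f, g]" "v = [h]"
    by (cases u; cases "tl u"; cases v; cases "tl v") auto
  then show "L (gen (map ncf (u @ v))) =
      fscale ((-1) ^ (length u * length v)) (L (gen (map ncf (v @ u))))"
  proof cases
    case (1 f g h)
    then show ?thesis using comm[of f g h] by (simp add: M)
  next
    case (2 f g h)
    then show ?thesis using comm[of h f g] by (simp add: M)
  qed
qed simp

text \<open>Every two-form is a sum of terms \<open>a\<^sub>0 da\<^sub>1 da\<^sub>2\<close>, since
  \<open>(x dy) (z dt) = x d(y z) dt - x y dz dt\<close>.\<close>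

lemma nc_form_surj:
  assumes "\<omega> \<in> DR s 2"
  shows "\<exists>F. nc_form s F = \<omega>"
proof -
  obtain G where \<omega>: "\<omega> = cls (dr_sub s 2) G" and G: "Poly_Mapping.keys G \<subseteq> mwords (nc_Omega1 s) 2"
    using assms by (auto simp: DR_def qspace_def)
  let ?p = "prj (dr_sub s 2)"
  let ?g = "\<lambda>(a0, a1, a2). gen [mleft (nc_Omega1 s) a0 (nc_d0 s a1), nc_d0 s a2]"
  have rel: "?p r = 0" if "r \<in> tensor_rels UNIV (nc_Omega1 s) 2" for r
    unfolding prj_eq_0_is_span[OF is_span_dr] unfolding dr_sub_def Let_def
    by (rule fspan_simps(5)) (use that in blast)
  let ?M = "\<lambda>f g. ?p (gen [ncf f, ncf g])"
  have lin: "flinear (\<lambda>f. ?M f g)" "flinear (?M f)" for f g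
    using nc.flinear_word[OF flinear_prj, of "[]" "[g]" "dr_sub s 2"]
      nc.flinear_word[OF flinear_prj, of "[f]" "[]" "dr_sub s 2"] rel
    by (simp_all add: numeral_2_eq_2)
  have bal: "?M (form_rmul z f) g = ?M f (lmul z g)" for z f g
    using nc.word_balance[OF flinear_prj, of "[]" "[]" "dr_sub s 2"] rel by (simp add: numeral_2_eq_2)
  define F2 where "F2 f g = lext (\<lambda>(x, y). lext (\<lambda>(z, t). gen (x, y * z, t) - gen (x * y, z, t)) g) f"
    for f g :: "'a \<times> 'a \<Rightarrow>\<^sub>0 'k"
  have F2: "?p (lext ?g (F2 f g)) = ?M f g" for f g
  proof (rule flinear_ext2[of "\<lambda>f g. ?p (lext ?g (F2 f g))" ?M])
    show "flinear (\<lambda>f. ?p (lext ?g (F2 f g)))" for g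
      unfolding F2_def by (intro flinear_compose[OF flinear_compose[OF flinear_lext flinear_lext] flinear_prj])
    show "flinear (\<lambda>g. ?p (lext ?g (F2 f g)))" for f
      unfolding F2_def
      by (intro flinear_compose[OF flinear_compose[OF _ flinear_lext] flinear_prj] flinear_lext_param)
        (auto simp: flinear_lext)
    fix p q :: "'a \<times> 'a"
    obtain x y z t where p: "p = (x, y)" and q: "q = (z, t)" by (cases p, cases q)
    \<comment> \<open>Balance moves z across the tensor sign: (x dy) (z dt) = ((x dy) z) dt.\<close>
    have "?M (gen p) (gen q) = ?M (form_rmul z (gen (x, y))) (gen (1, t))"
      unfolding bal by (simp add: p q)
    also have "\<dots> = ?M (gen (x, y * z)) (gen (1, t)) - ?M (gen (x * y, z)) (gen (1, t))"
      by (simp add: fl_diff[OF lin(1)])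
    also have "\<dots> = ?p (lext ?g (F2 (gen p) (gen q)))"
      by (simp add: F2_def p q lext_diff prj_diff nc_d0_ncf nc_Omega1_ops ncf_ops)
    finally show "?p (lext ?g (F2 (gen p) (gen q))) = ?M (gen p) (gen q)" by simp
  qed (rule lin)+
  define l where "l = inv_into UNIV ncf"
  have l: "ncf (l X) = X" if "X \<in> mcar (nc_Omega1 s)" for X
    using that by (auto simp: mcar_nc_Omega1 l_def f_inv_into_f)
  define F where "F = lext (\<lambda>w. F2 (l (w ! 0)) (l (w ! 1))) G"
  have "?p (lext ?g F) = lext (\<lambda>w. ?p (gen w)) G"
    unfolding F_def lext_lext prj_lext
  proof (rule lext_cong)
    fix w assume "w \<in> Poly_Mapping.keys G"
    with G have "w \<in> mwords (nc_Omega1 s) 2" by blast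
    then obtain X Y where w: "w = [X, Y]" "X \<in> mcar (nc_Omega1 s)" "Y \<in> mcar (nc_Omega1 s)"
      by (auto simp: mwords_def numeral_2_eq_2 length_Suc_conv)
    then show "lext (\<lambda>x. ?p (?g x)) (F2 (l (w ! 0)) (l (w ! 1))) = ?p (gen w)"
      using F2[of "l X" "l Y"] by (simp add: prj_lext l)
  qed
  then have "nc_form s F = \<omega>"
    unfolding nc_form_def \<omega> cls_eq_iff[OF is_span_dr] by (simp flip: prj_lext)
  then show ?thesis ..
qed

subsection \<open>Double derivations\<close>

text \<open>The map \<open>i\<^sub>\<Theta>\<close> on representatives, \<open>x dy \<mapsto> x \<Theta>(y)\<close>.\<close>

definition i_rep :: "('a \<Rightarrow> ('a \<times> 'a \<Rightarrow>\<^sub>0 'k) set) \<Rightarrow> ('a \<times> 'a \<Rightarrow>\<^sub>0 'k) \<Rightarrow> ('a \<times> 'a \<Rightarrow>\<^sub>0 'k)" where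
  "i_rep \<Theta> = lext (\<lambda>(x, y). lmul x (rep (\<Theta> y)))"

lemma flinear_i_rep: "flinear (i_rep \<Theta>)"
  by (simp add: i_rep_def flinear_lext)

lemma i_rep_gen [simp]: "i_rep \<Theta> (gen (x, y)) = lmul x (rep (\<Theta> y))"
  by (simp add: i_rep_def)

lemma DDer_rels:
  assumes "\<Theta> \<in> mcar (DDer s)"
  shows "tsq_cls (rep (\<Theta> a)) = \<Theta> a"
    "tsq_val (rep (\<Theta> (a + b))) = tsq_val (rep (\<Theta> a)) + tsq_val (rep (\<Theta> b))"
    "tsq_val (rep (\<Theta> (s c a))) = fscale c (tsq_val (rep (\<Theta> a)))"
    "tsq_val (rep (\<Theta> (a * b))) = tsq_val (lmul a (rep (\<Theta> b))) + tsq_val (rmul b (rep (\<Theta> a)))"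
    "tsq_val (rep (\<Theta> 1)) = 0"
proof -
  have D: "\<And>a. \<Theta> a \<in> range tsq_cls" "\<And>a b. \<Theta> (a + b) = madd (tsq s) (\<Theta> a) (\<Theta> b)"
    "\<And>c a. \<Theta> (s c a) = mscale (tsq s) c (\<Theta> a)"
    "\<And>a b. \<Theta> (a * b) = madd (tsq s) (mleft (tsq s) a (\<Theta> b)) (mright (tsq s) (\<Theta> a) b)"
    using assms by (simp_all add: DDer_def Let_def mcar_tsq)
  show r: "tsq_cls (rep (\<Theta> a)) = \<Theta> a" for a
    by (rule tsq_cls_rep[OF D(1)])
  show "tsq_val (rep (\<Theta> (a + b))) = tsq_val (rep (\<Theta> a)) + tsq_val (rep (\<Theta> b))"
    unfolding D(2) using tsq_ops(1)[of "rep (\<Theta> a)" "rep (\<Theta> b)"] by (simp add: r tsq_val_add)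
  show "tsq_val (rep (\<Theta> (s c a))) = fscale c (tsq_val (rep (\<Theta> a)))"
    unfolding D(3) using tsq_ops(2)[of c "rep (\<Theta> a)"] by (simp add: r tsq_val_scale)
  show m: "tsq_val (rep (\<Theta> (a * b))) = tsq_val (lmul a (rep (\<Theta> b))) + tsq_val (rmul b (rep (\<Theta> a)))" for a b
    unfolding D(4)
    using tsq_ops(3)[of a "rep (\<Theta> b)"] tsq_ops(4)[of "rep (\<Theta> a)" b]
      tsq_ops(1)[of "lmul a (rep (\<Theta> b))" "rmul b (rep (\<Theta> a))"]
    by (simp add: r tsq_val_add)
  have "rmul 1 f = f" for f
    by (rule flinear_ext[OF flinear_rmul flinear_id]) auto
  then show "tsq_val (rep (\<Theta> 1)) = 0" using m[of 1 1] by simp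
qed

text \<open>\<open>i_DD\<close> is a definite description, so existence and uniqueness both have to
  be shown. Existence: x dy \<mapsto> x \<Theta>(y) respects the tensor relations and is right
  linear by the Leibniz rule. Uniqueness: the forms x dy span.\<close>

lemma i_DD_ncf:
  assumes \<Theta>: "\<Theta> \<in> mcar (DDer s)"
  shows "i_DD s \<Theta> (ncf f) = tsq_cls (i_rep \<Theta> f)"
proof -
  note D = DDer_rels[OF \<Theta>]
  have tla: "tsq_val (lmul x f) = tsq_val (lmul x g) + tsq_val (lmul x h)" if "tsq_val f = tsq_val g + tsq_val h" for x f g h
    using tsq_val_lmul_cong[of f "g + h" x] that by (simp add: tsq_val_add fl_add[OF flinear_lmul])
  have tls: "tsq_val (lmul x f) = fscale c (tsq_val (lmul x g))" if "tsq_val f = fscale c (tsq_val g)" for x f g c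
    using tsq_val_lmul_cong[of f "fscale c g" x] that by (simp add: tsq_val_scale fl_scale[OF flinear_lmul])
  have lin: "flinear (\<lambda>f. tsq_val (i_rep \<Theta> f))" by (rule flinear_compose[OF flinear_i_rep flinear_tsq_val])
  have wd: "tsq_val (i_rep \<Theta> (rep (tsq_cls f))) = tsq_val (i_rep \<Theta> f)" for f
  proof (rule linear_rep_tsq_cls[OF lin])
    show "tsq_val (i_rep \<Theta> (gen (a, b + b'))) = tsq_val (i_rep \<Theta> (gen (a, b))) + tsq_val (i_rep \<Theta> (gen (a, b')))" for a b b'
      by (simp add: tla[OF D(2)])
    show "tsq_val (i_rep \<Theta> (gen (a, s c b))) = fscale c (tsq_val (i_rep \<Theta> (gen (a, b))))" for a b c
      by (simp add: tls[OF D(3)])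
  qed (simp_all add: lmul_left)
  have one: "tsq_val (lmul x (rep (\<Theta> 1))) = 0" for x
    using tsq_val_lmul_cong[of "rep (\<Theta> 1)" 0 x] D(5) by (simp add: tsq_val_zero fl_zero[OF flinear_lmul])
  \<comment> \<open>The representative of a one-form is a tensor, and x \<otimes> y in it is read as
    x dy. The terms - xy \<otimes> 1 added by \<open>d_rep\<close> contribute - xy \<Theta>(1) =
    0.\<close>
  have d_rep: "tsq_val (i_rep \<Theta> (d_rep f)) = tsq_val (i_rep \<Theta> f)" for f
    by (rule flinear_ext[OF flinear_compose[OF flinear_d_rep lin] lin])
      (auto simp: fl_diff[OF flinear_i_rep] tsq_val_diff one)
  have lmul: "i_rep \<Theta> (lmul a f) = lmul a (i_rep \<Theta> f)" for a f
    by (rule flinear_ext[OF flinear_compose[OF flinear_lmul flinear_i_rep]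
          flinear_compose[OF flinear_i_rep flinear_lmul]]) (auto simp: lmul_lmul)
  have form_rmul: "tsq_val (i_rep \<Theta> (form_rmul b f)) = tsq_val (rmul b (i_rep \<Theta> f))" for b f
    by (rule flinear_ext[OF flinear_compose[OF flinear_form_rmul lin]
          flinear_compose[OF flinear_compose[OF flinear_i_rep flinear_rmul] flinear_tsq_val]])
      (auto simp: fl_diff[OF flinear_i_rep] tsq_val_diff tla[OF D(4)] lmul_lmul lmul_rmul)
  define h where "h = restrict (\<lambda>X. tsq_cls (i_rep \<Theta> (rep X))) (mcar (nc_Omega1 s))"
  have h: "h (ncf f) = tsq_cls (i_rep \<Theta> f)" for f
    unfolding h_def mcar_nc_Omega1 by (simp add: tsq_cls_eq_iff) (simp add: ncf_def wd d_rep)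
  have hom: "bimod_hom UNIV (nc_Omega1 s) (tsq s) h"
    unfolding bimod_hom_def nc_Omega1_ops mcar_nc_Omega1
    by (auto simp: ncf_ops h tsq_ops mcar_tsq tsq_cls_eq_iff fl_add[OF flinear_i_rep] fl_scale[OF flinear_i_rep]
        lmul form_rmul)
  have hd: "h (nc_d0 s a) = \<Theta> a" for a
    by (simp add: nc_d0_ncf h D(1))
  have "i_DD s \<Theta> = h"
    unfolding i_DD_def
  proof (rule the_equality)
    show "bimod_hom UNIV (nc_Omega1 s) (tsq s) h \<and> h \<in> extensional (mcar (nc_Omega1 s)) \<and>
      (\<forall>a. h (nc_d0 s a) = \<Theta> a)"
      using hom hd by (simp add: h_def)
  next
    fix g assume g: "bimod_hom UNIV (nc_Omega1 s) (tsq s) g \<and> g \<in> extensional (mcar (nc_Omega1 s)) \<and>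
      (\<forall>a. g (nc_d0 s a) = \<Theta> a)"
    then have g': "g (ncf (f + f')) = madd (tsq s) (g (ncf f)) (g (ncf f'))"
      "g (ncf (fscale c f)) = mscale (tsq s) c (g (ncf f))"
      "g (ncf (lmul a f)) = mleft (tsq s) a (g (ncf f))"
      "g (ncf (gen (1, a))) = \<Theta> a" for f f' c a
      by (simp_all add: bimod_hom_def nc_Omega1_ops mcar_nc_Omega1 ncf_ops flip: nc_d0_ncf)
    have on_gen: "g (ncf (gen (x, y))) = tsq_cls (i_rep \<Theta> (gen (x, y)))" for x y
      using g'(3)[of x "gen (1, y)"] tsq_ops(3)[of x "rep (\<Theta> y)"] by (simp add: g'(4) D(1))
    have "g (ncf f) = tsq_cls (i_rep \<Theta> f)" for f
    proof (induction f rule: fsum_induct)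
      case zero
      have "g (ncf 0) = g (ncf (fscale 0 (gen (1, 1))))" by simp
      also have "\<dots> = tsq_cls (fscale 0 (rep (\<Theta> 1)))"
        unfolding g'(2) g'(4) using tsq_ops(2)[of 0 "rep (\<Theta> 1)"] by (simp add: D(1))
      finally show ?case by (simp add: fl_zero[OF flinear_i_rep])
    next
      case (gen x)
      then show ?case by (cases x) (simp only: on_gen)
    qed (simp_all add: g' tsq_ops fl_add[OF flinear_i_rep] fl_scale[OF flinear_i_rep])
    then have "g X = h X" if "X \<in> mcar (nc_Omega1 s)" for X
      using that h by (auto simp: mcar_nc_Omega1)
    then show "g = h"
      using g by (intro extensionalityI[of _ "mcar (nc_Omega1 s)"]) (simp_all add: h_def)
  qed
  then show ?thesis by (simp add: h)
qed

end

section \<open>The trace map\<close>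

context presented_algebra
begin

lemma wedge_slot:
  assumes "form_val f = (\<Sum>l\<in>S. form_val (h l))"
  shows "wedge (u @ [f] @ v) = (\<Sum>l\<in>S. wedge (u @ [h l] @ v))"
proof -
  have "wedge (u @ [f] @ v) = wedge (u @ [\<Sum>l\<in>S. h l] @ v)"
    by (rule wedge_cong) (simp add: assms form_val_sum)
  also have "\<dots> = (\<Sum>l\<in>S. wedge (u @ [h l] @ v))"
    by (rule fl_sum[OF flinear_wedge])
  finally show ?thesis .
qed

lemmas wedge2_slot = wedge_slot[of f h S "[]" "[g]" for f h S g, simplified]
    wedge_slot[of f h S "[g]" "[]" for f h S g, simplified]
  and wedge3_slot = wedge_slot[of f h S "[]" "[g, g']" for f h S g g', simplified]
    wedge_slot[of f h S "[g]" "[g']" for f h S g g', simplified]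
    wedge_slot[of f h S "[g, g']" "[]" for f h S g g', simplified]

lemma prj_form2_gen: "prj (ext_sub C 2) (form2 (gen (f, g))) = wedge [f, g]"
  by (simp add: form2_def wedge_def numeral_2_eq_2)

lemma flinear_form2: "flinear form2"
  by (simp add: form2_def flinear_lext)

end

locale rep_alg = k_alg s for s :: "'k::field \<Rightarrow> 'a::{ring, monoid_mult} \<Rightarrow> 'a" +
  fixes B :: "'v set"
  assumes fin: "finite B"
begin

abbreviation C :: "('k, ('k, 'a, 'v) rep_poly set) module" where
  "C \<equiv> rep_algebra s B"

abbreviation q :: "('k, 'a, 'v) rep_poly \<Rightarrow> ('k, 'a, 'v) rep_poly set" where
  "q \<equiv> cls (rep_ideal s B)"

sublocale V: presented_algebra C q
  by (rule presented_algebra.intro[OF rep_algebra_algebra]) (simp_all add: rep_algebra_simps)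

lemma rvar_rels:
  assumes "i \<in> B" "j \<in> B"
  shows "q (rvar (a + b) i j) = q (rvar a i j + rvar b i j)"
    "q (rvar (s c a) i j) = q (fscale c (rvar a i j))"
    "q (rvar (a * b) i j) = q (\<Sum>l\<in>B. rvar a i l * rvar b l j)"
    "q (rvar 1 i j) = q (if i = j then 1 else 0)"
proof -
  note m = univ_rep_matrix_rep[OF fin, of s, unfolded matrix_rep_def, rule_format, OF assms]
  show "q (rvar (a + b) i j) = q (rvar a i j + rvar b i j)"
    "q (rvar (s c a) i j) = q (fscale c (rvar a i j))"
    "q (rvar 1 i j) = q (if i = j then 1 else 0)"
    using m by (simp_all add: univ_rep_def V.q_add V.q_smult V.q_one V.q_zero)
  show "q (rvar (a * b) i j) = q (\<Sum>l\<in>B. rvar a i l * rvar b l j)"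
    using m by (simp add: univ_rep_def V.q_mult V.q_sum fin)
qed

lemma rvar_outside: "i \<notin> B \<or> j \<notin> B \<Longrightarrow> q (rvar a i j) = q 0"
proof -
  assume "i \<notin> B \<or> j \<notin> B"
  then have "rvar a i j \<in> rep_ideal s B"
    unfolding rep_ideal_def by (intro Modules.module.span_base[OF times_module]) blast
  then show ?thesis by (simp add: cls_rep_ideal_eq)
qed

lemma form_val_rvar:
  assumes "i \<in> B" "j \<in> B"
  shows "V.form_val (gen (rvar (a + b) i j, p)) = V.form_val (gen (rvar a i j, p)) + V.form_val (gen (rvar b i j, p))"
    "V.form_val (gen (p, rvar (a + b) i j)) = V.form_val (gen (p, rvar a i j)) + V.form_val (gen (p, rvar b i j))"
    "V.form_val (gen (rvar (s c a) i j, p)) = fscale c (V.form_val (gen (rvar a i j, p)))"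
    "V.form_val (gen (p, rvar (s c a) i j)) = fscale c (V.form_val (gen (p, rvar a i j)))"
    "V.form_val (gen (rvar (a * b) i j, p)) = (\<Sum>l\<in>B. V.form_val (gen (rvar a i l * rvar b l j, p)))"
    "V.form_val (gen (p, rvar (a * b) i j)) =
      (\<Sum>l\<in>B. V.form_val (gen (p * rvar a i l, rvar b l j)) + V.form_val (gen (p * rvar b l j, rvar a i l)))"
    "V.form_val (gen (p, rvar 1 i j)) = 0"
proof -
  note r = rvar_rels[OF assms] and g = V.form_val_gen_cong
  show "V.form_val (gen (rvar (a + b) i j, p)) = V.form_val (gen (rvar a i j, p)) + V.form_val (gen (rvar b i j, p))"
    unfolding g[OF r(1) refl] by (rule V.kaehler_rels)
  show "V.form_val (gen (p, rvar (a + b) i j)) = V.form_val (gen (p, rvar a i j)) + V.form_val (gen (p, rvar b i j))"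
    unfolding g[OF refl r(1)] by (rule V.kaehler_rels)
  show "V.form_val (gen (rvar (s c a) i j, p)) = fscale c (V.form_val (gen (rvar a i j, p)))"
    unfolding g[OF r(2) refl] by (rule V.kaehler_rels)
  show "V.form_val (gen (p, rvar (s c a) i j)) = fscale c (V.form_val (gen (p, rvar a i j)))"
    unfolding g[OF refl r(2)] by (rule V.kaehler_rels)
  show "V.form_val (gen (rvar (a * b) i j, p)) = (\<Sum>l\<in>B. V.form_val (gen (rvar a i l * rvar b l j, p)))"
    unfolding g[OF r(3) refl] by (rule fl_sum[OF V.flinear_form_val_gen(1)])
  have "V.form_val (gen (p, rvar (a * b) i j)) = (\<Sum>l\<in>B. V.form_val (gen (p, rvar a i l * rvar b l j)))"
    unfolding g[OF refl r(3)] by (rule fl_sum[OF V.flinear_form_val_gen(2)])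
  then show "V.form_val (gen (p, rvar (a * b) i j)) =
      (\<Sum>l\<in>B. V.form_val (gen (p * rvar a i l, rvar b l j)) + V.form_val (gen (p * rvar b l j, rvar a i l)))"
    by (simp only: V.kaehler_rels(5))
  have "V.form_val (gen (p, 0)) = 0" using V.kaehler_rels(4)[of p 0 0] by simp
  then show "V.form_val (gen (p, rvar 1 i j)) = 0"
    unfolding g[OF refl r(4)] by (simp add: V.form_val_d_one)
qed

text \<open>The matrix \<open>\<Sum> \<pi>(x) d\<pi>(y)\<close> of the noncommutative one-form \<open>\<Sum> x dy\<close>.\<close>

definition hat :: "('a \<times> 'a \<Rightarrow>\<^sub>0 'k) \<Rightarrow> 'v \<Rightarrow> 'v \<Rightarrow> ('a \<times> 'v \<times> 'v \<Rightarrow>\<^sub>0 nat, 'k) form" where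
  "hat f i j = lext (\<lambda>(x, y). \<Sum>l\<in>B. gen (rvar x i l, rvar y l j)) f"

lemma hat_gen [simp]: "hat (gen (x, y)) i j = (\<Sum>l\<in>B. gen (rvar x i l, rvar y l j))"
  by (simp add: hat_def)

lemma flinear_hat: "flinear (\<lambda>f. hat f i j)"
  unfolding hat_def by (rule flinear_lext)

lemma flinear_form_val_hat: "flinear (\<lambda>f. V.form_val (hat f i j))"
  by (rule flinear_compose[OF flinear_hat V.flinear_form_val])

lemma form_val_hat_cong:
  assumes "i \<in> B" "j \<in> B" "tsq_val f = tsq_val g"
  shows "V.form_val (hat f i j) = V.form_val (hat g i j)"
  by (rule linear_tsq_val_cong[OF flinear_form_val_hat])
    (use assms in \<open>simp_all add: V.form_val_sum form_val_rvar sum.distrib fvs.scale_sum_right\<close>)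

text \<open>\<open>rep\<close> returns a tensor that \<open>hat\<close> reads as a sum of forms x
  dy. The terms xy \<otimes> 1 introduced by \<open>d_rep\<close> become the matrices \<pi>(xy)
  d\<pi>(1), which vanish because \<pi>(1) has constant entries.\<close>

lemma form_val_hat_rep_ncf:
  assumes "i \<in> B" "j \<in> B"
  shows "V.form_val (hat (rep (ncf f)) i j) = V.form_val (hat f i j)"
proof -
  have "V.form_val (hat (rep (ncf f)) i j) = V.form_val (hat (d_rep f) i j)"
    by (rule form_val_hat_cong[OF assms]) (simp add: ncf_def)
  also have "\<dots> = V.form_val (hat f i j)"
    by (rule flinear_ext[OF flinear_compose[OF flinear_d_rep flinear_form_val_hat] flinear_form_val_hat])
      (auto simp: fl_diff[OF flinear_form_val_hat] V.form_val_sum form_val_rvar assms)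
  finally show ?thesis .
qed

text \<open>Left multiplication by the matrix \<pi>(a). Together with
  \<open>form_val_hat_form_rmul\<close> it makes the passage to matrices a map of bimodules.\<close>

lemma form_val_hat_lmul:
  assumes "i \<in> B" "j \<in> B"
  shows "V.form_val (hat (lmul a f) i j) = (\<Sum>l\<in>B. V.form_val (V.act (rvar a i l) (hat f l j)))"
proof (rule flinear_ext[of "\<lambda>f. V.form_val (hat (lmul a f) i j)"])
  show "flinear (\<lambda>f. V.form_val (hat (lmul a f) i j))"
    by (rule flinear_compose[OF flinear_lmul flinear_form_val_hat])
  show "flinear (\<lambda>f. \<Sum>l\<in>B. V.form_val (V.act (rvar a i l) (hat f l j)))"
    by (rule flinear_sum) (rule flinear_compose[OF flinear_compose[OF flinear_hat V.flinear_act] V.flinear_form_val])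
  fix z :: "'a \<times> 'a"
  obtain x y where z: "z = (x, y)" by (cases z)
  have "V.form_val (hat (lmul a (gen z)) i j) = (\<Sum>m\<in>B. \<Sum>l\<in>B. V.form_val (gen (rvar a i l * rvar x l m, rvar y m j)))"
    by (simp add: z V.form_val_sum form_val_rvar assms)
  also have "\<dots> = (\<Sum>l\<in>B. \<Sum>m\<in>B. V.form_val (gen (rvar a i l * rvar x l m, rvar y m j)))"
    by (rule sum.swap)
  also have "\<dots> = (\<Sum>l\<in>B. V.form_val (V.act (rvar a i l) (hat (gen z) l j)))"
    by (simp add: z V.form_val_sum V.act_sum)
  finally show "V.form_val (hat (lmul a (gen z)) i j) = (\<Sum>l\<in>B. V.form_val (V.act (rvar a i l) (hat (gen z) l j)))" .
qed

text \<open>In (x dy) b = x d(yb) - xy db the product rule for d(\<pi>(y) \<pi>(b)) gives two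
  families of terms. The one with d\<pi>(b) is cancelled by xy db; the other is the matrix of x dy
  times \<pi>(b).\<close>

lemma form_val_hat_form_rmul:
  assumes "i \<in> B" "j \<in> B"
  shows "V.form_val (hat (form_rmul b f) i j) = (\<Sum>l\<in>B. V.form_val (V.act (rvar b l j) (hat f i l)))"
proof (rule flinear_ext[of "\<lambda>f. V.form_val (hat (form_rmul b f) i j)"])
  show "flinear (\<lambda>f. V.form_val (hat (form_rmul b f) i j))"
    by (rule flinear_compose[OF flinear_form_rmul flinear_form_val_hat])
  show "flinear (\<lambda>f. \<Sum>l\<in>B. V.form_val (V.act (rvar b l j) (hat f i l)))"
    by (rule flinear_sum) (rule flinear_compose[OF flinear_compose[OF flinear_hat V.flinear_act] V.flinear_form_val])
  fix z :: "'a \<times> 'a"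
  obtain x y where z: "z = (x, y)" by (cases z)
  have "V.form_val (hat (form_rmul b (gen z)) i j) =
      (\<Sum>m\<in>B. \<Sum>l\<in>B. V.form_val (gen (rvar x i m * rvar y m l, rvar b l j)) +
         V.form_val (gen (rvar x i m * rvar b l j, rvar y m l))) -
      (\<Sum>l\<in>B. \<Sum>m\<in>B. V.form_val (gen (rvar x i m * rvar y m l, rvar b l j)))"
    by (simp add: z V.form_val_sum form_val_rvar assms fl_diff[OF flinear_form_val_hat])
  also have "(\<Sum>l\<in>B. \<Sum>m\<in>B. V.form_val (gen (rvar x i m * rvar y m l, rvar b l j))) =
      (\<Sum>m\<in>B. \<Sum>l\<in>B. V.form_val (gen (rvar x i m * rvar y m l, rvar b l j)))"
    by (rule sum.swap)
  also have "(\<Sum>m\<in>B. \<Sum>l\<in>B. V.form_val (gen (rvar x i m * rvar y m l, rvar b l j)) +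
         V.form_val (gen (rvar x i m * rvar b l j, rvar y m l))) - \<dots> =
      (\<Sum>m\<in>B. \<Sum>l\<in>B. V.form_val (gen (rvar x i m * rvar b l j, rvar y m l)))"
    by (simp add: sum.distrib)
  also have "\<dots> = (\<Sum>l\<in>B. \<Sum>m\<in>B. V.form_val (gen (rvar x i m * rvar b l j, rvar y m l)))"
    by (rule sum.swap)
  also have "\<dots> = (\<Sum>l\<in>B. V.form_val (V.act (rvar b l j) (hat (gen z) i l)))"
    by (simp add: z V.form_val_sum V.act_sum mult.commute)
  finally show "V.form_val (hat (form_rmul b (gen z)) i j) = (\<Sum>l\<in>B. V.form_val (V.act (rvar b l j) (hat (gen z) i l)))" .
qed

lemma form_val_hat_d:
  assumes "i \<in> B" "j \<in> B"
  shows "V.form_val (hat (gen (1, a)) i j) = V.form_val (gen (1, rvar a i j))"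
proof -
  have z: "V.form_val (gen (0, p)) = 0" for p using V.kaehler_rels(3)[of 0 0 p] by simp
  have "V.form_val (hat (gen (1, a)) i j) = (\<Sum>l\<in>B. V.form_val (gen (if i = l then 1 else 0, rvar a l j)))"
    unfolding hat_gen V.form_val_sum
    by (intro sum.cong V.form_val_gen_cong refl) (simp add: rvar_rels(4) assms)
  also have "\<dots> = (\<Sum>l\<in>B. if i = l then V.form_val (gen (1, rvar a l j)) else 0)"
    by (intro sum.cong) (auto simp: z)
  finally show ?thesis using assms by (simp add: fin)
qed

lemma form_val_hat_rep_d:
  assumes "i \<in> B" "j \<in> B"
  shows "V.form_val (hat (rep (nc_d0 s a)) i j) = V.form_val (V.dform (rvar a i j))"
  unfolding nc_d0_ncf by (simp only: form_val_hat_rep_ncf form_val_hat_d assms)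

text \<open>The trace of the product of two matrices of one-forms, kept as a formal sum of pairs so
  that both \<open>V.form2\<close> and \<open>V.contr_form\<close> apply to it.\<close>

definition trace2 :: "('a \<times> 'a \<Rightarrow>\<^sub>0 'k) set list
    \<Rightarrow> (('a \<times> 'v \<times> 'v \<Rightarrow>\<^sub>0 nat, 'k) form \<times> ('a \<times> 'v \<times> 'v \<Rightarrow>\<^sub>0 nat, 'k) form \<Rightarrow>\<^sub>0 'k)" where
  "trace2 w = (\<Sum>i\<in>B. \<Sum>j\<in>B. gen (hat (rep (w ! 0)) i j, hat (rep (w ! 1)) j i))"

definition trace3 :: "('a \<times> 'a \<Rightarrow>\<^sub>0 'k) set list \<Rightarrow>
    ((('k, 'a, 'v) rep_poly set \<times> ('k, 'a, 'v) rep_poly set \<Rightarrow>\<^sub>0 'k) set list \<Rightarrow>\<^sub>0 'k)" where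
  "trace3 w = (\<Sum>i\<in>B. \<Sum>j\<in>B. \<Sum>k\<in>B.
     gen [V.form_cls (hat (rep (w ! 0)) i j), V.form_cls (hat (rep (w ! 1)) j k), V.form_cls (hat (rep (w ! 2)) k i)])"

section \<open>Cyclic invariance of the trace and its compatibility with d\<close>

lemma prj_trace2: "prj (ext_sub C 2) (V.form2 (trace2 [X, Y])) =
    (\<Sum>i\<in>B. \<Sum>j\<in>B. V.wedge [hat (rep X) i j, hat (rep Y) j i])"
  by (simp add: trace2_def fl_sum[OF V.flinear_form2] prj_sum V.prj_form2_gen)

lemma prj_trace3: "prj (ext_sub C 3) (trace3 [X, Y, Z]) =
    (\<Sum>i\<in>B. \<Sum>j\<in>B. \<Sum>k\<in>B. V.wedge [hat (rep X) i j, hat (rep Y) j k, hat (rep Z) k i])"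
  by (simp add: trace3_def prj_sum V.wedge_def numeral_3_eq_3)

text \<open>The relabellings of summation indices by which a matrix passes from one factor of a
  trace to its neighbour, or the whole trace is rotated.\<close>

lemma sum3_rename:
  fixes T :: "'v \<Rightarrow> 'v \<Rightarrow> 'v \<Rightarrow> 'z::comm_monoid_add"
  shows "(\<Sum>i\<in>B. \<Sum>j\<in>B. \<Sum>l\<in>B. T i j l) = (\<Sum>i\<in>B. \<Sum>j\<in>B. \<Sum>l\<in>B. T i l j)"
    "(\<Sum>i\<in>B. \<Sum>j\<in>B. \<Sum>l\<in>B. T i j l) = (\<Sum>i\<in>B. \<Sum>j\<in>B. \<Sum>l\<in>B. T l j i)"
    "(\<Sum>i\<in>B. \<Sum>j\<in>B. \<Sum>l\<in>B. T i j l) = (\<Sum>i\<in>B. \<Sum>j\<in>B. \<Sum>l\<in>B. T l i j)"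
proof -
  note r = sum.reindex_bij_witness
  show "(\<Sum>i\<in>B. \<Sum>j\<in>B. \<Sum>l\<in>B. T i j l) = (\<Sum>i\<in>B. \<Sum>j\<in>B. \<Sum>l\<in>B. T i l j)"
    unfolding sum.cartesian_product
    by (rule r[of _ "\<lambda>(i, j, l). (i, l, j)" "\<lambda>(i, j, l). (i, l, j)"]) auto
  show "(\<Sum>i\<in>B. \<Sum>j\<in>B. \<Sum>l\<in>B. T i j l) = (\<Sum>i\<in>B. \<Sum>j\<in>B. \<Sum>l\<in>B. T l j i)"
    unfolding sum.cartesian_product
    by (rule r[of _ "\<lambda>(i, j, l). (l, j, i)" "\<lambda>(i, j, l). (l, j, i)"]) auto
  show "(\<Sum>i\<in>B. \<Sum>j\<in>B. \<Sum>l\<in>B. T i j l) = (\<Sum>i\<in>B. \<Sum>j\<in>B. \<Sum>l\<in>B. T l i j)"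
    unfolding sum.cartesian_product
    by (rule r[of _ "\<lambda>(i, j, l). (l, i, j)" "\<lambda>(l, i, j). (i, j, l)"]) auto
qed

lemma sum4_rename:
  fixes T :: "'v \<Rightarrow> 'v \<Rightarrow> 'v \<Rightarrow> 'v \<Rightarrow> 'z::comm_monoid_add"
  shows "(\<Sum>i\<in>B. \<Sum>j\<in>B. \<Sum>k\<in>B. \<Sum>l\<in>B. T i j k l) = (\<Sum>i\<in>B. \<Sum>j\<in>B. \<Sum>k\<in>B. \<Sum>l\<in>B. T i l k j)"
    "(\<Sum>i\<in>B. \<Sum>j\<in>B. \<Sum>k\<in>B. \<Sum>l\<in>B. T i j k l) = (\<Sum>i\<in>B. \<Sum>j\<in>B. \<Sum>k\<in>B. \<Sum>l\<in>B. T i j l k)"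
    "(\<Sum>i\<in>B. \<Sum>j\<in>B. \<Sum>k\<in>B. \<Sum>l\<in>B. T i j k l) = (\<Sum>i\<in>B. \<Sum>j\<in>B. \<Sum>k\<in>B. \<Sum>l\<in>B. T l j k i)"
proof -
  note r = sum.reindex_bij_witness
  show "(\<Sum>i\<in>B. \<Sum>j\<in>B. \<Sum>k\<in>B. \<Sum>l\<in>B. T i j k l) = (\<Sum>i\<in>B. \<Sum>j\<in>B. \<Sum>k\<in>B. \<Sum>l\<in>B. T i l k j)"
    unfolding sum.cartesian_product
    by (rule r[of _ "\<lambda>(i, j, k, l). (i, l, k, j)" "\<lambda>(i, j, k, l). (i, l, k, j)"]) auto
  show "(\<Sum>i\<in>B. \<Sum>j\<in>B. \<Sum>k\<in>B. \<Sum>l\<in>B. T i j k l) = (\<Sum>i\<in>B. \<Sum>j\<in>B. \<Sum>k\<in>B. \<Sum>l\<in>B. T i j l k)"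
    unfolding sum.cartesian_product
    by (rule r[of _ "\<lambda>(i, j, k, l). (i, j, l, k)" "\<lambda>(i, j, k, l). (i, j, l, k)"]) auto
  show "(\<Sum>i\<in>B. \<Sum>j\<in>B. \<Sum>k\<in>B. \<Sum>l\<in>B. T i j k l) = (\<Sum>i\<in>B. \<Sum>j\<in>B. \<Sum>k\<in>B. \<Sum>l\<in>B. T l j k i)"
    unfolding sum.cartesian_product
    by (rule r[of _ "\<lambda>(i, j, k, l). (l, j, k, i)" "\<lambda>(i, j, k, l). (l, j, k, i)"]) auto
qed

text \<open>The tensor relations are respected because matrix multiplication is associative, the
  commutators because a trace is cyclic and one-forms on \<open>C\<close> anticommute.\<close>

lemma trace2_dr_sub:
  assumes "r \<in> dr_sub s 2"
  shows "prj (ext_sub C 2) (V.form2 (lext trace2 r)) = 0"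
proof (rule dr_sub2_kernel[of "\<lambda>r. prj (ext_sub C 2) (V.form2 (lext trace2 r))"
      "\<lambda>f g. \<Sum>i\<in>B. \<Sum>j\<in>B. V.wedge [hat f i j, hat g j i]"])
  show "flinear (\<lambda>r. prj (ext_sub C 2) (V.form2 (lext trace2 r)))"
    by (rule flinear_compose[OF flinear_compose[OF flinear_lext V.flinear_form2] flinear_prj])
  show "prj (ext_sub C 2) (V.form2 (lext trace2 (gen [ncf f, ncf g]))) =
      (\<Sum>i\<in>B. \<Sum>j\<in>B. V.wedge [hat f i j, hat g j i])" for f g
    unfolding lext_gen prj_trace2
    by (intro sum.cong refl V.wedge_cong) (simp add: form_val_hat_rep_ncf)
  show "flinear (\<lambda>f. \<Sum>i\<in>B. \<Sum>j\<in>B. V.wedge [hat f i j, hat g j i])" for g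
    by (intro flinear_sum flinear_compose[OF flinear_hat V.flinear_wedge2(1)])
  show "flinear (\<lambda>g. \<Sum>i\<in>B. \<Sum>j\<in>B. V.wedge [hat f i j, hat g j i])" for f
    by (intro flinear_sum flinear_compose[OF flinear_hat V.flinear_wedge2(2)])
  show "(\<Sum>i\<in>B. \<Sum>j\<in>B. V.wedge [hat (form_rmul z f) i j, hat g j i]) =
      (\<Sum>i\<in>B. \<Sum>j\<in>B. V.wedge [hat f i j, hat (lmul z g) j i])" for z f g
    by (simp add: V.wedge2_slot[OF form_val_hat_form_rmul] V.wedge2_slot[OF form_val_hat_lmul] V.wedge2_act)
      (rule sum3_rename(1))
  show "(\<Sum>i\<in>B. \<Sum>j\<in>B. V.wedge [hat (lmul z f) i j, hat g j i]) =
      (\<Sum>i\<in>B. \<Sum>j\<in>B. V.wedge [hat f i j, hat (form_rmul z g) j i])" for z f g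
    by (simp add: V.wedge2_slot[OF form_val_hat_form_rmul] V.wedge2_slot[OF form_val_hat_lmul] V.wedge2_act)
      (rule sum3_rename(2))
  show "(\<Sum>i\<in>B. \<Sum>j\<in>B. V.wedge [hat f i j, hat g j i]) =
      - (\<Sum>i\<in>B. \<Sum>j\<in>B. V.wedge [hat g i j, hat f j i])" for f g
  proof -
    have "(\<Sum>i\<in>B. \<Sum>j\<in>B. V.wedge [hat f i j, hat g j i]) = (\<Sum>i\<in>B. \<Sum>j\<in>B. - V.wedge [hat g j i, hat f i j])"
      by (intro sum.cong refl V.wedge2_swap)
    also have "\<dots> = (\<Sum>i\<in>B. \<Sum>j\<in>B. - V.wedge [hat g i j, hat f j i])"
      by (rule sum.swap)
    finally show ?thesis by (simp add: sum_negf)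
  qed
qed (rule assms)

text \<open>As in degree two, except that rotating three anticommuting factors gives no sign, which
  matches the graded commutator of a one-form with a two-form.\<close>

lemma trace3_dr_sub:
  assumes "r \<in> dr_sub s 3"
  shows "prj (ext_sub C 3) (lext trace3 r) = 0"
proof (rule dr_sub3_kernel[of "\<lambda>r. prj (ext_sub C 3) (lext trace3 r)"
      "\<lambda>f g h. \<Sum>i\<in>B. \<Sum>j\<in>B. \<Sum>k\<in>B. V.wedge [hat f i j, hat g j k, hat h k i]"])
  show "flinear (\<lambda>r. prj (ext_sub C 3) (lext trace3 r))"
    by (rule flinear_compose[OF flinear_lext flinear_prj])
  show "prj (ext_sub C 3) (lext trace3 (gen [ncf f, ncf g, ncf h])) =
      (\<Sum>i\<in>B. \<Sum>j\<in>B. \<Sum>k\<in>B. V.wedge [hat f i j, hat g j k, hat h k i])" for f g h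
    unfolding lext_gen prj_trace3
    by (intro sum.cong refl V.wedge_cong) (simp add: form_val_hat_rep_ncf)
  show "flinear (\<lambda>f. \<Sum>i\<in>B. \<Sum>j\<in>B. \<Sum>k\<in>B. V.wedge [hat f i j, hat g j k, hat h k i])" for g h
    by (intro flinear_sum flinear_compose[OF flinear_hat V.flinear_wedge3(1)])
  show "flinear (\<lambda>g. \<Sum>i\<in>B. \<Sum>j\<in>B. \<Sum>k\<in>B. V.wedge [hat f i j, hat g j k, hat h k i])" for f h
    by (intro flinear_sum flinear_compose[OF flinear_hat V.flinear_wedge3(2)])
  show "flinear (\<lambda>h. \<Sum>i\<in>B. \<Sum>j\<in>B. \<Sum>k\<in>B. V.wedge [hat f i j, hat g j k, hat h k i])" for f g
    by (intro flinear_sum flinear_compose[OF flinear_hat V.flinear_wedge3(3)])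
  show "(\<Sum>i\<in>B. \<Sum>j\<in>B. \<Sum>k\<in>B. V.wedge [hat (form_rmul z f) i j, hat g j k, hat h k i]) =
      (\<Sum>i\<in>B. \<Sum>j\<in>B. \<Sum>k\<in>B. V.wedge [hat f i j, hat (lmul z g) j k, hat h k i])" for z f g h
    by (simp add: V.wedge3_slot[OF form_val_hat_form_rmul] V.wedge3_slot[OF form_val_hat_lmul] V.wedge3_act(1))
      (rule sum4_rename(1))
  show "(\<Sum>i\<in>B. \<Sum>j\<in>B. \<Sum>k\<in>B. V.wedge [hat f i j, hat (form_rmul z g) j k, hat h k i]) =
      (\<Sum>i\<in>B. \<Sum>j\<in>B. \<Sum>k\<in>B. V.wedge [hat f i j, hat g j k, hat (lmul z h) k i])" for z f g h
    by (simp add: V.wedge3_slot[OF form_val_hat_form_rmul] V.wedge3_slot[OF form_val_hat_lmul] V.wedge3_act(2))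
      (rule sum4_rename(2))
  show "(\<Sum>i\<in>B. \<Sum>j\<in>B. \<Sum>k\<in>B. V.wedge [hat (lmul z f) i j, hat g j k, hat h k i]) =
      (\<Sum>i\<in>B. \<Sum>j\<in>B. \<Sum>k\<in>B. V.wedge [hat f i j, hat g j k, hat (form_rmul z h) k i])" for z f g h
    by (simp add: V.wedge3_slot[OF form_val_hat_form_rmul] V.wedge3_slot[OF form_val_hat_lmul] V.wedge3_act)
      (rule sum4_rename(3))
  show "(\<Sum>i\<in>B. \<Sum>j\<in>B. \<Sum>k\<in>B. V.wedge [hat f i j, hat g j k, hat h k i]) =
      (\<Sum>i\<in>B. \<Sum>j\<in>B. \<Sum>k\<in>B. V.wedge [hat g i j, hat h j k, hat f k i])" for f g h
    unfolding V.wedge3_rotate[of "hat f _ _"] by (rule sum3_rename(3))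
qed (rule assms)

text \<open>The (i, j) entry of x dy is \<Sum> x_il dy_lj, with differential \<Sum> dx_il \<and>
  dy_lj, and this is the entry of the matrix product dx dy. So d commutes with the trace word by
  word.\<close>

lemma d_trace:
  assumes G: "Poly_Mapping.keys G \<subseteq> mwords (nc_Omega1 s) 2"
  shows "prj (ext_sub C 3) (lext (d_word (comm_d0 C)) (V.form2 (lext trace2 G))) =
    prj (ext_sub C 3) (lext trace3 (lext (d_word (nc_d0 s)) G))"
proof -
  let ?p = "prj (ext_sub C 3)"
  have "?p (lext (d_word (comm_d0 C)) (V.form2 (trace2 [X, Y]))) = ?p (lext trace3 (d_word (nc_d0 s) [X, Y]))"
    for X Y
  proof -
    have dd: "V.d_wedge (hat f i j) g = lext (\<lambda>(x, y). \<Sum>l\<in>B. V.wedge [V.dform (rvar x i l), V.dform (rvar y l j), g]) f"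
      for f g i j
      unfolding hat_def flinear_lext_comp[OF V.flinear_d_wedge(1)]
      by (rule lext_cong) (auto simp: fl_sum[OF V.flinear_d_wedge(1)], simp add: V.d_wedge_def)
    have t1: "?p (trace3 [nc_d0 s x, nc_d0 s y, Y]) =
        (\<Sum>i\<in>B. \<Sum>j\<in>B. \<Sum>l\<in>B. V.wedge [V.dform (rvar x i l), V.dform (rvar y l j), hat (rep Y) j i])" for x y Y
    proof -
      have "?p (trace3 [nc_d0 s x, nc_d0 s y, Y]) =
          (\<Sum>i\<in>B. \<Sum>j\<in>B. \<Sum>k\<in>B. V.wedge [V.dform (rvar x i j), V.dform (rvar y j k), hat (rep Y) k i])"
        unfolding prj_trace3 by (intro sum.cong refl V.wedge_cong) (simp add: form_val_hat_rep_d)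
      then show ?thesis by (subst (asm) sum3_rename(1))
    qed
    \<comment> \<open>X is rotated to the end, where \<open>d_wedge\<close> keeps its
      undifferentiated factor.\<close>
    have t2: "?p (trace3 [X, nc_d0 s x, nc_d0 s y]) =
        (\<Sum>i\<in>B. \<Sum>j\<in>B. \<Sum>l\<in>B. V.wedge [V.dform (rvar x j l), V.dform (rvar y l i), hat (rep X) i j])" for x y
      unfolding prj_trace3 V.wedge3_rotate[of "hat (rep X) _ _"]
      by (intro sum.cong refl V.wedge_cong) (simp add: form_val_hat_rep_d)
    have "?p (lext (d_word (comm_d0 C)) (V.form2 (trace2 [X, Y]))) =
        (\<Sum>i\<in>B. \<Sum>j\<in>B. V.d_wedge (hat (rep X) i j) (hat (rep Y) j i)) -
        (\<Sum>i\<in>B. \<Sum>j\<in>B. V.d_wedge (hat (rep Y) j i) (hat (rep X) i j))"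
      by (simp add: trace2_def fl_sum[OF V.flinear_form2] lext_sum prj_sum V.form2_def V.prj_d_word
          sum_subtractf)
    also have "\<dots> = lext (\<lambda>(x, y). ?p (trace3 [nc_d0 s x, nc_d0 s y, Y])) (rep X) -
        lext (\<lambda>(x, y). ?p (trace3 [X, nc_d0 s x, nc_d0 s y])) (rep Y)"
      unfolding dd t1 t2 by (simp add: case_prod_unfold lext_sum_fun)
    also have "\<dots> = ?p (lext trace3 (d_word (nc_d0 s) [X, Y]))"
      by (simp add: d_word_def numeral_2_eq_2 lext_fscale_fun prj_diff prj_add prj_neg lext_lext
          lext_add lext_neg lext_diff lext_scale fvs.scale_minus_left prj_lext case_prod_unfold)
    finally show ?thesis .
  qed
  note word = this
  show ?thesis
    unfolding flinear_lext_comp[OF V.flinear_form2] lext_lext prj_lext[of _ _ G]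
  proof (rule lext_cong)
    fix w assume "w \<in> Poly_Mapping.keys G"
    with G obtain X Y where "w = [X, Y]"
      by (force simp: mwords_def numeral_2_eq_2 length_Suc_conv)
    then show "?p (lext (d_word (comm_d0 C)) (V.form2 (trace2 w))) = ?p (lext trace3 (d_word (nc_d0 s) w))"
      using word by simp
  qed
qed

text \<open>\<open>induced_form\<close> chooses a presentation by \<open>SOME\<close>. As the trace
  kills the relations, every presentation yields the class computed from any sum \<open>G\<close> of
  words for the same form, in particular from \<open>rep \<omega>\<close>.\<close>

lemma trace_form_eq:
  assumes "nc_form s F = cls (dr_sub s 2) G"
  shows "trace_form s B F = cls (ext_sub C 2) (V.form2 (lext trace2 G))"
proof -
  let ?p = "prj (ext_sub C 2)"
  let ?g = "\<lambda>(a0, a1, a2). gen [mleft (nc_Omega1 s) a0 (nc_d0 s a1), nc_d0 s a2]"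
  have "prj (dr_sub s 2) (lext ?g F - G) = 0"
    using assms by (simp add: nc_form_def cls_eq_iff[OF is_span_dr] prj_diff)
  then have "lext ?g F - G \<in> dr_sub s 2"
    by (simp add: prj_eq_0_is_span[OF is_span_dr])
  from trace2_dr_sub[OF this] have "?p (V.form2 (lext trace2 G)) = ?p (V.form2 (lext trace2 (lext ?g F)))"
    by (simp add: lext_diff fl_diff[OF V.flinear_form2] prj_diff)
  also have "\<dots> = lext (\<lambda>x. ?p (V.form2 (lext trace2 (?g x)))) F"
    unfolding lext_lext flinear_lext_comp[OF V.flinear_form2] prj_lext ..
  also have "\<dots> = lext (\<lambda>x. ?p (case x of (a0, a1, a2) \<Rightarrow> \<Sum>i\<in>B. \<Sum>j\<in>B. \<Sum>l\<in>B.
      gen [mleft (Kaehler C) (univ_rep s B a0 i j) (comm_d0 C (univ_rep s B a1 j l)),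
        comm_d0 C (univ_rep s B a2 l i)])) F"
  proof (rule lext_cong)
    fix x :: "'a \<times> 'a \<times> 'a"
    obtain a b c where x: "x = (a, b, c)" by (cases x)
    have "?p (V.form2 (lext trace2 (?g x))) =
        (\<Sum>i\<in>B. \<Sum>j\<in>B. V.wedge [hat (gen (a, b)) i j, V.dform (rvar c j i)])"
      unfolding x nc_d0_ncf nc_Omega1_ops ncf_ops split_conv lext_gen prj_trace2
      by (intro sum.cong refl V.wedge_cong) (simp add: form_val_hat_rep_ncf form_val_hat_d del: hat_gen)
    also have "\<dots> = (\<Sum>i\<in>B. \<Sum>j\<in>B. \<Sum>l\<in>B. V.wedge [gen (rvar a i l, rvar b l j), V.dform (rvar c j i)])"
      by (simp add: fl_sum[OF V.flinear_wedge2(1)])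
    also have "\<dots> = (\<Sum>i\<in>B. \<Sum>j\<in>B. \<Sum>l\<in>B. V.wedge [gen (rvar a i j, rvar b j l), V.dform (rvar c l i)])"
      by (rule sum3_rename(1))
    also have "\<dots> = ?p (case x of (a0, a1, a2) \<Rightarrow> \<Sum>i\<in>B. \<Sum>j\<in>B. \<Sum>l\<in>B.
      gen [mleft (Kaehler C) (univ_rep s B a0 i j) (comm_d0 C (univ_rep s B a1 j l)),
        comm_d0 C (univ_rep s B a2 l i)])"
      by (simp add: x univ_rep_def V.comm_d0_q V.mleft_form_cls prj_sum V.wedge_def numeral_2_eq_2)
    finally show "?p (V.form2 (lext trace2 (?g x))) = ?p (case x of (a0, a1, a2) \<Rightarrow> \<Sum>i\<in>B. \<Sum>j\<in>B. \<Sum>l\<in>B.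
      gen [mleft (Kaehler C) (univ_rep s B a0 i j) (comm_d0 C (univ_rep s B a1 j l)),
        comm_d0 C (univ_rep s B a2 l i)])" .
  qed
  finally show ?thesis
    unfolding trace_form_def Let_def cls_eq_iff[OF V.is_span_ext] prj_lext by simp
qed

end

section \<open>Derivations of the representation algebra\<close>

context presented_algebra
begin

text \<open>The dual numbers C[e] with e^2 = 0; the pair (x, x') stands for x + e x'.\<close>

definition dual :: "('k, 'c \<times> 'c) module" where
  "dual = \<lparr> carrier = carrier C \<times> carrier C,
     monoid.mult = (\<lambda>(x, x') (y, y'). (x \<otimes> y, x \<otimes> y' \<oplus> x' \<otimes> y)),
     one = (\<one>, \<zero>), zero = (\<zero>, \<zero>),
     add = (\<lambda>(x, x') (y, y'). (x \<oplus> y, x' \<oplus> y')),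
     smult = (\<lambda>c (x, x'). (c \<odot> x, c \<odot> x')) \<rparr>"

lemma dual_simps:
  "(q p, q p') \<otimes>\<^bsub>dual\<^esub> (q r, q r') = (q (p * r), q (p * r' + p' * r))"
  "(q p, q p') \<oplus>\<^bsub>dual\<^esub> (q r, q r') = (q (p + r), q (p' + r'))"
  "c \<odot>\<^bsub>dual\<^esub> (q p, q p') = (q (fscale c p), q (fscale c p'))"
  "\<one>\<^bsub>dual\<^esub> = (q 1, q 0)" "\<zero>\<^bsub>dual\<^esub> = (q 0, q 0)"
  by (simp_all add: dual_def q_add q_mult q_smult q_one q_zero)

lemma dual_carrierE:
  assumes "x \<in> carrier dual"
  obtains p p' where "x = (q p, q p')"
  using assms by (auto simp: dual_def carrier_q)

lemma dual_carrier [simp]: "(q p, q p') \<in> carrier dual"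
  by (simp add: dual_def)

lemma dual_algebra: "algebra field_ring dual"
proof (rule algebraI)
  show "cring (field_ring :: 'k ring)" by (rule cring_field_ring)
  show "cring dual"
  proof (rule cringI)
    show "abelian_group dual"
    proof (rule abelian_groupI)
      fix x assume "x \<in> carrier dual"
      then obtain p p' where "x = (q p, q p')" by (rule dual_carrierE)
      then show "\<exists>y\<in>carrier dual. y \<oplus>\<^bsub>dual\<^esub> x = \<zero>\<^bsub>dual\<^esub>"
        by (intro bexI[of _ "(q (- p), q (- p'))"]) (simp_all add: dual_simps)
    qed (auto elim!: dual_carrierE simp: dual_simps algebra_simps)
    show "Group.comm_monoid dual"
      by (rule comm_monoidI) (auto elim!: dual_carrierE simp: dual_simps algebra_simps)
  qed (auto elim!: dual_carrierE simp: dual_simps algebra_simps)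
qed (auto elim!: dual_carrierE simp: dual_simps field_ring_def fvs.scale_left_distrib
    fvs.scale_right_distrib fscale_mult)

lemma finsum_dual:
  assumes "finite S"
  shows "(\<Oplus>\<^bsub>dual\<^esub>i\<in>S. (q (f i), q (g i))) = (q (\<Sum>i\<in>S. f i), q (\<Sum>i\<in>S. g i))"
proof -
  interpret D: algebra field_ring dual by (rule dual_algebra)
  show ?thesis using assms
    by (induction S) (simp_all add: dual_simps D.finsum_insert Pi_def)
qed

end

context rep_alg
begin

text \<open>A derivation is obtained as the infinitesimal part of a homomorphism to the dual numbers,
  which exists by the universal property of the representation algebra.\<close>

lemma derivation_exists:
  assumes add: "\<And>a b i j. i \<in> B \<Longrightarrow> j \<in> B \<Longrightarrow> q (D (a + b) i j) = q (D a i j + D b i j)"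
    and scale: "\<And>c a i j. i \<in> B \<Longrightarrow> j \<in> B \<Longrightarrow> q (D (s c a) i j) = q (fscale c (D a i j))"
    and mult: "\<And>a b i j. i \<in> B \<Longrightarrow> j \<in> B \<Longrightarrow>
      q (D (a * b) i j) = q (\<Sum>l\<in>B. rvar a i l * D b l j + D a i l * rvar b l j)"
    and one: "\<And>i j. i \<in> B \<Longrightarrow> j \<in> B \<Longrightarrow> q (D 1 i j) = q 0"
  shows "\<exists>\<psi>\<in>mcar (Der C). \<forall>a. \<forall>i\<in>B. \<forall>j\<in>B. \<psi> (q (rvar a i j)) = q (D a i j)"
proof -
  let ?\<rho> = "\<lambda>a i j. (q (rvar a i j), q (D a i j))"
  have "matrix_rep s B V.dual ?\<rho>"
    unfolding matrix_rep_def
    by (auto simp: V.dual_simps V.finsum_dual fin add scale mult one rvar_rels sum.distrib)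
  from rep_algebra_universal[OF V.dual_algebra fin this] obtain \<phi> where
    hom: "alg_hom C V.dual \<phi>" and \<phi>: "\<And>a i j. i \<in> B \<Longrightarrow> j \<in> B \<Longrightarrow> \<phi> (univ_rep s B a i j) = ?\<rho> a i j"
    by blast
  interpret A: algebra field_ring C by (rule rep_algebra_algebra)
  interpret D: algebra field_ring V.dual by (rule V.dual_algebra)
  have r: "\<phi> \<in> ring_hom C V.dual" using hom by (simp add: alg_hom_def)
  have car: "\<exists>p'. \<phi> (q p) = (fst (\<phi> (q p)), q p')" for p
    using ring_hom_closed[OF r V.q_closed[of p]] by (auto elim!: V.dual_carrierE)
  have \<phi>_add: "\<phi> (q (p + r)) = \<phi> (q p) \<oplus>\<^bsub>V.dual\<^esub> \<phi> (q r)" for p r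
    using ring_hom_add[OF r V.q_closed V.q_closed, of p r] by (simp add: V.q_add)
  have \<phi>_mult: "\<phi> (q (p * r)) = \<phi> (q p) \<otimes>\<^bsub>V.dual\<^esub> \<phi> (q r)" for p r
    using ring_hom_mult[OF r V.q_closed V.q_closed, of p r] by (simp add: V.q_mult)
  have \<phi>_scale: "\<phi> (q (fscale c p)) = c \<odot>\<^bsub>V.dual\<^esub> \<phi> (q p)" for c p
    using hom V.q_closed[of p] unfolding alg_hom_def by (simp flip: V.q_smult)
  have \<phi>_zero: "\<phi> (q 0) = (q 0, q 0)"
    using ring_hom_zero[OF r A.ring_axioms D.ring_axioms] by (simp add: V.q_zero V.dual_simps)
  have \<phi>_one: "\<phi> (q 1) = (q 1, q 0)"
    using ring_hom_one[OF r] by (simp add: V.q_one V.dual_simps)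
  \<comment> \<open>The first component of \<phi> is the identity, since it is so on constants and
    generators and \<phi> is a ring homomorphism. Multiplicativity in the second component is then
    the Leibniz rule.\<close>
  have lift: "\<exists>p'. \<phi> (q p) = (q p, q p')" for p
  proof (induction p rule: rep_poly_induct)
    case (const c)
    have "\<phi> (q (Poly_Mapping.single 0 c)) = \<phi> (q (fscale c 1))" by (simp add: fscale_conv_mult)
    also have "\<dots> = (q (Poly_Mapping.single 0 c), q 0)"
      unfolding \<phi>_scale \<phi>_one by (simp add: V.dual_simps fscale_conv_mult)
    finally show ?case by blast
  next
    case (var a i j)
    show ?case
    proof (cases "i \<in> B \<and> j \<in> B")
      case True
      then show ?thesis using \<phi>[of i j a] by (auto simp: univ_rep_def)
    next
      case False
      then show ?thesis using \<phi>_zero rvar_outside[of i j a] by auto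
    qed
  next
    case (add p r)
    then obtain p' r' where "\<phi> (q p) = (q p, q p')" "\<phi> (q r) = (q r, q r')" by blast
    then show ?case by (auto simp: \<phi>_add V.dual_simps)
  next
    case (mult p r)
    then obtain p' r' where "\<phi> (q p) = (q p, q p')" "\<phi> (q r) = (q r, q r')" by blast
    then show ?case by (auto simp: \<phi>_mult V.dual_simps)
  qed
  define h where "h p = (SOME p'. \<phi> (q p) = (q p, q p'))" for p
  have h: "\<phi> (q p) = (q p, q (h p))" for p
    unfolding h_def by (rule someI_ex[OF lift])
  define \<psi> where "\<psi> = restrict (\<lambda>x. snd (\<phi> x)) (carrier C)"
  have \<psi>: "\<psi> (q p) = q (h p)" for p by (simp add: \<psi>_def h)
  have "\<psi> \<in> mcar (Der C)"
  proof (rule V.Der_memI[where h = h])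
    show "\<psi> \<in> extensional (carrier C)" by (simp add: \<psi>_def)
    show "q (h (p + r)) = q (h p + h r)" for p r
      using \<phi>_add[of p r] by (simp add: h V.dual_simps)
    show "q (h (fscale c p)) = q (fscale c (h p))" for c p
      using \<phi>_scale[of c p] by (simp add: h V.dual_simps)
    show "q (h (p * r)) = q (p * h r + h p * r)" for p r
      using \<phi>_mult[of p r] by (simp add: h V.dual_simps)
  qed (rule \<psi>)
  moreover have "\<psi> (q (rvar a i j)) = q (D a i j)" if "i \<in> B" "j \<in> B" for a i j
    using \<phi>[OF that, of a] by (simp add: \<psi>_def univ_rep_def)
  ultimately show ?thesis by blast
qed

text \<open>The value at \<open>x \<otimes> y\<close> is the product of the entries \<open>\<pi>(x)\<^sub>u\<^sub>j\<close> and \<open>\<pi>(y)\<^sub>i\<^sub>v\<close>; composed with a double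
  derivation \<open>\<Theta>\<close> it gives the derivation \<open>\<Theta>\<^sub>i\<^sub>j\<close> of \<open>C\<close> with \<open>\<pi>(a)\<^sub>u\<^sub>v \<mapsto> \<Theta>'(a)\<^sub>u\<^sub>j \<Theta>''(a)\<^sub>i\<^sub>v\<close>.\<close>

definition entry :: "'v \<Rightarrow> 'v \<Rightarrow> ('a \<times> 'a \<Rightarrow>\<^sub>0 'k) \<Rightarrow> 'v \<Rightarrow> 'v \<Rightarrow> ('k, 'a, 'v) rep_poly" where
  "entry i j f u v = lext (\<lambda>(x, y). rvar x u j * rvar y i v) f"

lemma entry_gen [simp]: "entry i j (gen (x, y)) u v = rvar x u j * rvar y i v"
  by (simp add: entry_def)

lemma flinear_entry: "flinear (\<lambda>f. entry i j f u v)"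
  unfolding entry_def by (rule flinear_lext)

lemma flinear_prj_entry: "flinear (\<lambda>f. prj V.qker (entry i j f u v))"
  by (rule flinear_compose[OF flinear_entry flinear_prj])

lemma flinear_mult: "flinear (\<lambda>p. z * p)" for z :: "('k, 'a, 'v) rep_poly"
  by (intro flinearI) (simp_all add: distrib_left fscale_mult)

lemma flinear_mult_right: "flinear (\<lambda>p. p * z)" for z :: "('k, 'a, 'v) rep_poly"
  by (intro flinearI) (simp_all add: distrib_right fscale_mult)

lemma q_entry_cong:
  assumes "i \<in> B" "j \<in> B" "u \<in> B" "v \<in> B" "tsq_val f = tsq_val g"
  shows "q (entry i j f u v) = q (entry i j g u v)"
proof -
  have c: "prj V.qker (p * r) = prj V.qker (p' * r)" "prj V.qker (r * p) = prj V.qker (r * p')"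
    if "q p = q p'" for p p' r
    using V.q_cong_mult[OF that refl] V.q_cong_mult[OF refl that] by (simp_all flip: V.q_eq_iff)
  have "prj V.qker (entry i j f u v) = prj V.qker (entry i j g u v)"
    by (rule linear_tsq_val_cong[OF flinear_prj_entry])
      (use assms in \<open>simp_all add: c[OF rvar_rels(1)] c[OF rvar_rels(2)] distrib_left distrib_right
        prj_add fscale_mult prj_scale\<close>)
  then show ?thesis by (simp add: V.q_eq_iff)
qed

text \<open>Outer multiplication by a acts on the left of x, where the outer index u sits; i and j
  are not involved. With \<open>q_entry_rmul\<close>, the outer Leibniz rule of \<Theta> becomes the
  matrix product rule required by \<open>derivation_exists\<close>.\<close>

lemma q_entry_lmul:
  assumes "u \<in> B" "j \<in> B"
  shows "q (entry i j (lmul a f) u v) = q (\<Sum>l\<in>B. rvar a u l * entry i j f l v)"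
proof -
  have "prj V.qker (entry i j (lmul a f) u v) = prj V.qker (\<Sum>l\<in>B. rvar a u l * entry i j f l v)"
  proof (rule flinear_ext[of "\<lambda>f. prj V.qker (entry i j (lmul a f) u v)" "\<lambda>f. prj V.qker (\<Sum>l\<in>B. rvar a u l * entry i j f l v)"])
    show "flinear (\<lambda>f. prj V.qker (entry i j (lmul a f) u v))"
      by (rule flinear_compose[OF flinear_lmul flinear_prj_entry])
    show "flinear (\<lambda>f. prj V.qker (\<Sum>l\<in>B. rvar a u l * entry i j f l v))"
      by (rule flinear_compose[OF _ flinear_prj], rule flinear_sum,
          rule flinear_compose[OF flinear_entry flinear_mult])
    fix z :: "'a \<times> 'a"
    obtain x y where z: "z = (x, y)" by (cases z)
    have "q (rvar (a * x) u j * rvar y i v) = q ((\<Sum>l\<in>B. rvar a u l * rvar x l j) * rvar y i v)"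
      by (rule V.q_cong_mult[OF rvar_rels(3)[OF assms] refl])
    then show "prj V.qker (entry i j (lmul a (gen z)) u v) =
        prj V.qker (\<Sum>l\<in>B. rvar a u l * entry i j (gen z) l v)"
      by (simp add: z sum_distrib_right mult.assoc flip: V.q_eq_iff)
  qed
  then show ?thesis by (simp add: V.q_eq_iff)
qed

lemma q_entry_rmul:
  assumes "i \<in> B" "v \<in> B"
  shows "q (entry i j (rmul b f) u v) = q (\<Sum>l\<in>B. entry i j f u l * rvar b l v)"
proof -
  have "prj V.qker (entry i j (rmul b f) u v) = prj V.qker (\<Sum>l\<in>B. entry i j f u l * rvar b l v)"
  proof (rule flinear_ext[of "\<lambda>f. prj V.qker (entry i j (rmul b f) u v)" "\<lambda>f. prj V.qker (\<Sum>l\<in>B. entry i j f u l * rvar b l v)"])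
    show "flinear (\<lambda>f. prj V.qker (entry i j (rmul b f) u v))"
      by (rule flinear_compose[OF flinear_rmul flinear_prj_entry])
    show "flinear (\<lambda>f. prj V.qker (\<Sum>l\<in>B. entry i j f u l * rvar b l v))"
      by (rule flinear_compose[OF _ flinear_prj], rule flinear_sum,
          rule flinear_compose[OF flinear_entry flinear_mult_right])
    fix z :: "'a \<times> 'a"
    obtain x y where z: "z = (x, y)" by (cases z)
    have "q (rvar x u j * rvar (y * b) i v) = q (rvar x u j * (\<Sum>l\<in>B. rvar y i l * rvar b l v))"
      by (rule V.q_cong_mult[OF refl rvar_rels(3)[OF assms]])
    then show "prj V.qker (entry i j (rmul b (gen z)) u v) =
        prj V.qker (\<Sum>l\<in>B. entry i j (gen z) u l * rvar b l v)"
      by (simp add: z sum_distrib_left mult.assoc flip: V.q_eq_iff)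
  qed
  then show ?thesis by (simp add: V.q_eq_iff)
qed

lemma double_derivation_entry:
  assumes \<Theta>: "\<Theta> \<in> mcar (DDer s)" and i: "i \<in> B" and j: "j \<in> B"
  shows "\<exists>\<psi>\<in>mcar (Der C). \<forall>a. \<forall>u\<in>B. \<forall>v\<in>B. \<psi> (q (rvar a u v)) = q (entry i j (rep (\<Theta> a)) u v)"
proof (rule derivation_exists)
  note D = DDer_rels[OF \<Theta>] and c = q_entry_cong[OF i j]
  fix u v a b k assume uv: "u \<in> B" "v \<in> B"
  show "q (entry i j (rep (\<Theta> (a + b))) u v) = q (entry i j (rep (\<Theta> a)) u v + entry i j (rep (\<Theta> b)) u v)"
    using c[OF uv, of "rep (\<Theta> (a + b))" "rep (\<Theta> a) + rep (\<Theta> b)"]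
    by (simp add: D tsq_val_add fl_add[OF flinear_entry])
  show "q (entry i j (rep (\<Theta> (s k a))) u v) = q (fscale k (entry i j (rep (\<Theta> a)) u v))"
    using c[OF uv, of "rep (\<Theta> (s k a))" "fscale k (rep (\<Theta> a))"]
    by (simp add: D tsq_val_scale fl_scale[OF flinear_entry])
  show "q (entry i j (rep (\<Theta> 1)) u v) = q 0"
    using c[OF uv, of "rep (\<Theta> 1)" 0] by (simp add: D tsq_val_zero fl_zero[OF flinear_entry])
  have "q (entry i j (rep (\<Theta> (a * b))) u v) =
      q (entry i j (lmul a (rep (\<Theta> b))) u v + entry i j (rmul b (rep (\<Theta> a))) u v)"
    using c[OF uv, of "rep (\<Theta> (a * b))" "lmul a (rep (\<Theta> b)) + rmul b (rep (\<Theta> a))"]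
    by (simp add: D(4) tsq_val_add fl_add[OF flinear_entry])
  also have "\<dots> = q ((\<Sum>l\<in>B. rvar a u l * entry i j (rep (\<Theta> b)) l v) +
      (\<Sum>l\<in>B. entry i j (rep (\<Theta> a)) u l * rvar b l v))"
    by (rule V.q_cong_add[OF q_entry_lmul[OF uv(1) j] q_entry_rmul[OF i uv(2)]])
  finally show "q (entry i j (rep (\<Theta> (a * b))) u v) =
      q (\<Sum>l\<in>B. rvar a u l * entry i j (rep (\<Theta> b)) l v + entry i j (rep (\<Theta> a)) u l * rvar b l v)"
    by (simp add: sum.distrib)
qed

section \<open>Contraction with the derivations attached to a double derivation\<close>

lemma q_pair_form_cong:
  assumes "\<psi> \<in> mcar (Der C)" "V.form_val f = V.form_val g"
  shows "q (V.pair_form \<psi> f) = q (V.pair_form \<psi> g)"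
  using assms by (metis V.form_cls_eq_iff V.pair_der_form_cls)

text \<open>Both sides are linear in the presentation. On x dy they are \<Sum> x_ul \<psi>(y_lv) and
  the entry of x \<Theta>(y), which \<open>q_entry_lmul\<close> identifies.\<close>

lemma q_pair_form_hat:
  assumes \<Theta>: "\<Theta> \<in> mcar (DDer s)" and ij: "i \<in> B" "j \<in> B" and \<psi>: "\<psi> \<in> mcar (Der C)"
    and val: "\<And>a u v. u \<in> B \<Longrightarrow> v \<in> B \<Longrightarrow> \<psi> (q (rvar a u v)) = q (entry i j (rep (\<Theta> a)) u v)"
    and X: "X \<in> mcar (nc_Omega1 s)" and uv: "u \<in> B" "v \<in> B"
  shows "q (V.pair_form \<psi> (hat (rep X) u v)) = q (entry i j (rep (i_DD s \<Theta> X)) u v)"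
proof -
  obtain f where f: "X = ncf f" using X by (auto simp: mcar_nc_Omega1)
  have "q (V.pair_form \<psi> (hat (rep X) u v)) = q (V.pair_form \<psi> (hat f u v))"
    by (rule q_pair_form_cong[OF \<psi>]) (simp add: f form_val_hat_rep_ncf uv)
  also have "\<dots> = q (entry i j (i_rep \<Theta> f) u v)"
  proof -
    have "prj V.qker (V.pair_form \<psi> (hat f u v)) = prj V.qker (entry i j (i_rep \<Theta> f) u v)"
    proof (rule flinear_ext[of "\<lambda>f. prj V.qker (V.pair_form \<psi> (hat f u v))" "\<lambda>f. prj V.qker (entry i j (i_rep \<Theta> f) u v)"])
      show "flinear (\<lambda>f. prj V.qker (V.pair_form \<psi> (hat f u v)))"
        by (rule flinear_compose[OF flinear_compose[OF flinear_hat V.flinear_pair_form] flinear_prj])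
      show "flinear (\<lambda>f. prj V.qker (entry i j (i_rep \<Theta> f) u v))"
        by (rule flinear_compose[OF flinear_i_rep flinear_prj_entry])
      fix z :: "'a \<times> 'a"
      obtain x y where z: "z = (x, y)" by (cases z)
      have "q (V.pair_form \<psi> (hat (gen z) u v)) = q (\<Sum>l\<in>B. rvar x u l * entry i j (rep (\<Theta> y)) l v)"
        unfolding z hat_gen fl_sum[OF V.flinear_pair_form] V.pair_form_gen
        by (intro V.q_cong_sum V.q_cong_mult refl) (simp add: V.q_der_lift \<psi> val uv)
      also have "\<dots> = q (entry i j (i_rep \<Theta> (gen z)) u v)"
        by (simp add: z q_entry_lmul uv ij)
      finally show "prj V.qker (V.pair_form \<psi> (hat (gen z) u v)) = prj V.qker (entry i j (i_rep \<Theta> (gen z)) u v)"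
        by (simp add: V.q_eq_iff)
    qed
    then show ?thesis by (simp add: V.q_eq_iff)
  qed
  also have "\<dots> = q (entry i j (rep (i_DD s \<Theta> X)) u v)"
    by (rule q_entry_cong) (simp_all add: f i_DD_ncf \<Theta> ij uv)
  finally show ?thesis .
qed

text \<open>The (i, j) entry of Y'' X Y' is \<Sum> Y''_iu X_uv Y'_vj, and Y'_vj Y''_iu is exactly
  what \<open>entry i j\<close> extracts from Y at (v, u).\<close>

lemma form_val_hat_sweedler:
  assumes ij: "i \<in> B" "j \<in> B" and X: "X \<in> mcar (nc_Omega1 s)"
  shows "V.form_val (hat (sweedler s Y X) i j) =
    (\<Sum>v\<in>B. \<Sum>u\<in>B. V.form_val (V.act (entry i j (rep Y) v u) (hat (rep X) u v)))"
proof -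
  obtain g where g: "X = ncf g" using X by (auto simp: mcar_nc_Omega1)
  have summand: "V.form_val (hat (rep (mright (tsq s) (mleft (tsq s) y X) x)) i j) =
      (\<Sum>v\<in>B. \<Sum>u\<in>B. V.form_val (V.act (rvar x v j * rvar y i u) (hat (rep X) u v)))" for x y
  proof -
    have "V.form_val (hat (rep (mright (tsq s) (mleft (tsq s) y X) x)) i j) = V.form_val (hat (form_rmul x (lmul y g)) i j)"
      by (simp add: g ncf_ops form_val_hat_rep_ncf ij)
    also have "\<dots> = (\<Sum>v\<in>B. V.form_val (V.act (rvar x v j) (hat (lmul y g) i v)))"
      by (rule form_val_hat_form_rmul[OF ij])
    also have "\<dots> = (\<Sum>v\<in>B. \<Sum>u\<in>B. V.form_val (V.act (rvar x v j * rvar y i u) (hat (rep X) u v)))"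
    proof (rule sum.cong[OF refl])
      fix v assume v: "v \<in> B"
      have "V.form_val (V.act (rvar x v j) (hat (lmul y g) i v)) =
          V.form_val (V.act (rvar x v j) (\<Sum>u\<in>B. V.act (rvar y i u) (hat g u v)))"
        by (rule V.act_cong[OF _ refl]) (simp add: form_val_hat_lmul ij v V.form_val_sum)
      also have "\<dots> = (\<Sum>u\<in>B. V.form_val (V.act (rvar x v j * rvar y i u) (hat g u v)))"
        by (simp add: V.act_sum V.act_act V.form_val_sum)
      also have "\<dots> = (\<Sum>u\<in>B. V.form_val (V.act (rvar x v j * rvar y i u) (hat (rep X) u v)))"
        by (intro sum.cong refl V.act_cong) (simp add: g form_val_hat_rep_ncf v)
      finally show "V.form_val (V.act (rvar x v j) (hat (lmul y g) i v)) =
          (\<Sum>u\<in>B. V.form_val (V.act (rvar x v j * rvar y i u) (hat (rep X) u v)))" .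
    qed
    finally show ?thesis .
  qed
  have "V.form_val (hat (sweedler s Y X) i j) =
      lext (\<lambda>(x, y). \<Sum>v\<in>B. \<Sum>u\<in>B. V.form_val (V.act (rvar x v j * rvar y i u) (hat (rep X) u v))) (rep Y)"
    unfolding sweedler_def flinear_lext_comp[OF flinear_form_val_hat]
    by (rule lext_cong) (auto simp: summand)
  also have "\<dots> = (\<Sum>v\<in>B. \<Sum>u\<in>B. V.form_val (V.act (entry i j (rep Y) v u) (hat (rep X) u v)))"
    unfolding entry_def flinear_lext_comp[OF V.flinear_act_left]
    by (simp add: case_prod_unfold lext_sum_fun)
  finally show ?thesis .
qed

text \<open>On a word [X, Y] the contracted trace is \<Sum> \<psi>(X_uv) Y_vu - \<psi>(Y_vu) X_uv.
  \<open>q_pair_form_hat\<close> turns the coefficients into entries of i_\<Theta> X and i_\<Theta>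
  Y, and \<open>form_val_hat_sweedler\<close> recognises the two terms of
  \<open>iota\<close>.\<close>

lemma contraction_hat:
  assumes \<Theta>: "\<Theta> \<in> mcar (DDer s)" and ij: "i \<in> B" "j \<in> B" and \<psi>: "\<psi> \<in> mcar (Der C)"
    and val: "\<And>a u v. u \<in> B \<Longrightarrow> v \<in> B \<Longrightarrow> \<psi> (q (rvar a u v)) = q (entry i j (rep (\<Theta> a)) u v)"
    and keys: "Poly_Mapping.keys (rep \<omega>) \<subseteq> mwords (nc_Omega1 s) 2"
  shows "V.form_val (V.contr_form \<psi> (lext trace2 (rep \<omega>))) = V.form_val (hat (rep (iota s \<omega> \<Theta>)) i j)"
proof -
  let ?sw = "\<lambda>w. sweedler s (i_DD s \<Theta> (w ! 0)) (w ! 1) - sweedler s (i_DD s \<Theta> (w ! 1)) (w ! 0)"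
  have lin: "flinear (V.contr_form \<psi>)" unfolding V.contr_form_def by (rule flinear_lext)
  have "V.form_val (hat (rep (iota s \<omega> \<Theta>)) i j) = V.form_val (hat (lext ?sw (rep \<omega>)) i j)"
    by (rule form_val_hat_cong[OF ij]) (simp add: iota_def flip: tsq_cls_def)
  also have "\<dots> = lext (\<lambda>w. V.form_val (hat (?sw w) i j)) (rep \<omega>)"
    by (rule flinear_lext_comp[OF flinear_form_val_hat])
  also have "\<dots> = lext (\<lambda>w. V.form_val (V.contr_form \<psi> (trace2 w))) (rep \<omega>)"
  proof (rule lext_cong)
    fix w assume "w \<in> Poly_Mapping.keys (rep \<omega>)"
    with keys have "w \<in> mwords (nc_Omega1 s) 2" by blast
    then obtain X Y where w: "w = [X, Y]" "X \<in> mcar (nc_Omega1 s)" "Y \<in> mcar (nc_Omega1 s)"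
      by (auto simp: mwords_def numeral_2_eq_2 length_Suc_conv)
    have sw: "V.form_val (hat (sweedler s (i_DD s \<Theta> X) Y) i j) =
        (\<Sum>v\<in>B. \<Sum>u\<in>B. V.form_val (V.act (V.pair_form \<psi> (hat (rep X) v u)) (hat (rep Y) u v)))"
      if "X \<in> mcar (nc_Omega1 s)" "Y \<in> mcar (nc_Omega1 s)" for X Y
      unfolding form_val_hat_sweedler[OF ij that(2)]
      by (intro sum.cong refl V.act_cong) (simp add: q_pair_form_hat[OF \<Theta> ij \<psi> val that(1)])
    have "V.form_val (V.contr_form \<psi> (trace2 w)) =
        (\<Sum>i\<in>B. \<Sum>j\<in>B. V.form_val (V.act (V.pair_form \<psi> (hat (rep X) i j)) (hat (rep Y) j i))) -
        (\<Sum>i\<in>B. \<Sum>j\<in>B. V.form_val (V.act (V.pair_form \<psi> (hat (rep Y) j i)) (hat (rep X) i j)))"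
      by (simp add: w trace2_def fl_sum[OF lin] V.form_val_sum V.form_val_diff sum_subtractf)
        (simp add: V.contr_form_def V.form_val_diff sum_subtractf)
    also have "(\<Sum>i\<in>B. \<Sum>j\<in>B. V.form_val (V.act (V.pair_form \<psi> (hat (rep Y) j i)) (hat (rep X) i j))) =
        (\<Sum>j\<in>B. \<Sum>i\<in>B. V.form_val (V.act (V.pair_form \<psi> (hat (rep Y) j i)) (hat (rep X) i j)))"
      by (rule sum.swap)
    finally show "V.form_val (hat (?sw w) i j) = V.form_val (V.contr_form \<psi> (trace2 w))"
      by (simp add: w fl_diff[OF flinear_form_val_hat] sw)
  qed
  also have "\<dots> = V.form_val (V.contr_form \<psi> (lext trace2 (rep \<omega>)))"
    unfolding flinear_lext_comp[OF flinear_compose[OF lin V.flinear_form_val]] ..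
  finally show ?thesis ..
qed

text \<open>A priori \<open>rep \<omega>\<close> might contain words of other lengths, or with
  letters outside the module, on which \<open>trace2\<close> and \<open>iota\<close> mean nothing.
  The relations in degree two stay within \<open>mwords\<close>, so it does not.\<close>

lemma keys_rep_DR:
  assumes "\<omega> \<in> DR s 2"
  shows "Poly_Mapping.keys (rep \<omega>) \<subseteq> mwords (nc_Omega1 s) 2" "cls (dr_sub s 2) (rep \<omega>) = \<omega>"
proof -
  let ?M = "nc_Omega1 s"
  obtain G where \<omega>: "\<omega> = cls (dr_sub s 2) G" and G: "Poly_Mapping.keys G \<subseteq> mwords ?M 2"
    using assms by (auto simp: DR_def qspace_def)
  show "cls (dr_sub s 2) (rep \<omega>) = \<omega>" by (rule cls_rep[OF is_span_dr \<omega>])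
  have closed: "madd ?M x y \<in> mcar ?M" "mscale ?M c x \<in> mcar ?M" "mleft ?M a x \<in> mcar ?M"
    "mright ?M x a \<in> mcar ?M" if "x \<in> mcar ?M" "y \<in> mcar ?M" for x y a c
    using that by (auto simp: mcar_nc_Omega1 nc_Omega1_ops ncf_ops)
  have A: "Poly_Mapping.keys (gen (mleft ?M a (hd w) # tl w) - gen (butlast w @ [mright ?M (last w) a])
      :: _ \<Rightarrow>\<^sub>0 'k) \<subseteq> mwords ?M 2" if "w \<in> mwords ?M 2" for a w
  proof -
    obtain X Y where "w = [X, Y]" "X \<in> mcar ?M" "Y \<in> mcar ?M"
      using \<open>w \<in> _\<close> by (auto simp: mwords_def numeral_2_eq_2 length_Suc_conv)
    then show ?thesis
      using keys_diff_subset by (fastforce simp: mwords_def closed)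
  qed
  have T: "Poly_Mapping.keys r \<subseteq> mwords ?M 2" if "r \<in> tensor_rels UNIV ?M 2" for r :: "_ \<Rightarrow>\<^sub>0 'k"
    using that
    by (cases rule: tensor_rels_cases)
      (auto dest!: subsetD[OF keys_diff_subset] subsetD[OF keys_fscale_subset]
        simp: mwords_def closed)
  show "Poly_Mapping.keys (rep \<omega>) \<subseteq> mwords ?M 2"
    unfolding \<omega> dr_sub_def Let_def
  proof (rule keys_rep_cls[OF _ G])
    fix r :: "_ \<Rightarrow>\<^sub>0 'k"
    assume "r \<in> tensor_rels UNIV ?M 2 \<union>
     {gen (mleft ?M a (hd w) # tl w) - gen (butlast w @ [mright ?M (last w) a]) | a w.
        w \<in> mwords ?M 2} \<union>
     {gen (u @ v) - fscale ((-1) ^ (length u * length v)) (gen (v @ u)) | u v.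
        u @ v \<in> mwords ?M 2 \<and> u \<noteq> [] \<and> v \<noteq> []}"
    then show "Poly_Mapping.keys r \<subseteq> mwords ?M 2"
    proof (elim UnE CollectE exE conjE)
      fix u v assume "r = gen (u @ v) - fscale ((-1) ^ (length u * length v)) (gen (v @ u))"
        "u @ v \<in> mwords ?M 2"
      then show ?thesis
        by (auto dest!: subsetD[OF keys_diff_subset] subsetD[OF keys_fscale_subset] simp: mwords_def)
    qed (use A T in auto)
  qed
qed

section \<open>Closedness and non-degeneracy of the trace form\<close>

theorem symplectic_trace:
  assumes \<omega>: "\<omega> \<in> DR s 2" and bi: "bisymplectic s \<omega>"
  shows "symplectic C (induced_form s B \<omega>)"
proof -
  let ?G = "lext trace2 (rep \<omega>)"
  let ?\<eta> = "cls (ext_sub C 2) (V.form2 ?G)"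
  note keys = keys_rep_DR[OF \<omega>]
  \<comment> \<open>By \<open>nc_form_surj\<close> the choice in \<open>induced_form\<close> is a
    genuine presentation of \<omega>, so it may be replaced by the trace of
    \<open>rep \<omega>\<close>.\<close>
  have "nc_form s (SOME F. nc_form s F = \<omega>) = \<omega>"
    by (rule someI_ex[OF nc_form_surj[OF \<omega>]])
  then have \<eta>: "induced_form s B \<omega> = ?\<eta>"
    unfolding induced_form_def by (intro trace_form_eq) (simp add: keys(2))
  have closed: "comm_d C 2 ?\<eta> = cls (ext_sub C 3) 0"
  proof -
    have "dr_d s 2 \<omega> = cls (dr_sub s 3) 0" using bi by (simp add: bisymplectic_def)
    then have "prj (dr_sub s 3) (lext (d_word (nc_d0 s)) (rep \<omega>)) = 0"
      by (simp add: dr_d_def cls_eq_iff is_span_dr prj_zero numeral_3_eq_3 numeral_2_eq_2)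
    then have "lext (d_word (nc_d0 s)) (rep \<omega>) \<in> dr_sub s 3"
      by (simp add: prj_eq_0_is_span is_span_dr)
    then show ?thesis
      unfolding V.comm_d_form2 d_trace[OF keys(1)] by (rule trace3_dr_sub)
  qed
  have entry: "\<exists>\<psi>\<in>mcar (Der C). contr2 C ?\<eta> \<psi> = V.form_cls (V.dform (rvar a i j))"
    if ij: "i \<in> B" "j \<in> B" for a i j
  proof -
    have "iota s \<omega> ` mcar (DDer s) = mcar (nc_Omega1 s)"
      using bi by (simp add: bisymplectic_def bimod_iso_def bij_betw_def)
    moreover have "nc_d0 s a \<in> mcar (nc_Omega1 s)" by (simp add: nc_d0_ncf mcar_nc_Omega1)
    ultimately obtain \<Theta> where \<Theta>: "\<Theta> \<in> mcar (DDer s)" "iota s \<omega> \<Theta> = nc_d0 s a"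
      by (metis imageE)
    obtain \<psi> where \<psi>: "\<psi> \<in> mcar (Der C)"
      "\<And>a u v. u \<in> B \<Longrightarrow> v \<in> B \<Longrightarrow> \<psi> (q (rvar a u v)) = q (entry i j (rep (\<Theta> a)) u v)"
      using double_derivation_entry[OF \<Theta>(1) ij] by blast
    have "V.form_val (V.contr_form \<psi> ?G) = V.form_val (V.dform (rvar a i j))"
      using contraction_hat[OF \<Theta>(1) ij \<psi> keys(1)] form_val_hat_rep_d[OF ij, of a] by (simp add: \<Theta>(2))
    then show ?thesis
      using \<psi>(1) by (intro bexI[of _ \<psi>]) (simp_all add: V.contr2_form2 V.form_cls_eq_iff)
  qed
  note hom = V.contr2_hom[of ?G, unfolded bimod_hom_def]
  \<comment> \<open>Covers the constants and the variables with an index outside \<open>B\<close>,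
    whose differentials vanish.\<close>
  have zero: "\<exists>\<psi>\<in>mcar (Der C). contr2 C ?\<eta> \<psi> = V.form_cls 0"
  proof -
    define z where "z = (\<lambda>x\<in>carrier C. q 0)"
    have z: "z \<in> mcar (Der C)"
      by (rule V.Der_memI[where h = "\<lambda>p. 0"]) (simp_all add: z_def)
    then have "contr2 C ?\<eta> (mscale (Der C) 0 z) = V.form_cls 0"
      using hom by (simp add: V.contr2_form2 V.mscale_form_cls)
    then show ?thesis using V.Der_mleft[OF z] V.mscale_Der[OF z] by metis
  qed
  \<comment> \<open>The p whose differential is a contraction are closed under products, since d(p
    r) = p dr + r dp and contraction is linear over \<open>C\<close>. They are closed under sums as
    well and contain the constants and the generators.\<close>
  have surj: "\<exists>\<psi>\<in>mcar (Der C). contr2 C ?\<eta> \<psi> = V.form_cls (V.dform p)" for p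
  proof (induction p rule: rep_poly_induct)
    case (add p r)
    then obtain \<psi> \<phi> where *: "\<psi> \<in> mcar (Der C)" "contr2 C ?\<eta> \<psi> = V.form_cls (V.dform p)"
      "\<phi> \<in> mcar (Der C)" "contr2 C ?\<eta> \<phi> = V.form_cls (V.dform r)" by blast
    have "contr2 C ?\<eta> (madd (Der C) \<psi> \<phi>) = V.form_cls (V.dform (p + r))"
      using hom * by (simp add: V.madd_form_cls V.form_cls_eq_iff V.form_val_d_add)
    then show ?case using V.Der_madd[OF *(1,3)] by blast
  next
    case (mult p r)
    then obtain \<psi> \<phi> where *: "\<psi> \<in> mcar (Der C)" "contr2 C ?\<eta> \<psi> = V.form_cls (V.dform p)"
      "\<phi> \<in> mcar (Der C)" "contr2 C ?\<eta> \<phi> = V.form_cls (V.dform r)" by blast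
    let ?\<chi> = "madd (Der C) (mleft (Der C) (q p) \<phi>) (mleft (Der C) (q r) \<psi>)"
    note cl = V.Der_mleft[OF *(3), of p] V.Der_mleft[OF *(1), of r]
    have "contr2 C ?\<eta> ?\<chi> = V.form_cls (V.dform (p * r))"
      using hom * cl V.form_val_d_mult[of p r] by (simp add: V.madd_form_cls V.mleft_form_cls V.form_cls_eq_iff)
    then show ?case using V.Der_madd[OF cl] by blast
  next
    case (const c)
    have "V.form_val (V.dform (Poly_Mapping.single 0 c)) = V.form_val 0"
      using V.form_val_d_scale[of c 1] by (simp add: fscale_conv_mult V.form_val_scale V.form_val_d_one V.form_val_zero)
    then show ?case using zero by (simp only: flip: V.form_cls_eq_iff)
  next
    case (var a i j)
    show ?case
    proof (cases "i \<in> B \<and> j \<in> B")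
      case True
      then show ?thesis using entry by blast
    next
      case False
      then have "V.form_val (V.dform (rvar a i j)) = V.form_val (V.dform 0)"
        by (intro V.form_val_gen_cong refl rvar_outside) auto
      also have "\<dots> = V.form_val 0" using V.form_val_d_scale[of 0 0] by simp
      finally show ?thesis using zero by (simp only: flip: V.form_cls_eq_iff)
    qed
  qed
  show ?thesis
    unfolding symplectic_def \<eta> using V.form2_closed closed V.contr2_iso[OF surj] by blast
qed

end

section \<open>The induced symplectic form\<close>

theorem theorem7p5:
  fixes scaleA :: "'k::field_char_0 \<Rightarrow> 'a::{ring, monoid_mult} \<Rightarrow> 'a"
    and scaleV :: "'k \<Rightarrow> 'v::ab_group_add \<Rightarrow> 'v"
    and B :: "'v set"
    and \<omega> :: "(('a \<times> 'a \<Rightarrow>\<^sub>0 'k) set list \<Rightarrow>\<^sub>0 'k) set"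
  assumes "k_algebra scaleA"
    and "smooth_algebra scaleA"
    and "finite_dimensional_vector_space scaleV B"
    and "\<omega> \<in> DR scaleA 2"
    and "bisymplectic scaleA \<omega>"
  shows "symplectic (rep_algebra scaleA B) (induced_form scaleA B \<omega>)"
proof -
  interpret rep_alg scaleA B
    by unfold_locales (rule assms(1), rule finite_dimensional_vector_space.finite_Basis[OF assms(3)])
  show ?thesis by (rule symplectic_trace[OF assms(4,5)])
qed

end
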